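(* Let $c=1+\varepsilon=1+\lambda n^{-1/3}$ (where $\lambda$ may depend on $n$). Then $$\lfloor cn\rfloor-f(n,\lfloor cn\rfloor)=\begin{cases}O(\lambda^3)&\text{if }\lambda>1,\\ \Theta(1)&\text{if }-1\le\lambda\le1,\\ \Theta(|\lambda|^{-3})&\text{if }\lambda<-1.\end{cases}$$ Furthermore, for $\lambda>1$, there is a positive absolute constant $C$ such that for any $\beta>0$, $$\Pr\left(\lfloor cn\rfloor-\max F(n,\lfloor cn\rfloor)> C\beta\lambda^3\right)\le\exp(-\beta\lambda^3).$$ Also, $$\Pr(F(n,\lfloor cn\rfloor)\text{ is satisfiable})=\begin{cases}\exp(-O(\lambda^3))&\text{if }\lambda>1,\\ \Theta(1)&\text{if }-1\le\lambda<1,\\ 1-\Theta(|\lambda|^{-3})&\text{if }\lambda<-1.\end{cases}$$ (All implied constants are absolute.)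
   Context: A random 2-SAT formula $F(n,m)$ on variables $X_1,\dots,X_n$ consists of $m$ clauses, each chosen independently and uniformly at random (with replacement) from the $2^2\binom n2$ proper clauses (disjunctions of two literals on two distinct variables). For a formula $F$, $\max F$ is the maximum over truth assignments of the number of clauses satisfied; $F$ is satisfiable if $\max F$ equals the number of clauses. $f(n,m)=\mathbb{E}[\max F(n,m)]$.
   Formalization: For λ<-1 the Θ bounds are stated for c≥κ, for each κ>0, with constants depending on κ (they fail as c→0, e.g. with no clauses); the tail bound holds for all β≥β0 with C depending on β0>0 (one C for all β>0 is impossible, e.g. at c=4). *)

theory Defs
  imports "HOL-Probability.Probability" "HOL-Library.Landau_Symbols"
begin

text \<open>The variables of a formula on \<open>n\<close> variables are the numbers \<open>0, \<dots>, n - 1\<close>. The literal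
  \<open>(i, True)\<close> is the variable \<open>i\<close> and \<open>(i, False)\<close> is its negation.\<close>

type_synonym literal = "nat \<times> bool"
type_synonym clause = "literal set"

text \<open>Clauses are unordered, so that there are \<open>2\<^sup>2 * (n choose 2)\<close> proper ones.\<close>

definition proper_clauses :: "nat \<Rightarrow> clause set" where
  "proper_clauses n = {{(i, a), (j, b)} | i a j b. i < n \<and> j < n \<and> i \<noteq> j}"

lemma proper_clauses_eq_image:
  "proper_clauses n = (\<lambda>(S, b). (\<lambda>i. (i, b i)) ` S) `
     (SIGMA S:{S. S \<subseteq> {..<n} \<and> card S = 2}. S \<rightarrow>\<^sub>E UNIV)"
proof (intro subset_antisym subsetI)
  fix C assume "C \<in> proper_clauses n"
  then obtain i a j b where C: "C = {(i, a), (j, b)}" and ij: "i < n" "j < n" "i \<noteq> j"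
    unfolding proper_clauses_def by blast
  let ?b = "restrict (\<lambda>k. if k = i then a else b) {i, j}"
  have "C = (\<lambda>(S, b). (\<lambda>i. (i, b i)) ` S) ({i, j}, ?b)"
    using ij by (auto simp: C)
  moreover have "({i, j}, ?b) \<in> (SIGMA S:{S. S \<subseteq> {..<n} \<and> card S = 2}. S \<rightarrow>\<^sub>E UNIV)"
    using ij by auto
  ultimately show "C \<in> (\<lambda>(S, b). (\<lambda>i. (i, b i)) ` S) `
     (SIGMA S:{S. S \<subseteq> {..<n} \<and> card S = 2}. S \<rightarrow>\<^sub>E UNIV)"
    by blast
next
  fix C assume "C \<in> (\<lambda>(S, b). (\<lambda>i. (i, b i)) ` S) `
     (SIGMA S:{S. S \<subseteq> {..<n} \<and> card S = 2}. S \<rightarrow>\<^sub>E (UNIV :: bool set))"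
  then obtain S b where S: "S \<subseteq> {..<n}" "card S = 2" and C: "C = (\<lambda>i. (i, b i)) ` S"
    by auto
  from S(2) obtain i j where "S = {i, j}" "i \<noteq> j"
    by (auto simp: card_2_iff)
  with S(1) have "C = {(i, b i), (j, b j)}" "i < n" "j < n" "i \<noteq> j"
    by (auto simp: C)
  then show "C \<in> proper_clauses n"
    unfolding proper_clauses_def by blast
qed

lemma card_proper_clauses: "card (proper_clauses n) = 2\<^sup>2 * (n choose 2)"
proof -
  let ?A = "SIGMA S:{S. S \<subseteq> {..<n} \<and> card S = 2}. S \<rightarrow>\<^sub>E (UNIV :: bool set)"
  have fin: "finite {S. S \<subseteq> {..<n} \<and> card S = 2}"
    by (rule finite_subset[of _ "Pow {..<n}"]) auto
  have inj: "inj_on (\<lambda>(S, b). (\<lambda>i. (i, b i :: bool)) ` S) ?A"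
  proof (rule inj_onI, clarify, rule conjI)
    fix S b S' b'
    assume b: "b \<in> S \<rightarrow>\<^sub>E (UNIV :: bool set)" and b': "b' \<in> S' \<rightarrow>\<^sub>E (UNIV :: bool set)"
      and eq: "(\<lambda>i. (i, b i)) ` S = (\<lambda>i. (i, b' i)) ` S'"
    from arg_cong[OF eq, of "image fst"] show S: "S = S'"
      by (simp add: image_image)
    show "b = b'"
    proof (rule PiE_ext[OF b])
      show "b' \<in> S \<rightarrow>\<^sub>E (UNIV :: bool set)" using b' S by simp
      fix i assume "i \<in> S"
      then have "(i, b i) \<in> (\<lambda>i. (i, b' i)) ` S'" using eq by blast
      then show "b i = b' i" by auto
    qed
  qed
  have "card (proper_clauses n) = card ?A"
    unfolding proper_clauses_eq_image using inj by (rule card_image)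
  also have "\<dots> = (\<Sum>S | S \<subseteq> {..<n} \<and> card S = 2. card (S \<rightarrow>\<^sub>E (UNIV :: bool set)))"
    using fin by (intro card_SigmaI) (auto intro!: finite_PiE intro: finite_subset)
  also have "\<dots> = (\<Sum>S | S \<subseteq> {..<n} \<and> card S = 2. 2\<^sup>2)"
  proof (rule sum.cong[OF refl])
    fix S assume "S \<in> {S. S \<subseteq> {..<n} \<and> card S = 2}"
    then have "finite S" "card S = 2" by (auto intro: finite_subset)
    then show "card (S \<rightarrow>\<^sub>E (UNIV :: bool set)) = 2\<^sup>2"
      by (simp add: card_PiE)
  qed
  also have "\<dots> = 2\<^sup>2 * (n choose 2)"
    using n_subsets[of "{..<n}" 2] by simp
  finally show ?thesis .
qed

text \<open>Formulas are lists, since clauses are drawn with replacement and counted with multiplicity.\<close>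

type_synonym formula = "clause list"

definition clause_sat :: "(nat \<Rightarrow> bool) \<Rightarrow> clause \<Rightarrow> bool" where
  "clause_sat \<sigma> C \<longleftrightarrow> (\<exists>(i, a) \<in> C. \<sigma> i = a)"

definition num_sat :: "(nat \<Rightarrow> bool) \<Rightarrow> formula \<Rightarrow> nat" where
  "num_sat \<sigma> F = length (filter (clause_sat \<sigma>) F)"

text \<open>Assignments are total on \<open>nat\<close>; the values outside the variables of \<open>F\<close> are irrelevant.
  The set below is finite, being bounded by \<open>length F\<close>.\<close>

definition max_sat :: "formula \<Rightarrow> nat" where
  "max_sat F = Max (range (\<lambda>\<sigma>. num_sat \<sigma> F))"

lemma finite_range_num_sat: "finite (range (\<lambda>\<sigma>. num_sat \<sigma> F))"
  by (rule finite_subset[of _ "{..length F}"]) (auto simp: num_sat_def)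

definition satisfiable :: "formula \<Rightarrow> bool" where
  "satisfiable F \<longleftrightarrow> max_sat F = length F"

text \<open>\<open>F(n,m)\<close>, which is meaningful for \<open>n \<ge> 2\<close> only: otherwise there is no proper clause.\<close>

definition random_formula :: "nat \<Rightarrow> nat \<Rightarrow> formula pmf" where
  "random_formula n m = replicate_pmf m (pmf_of_set (proper_clauses n))"

definition expected_max_sat :: "nat \<Rightarrow> nat \<Rightarrow> real" where
  "expected_max_sat n m = measure_pmf.expectation (random_formula n m) (\<lambda>F. real (max_sat F))"

definition prob_satisfiable :: "nat \<Rightarrow> nat \<Rightarrow> real" where
  "prob_satisfiable n m = measure_pmf.prob (random_formula n m) {F. satisfiable F}"

definition clause_density :: "nat \<Rightarrow> real \<Rightarrow> real" where
  "clause_density n l = 1 + l * real n powr (- 1 / 3)"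

text \<open>The number \<open>\<lfloor>c n\<rfloor>\<close> of clauses; \<open>nat\<close> truncates only if \<open>c < 0\<close>.\<close>

definition num_clauses :: "nat \<Rightarrow> real \<Rightarrow> nat" where
  "num_clauses n l = nat \<lfloor>clause_density n l * real n\<rfloor>"

text \<open>The filter expressing ``as \<open>n \<rightarrow> \<infinity>\<close>, uniformly over all \<open>\<lambda>\<close> with \<open>R n \<lambda>\<close>''. The constants in
  Landau symbols over this filter depend neither on \<open>n\<close> nor on \<open>\<lambda>\<close>, so that \<open>\<lambda>\<close> may be an
  arbitrary function of \<open>n\<close> with values in the given range.\<close>

definition regime :: "(nat \<Rightarrow> real \<Rightarrow> bool) \<Rightarrow> (nat \<times> real) filter" where
  "regime R = inf (filtercomap fst sequentially) (principal {(n, l). R n l})"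

lemma eventually_regime:
  "eventually P (regime R) \<longleftrightarrow> (\<exists>N. \<forall>n\<ge>N. \<forall>l. R n l \<longrightarrow> P (n, l))"
proof -
  have "eventually P (regime R) \<longleftrightarrow>
      (\<exists>Q. (\<exists>N. \<forall>n\<ge>N. Q n) \<and> (\<forall>x. Q (fst x) \<longrightarrow> x \<in> {(n, l). R n l} \<longrightarrow> P x))"
    unfolding regime_def eventually_inf_principal eventually_filtercomap
      eventually_sequentially ..
  also have "\<dots> \<longleftrightarrow> (\<exists>N. \<forall>n\<ge>N. \<forall>l. R n l \<longrightarrow> P (n, l))"
  proof
    assume "\<exists>N. \<forall>n\<ge>N. \<forall>l. R n l \<longrightarrow> P (n, l)"
    then obtain N where "\<forall>n\<ge>N. \<forall>l. R n l \<longrightarrow> P (n, l)" ..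
    then show "\<exists>Q. (\<exists>N. \<forall>n\<ge>N. Q n) \<and> (\<forall>x. Q (fst x) \<longrightarrow> x \<in> {(n, l). R n l} \<longrightarrow> P x)"
      by (intro exI[of _ "\<lambda>n. n \<ge> N"]) auto
  qed fastforce
  finally show ?thesis .
qed

text \<open>Two degenerate ranges, where bounds with absolute constants fail. If \<open>c\<close> may tend to \<open>0\<close>,
  then the lower bound \<open>\<Omega>(\<bar>\<lambda>\<bar>\<^sup>-\<^sup>3)\<close> fails for \<open>\<lambda> < -1\<close>: the formula may even be empty.\<close>

lemma unsat_lower_bound_fails_for_small_density:
  "(\<lambda>(n, l). 1 - prob_satisfiable n (num_clauses n l))
     \<notin> \<Omega>[regime (\<lambda>n l. l < -1 \<and> clause_density n l > 0)](\<lambda>(n, l). \<bar>l\<bar> powi (-3))"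
proof
  assume "(\<lambda>(n, l). 1 - prob_satisfiable n (num_clauses n l))
     \<in> \<Omega>[regime (\<lambda>n l. l < -1 \<and> clause_density n l > 0)](\<lambda>(n, l). \<bar>l\<bar> powi (-3))"
  then obtain A where A: "A > 0"
    and ev: "eventually (\<lambda>x. norm (case x of (n, l) \<Rightarrow> 1 - prob_satisfiable n (num_clauses n l)) \<ge>
      A * norm (case x of (n, l) \<Rightarrow> \<bar>l\<bar> powi (-3))) (regime (\<lambda>n l. l < -1 \<and> clause_density n l > 0))"
    unfolding bigomega_def by blast
  from ev obtain N where N: "\<And>n l. n \<ge> N \<Longrightarrow> l < -1 \<Longrightarrow> clause_density n l > 0 \<Longrightarrow>
      \<bar>1 - prob_satisfiable n (num_clauses n l)\<bar> \<ge> A * \<bar>\<bar>l\<bar> powi (-3)\<bar>"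
    unfolding eventually_regime by force
  define n where "n = max N 8"
  define l where "l = - (1 - 1 / (2 * real n)) * real n powr (1 / 3)"
  have n: "n \<ge> N" "n \<ge> 8" by (auto simp: n_def)
  have "real n powr (1 / 3) * real n powr (- 1 / 3) = 1"
    using n by (simp flip: powr_add)
  then have dens: "clause_density n l = 1 / (2 * real n)"
    unfolding clause_density_def l_def by (simp add: algebra_simps)
  have "(8::real) powr (1 / 3) = 2"
  proof -
    have "(8::real) = 2 powr 3" by simp
    then show ?thesis by (simp only: powr_powr) simp
  qed
  then have "2 \<le> real n powr (1 / 3)"
    using powr_mono2[of "1 / 3" 8 "real n"] n by simp
  moreover have "1 - 1 / (2 * real n) \<ge> 15 / 16"
    using n by (simp add: field_simps)
  ultimately have "(15 / 16) * 2 \<le> (1 - 1 / (2 * real n)) * real n powr (1 / 3)"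
    by (intro mult_mono) auto
  then have l: "l < -1" unfolding l_def minus_mult_left[symmetric] by linarith
  have "num_clauses n l = 0"
    using n by (simp add: num_clauses_def dens)
  moreover have "range (\<lambda>\<sigma>. num_sat \<sigma> []) = {0}"
    by (auto simp: num_sat_def)
  ultimately have "prob_satisfiable n (num_clauses n l) = 1"
    by (simp add: prob_satisfiable_def random_formula_def satisfiable_def max_sat_def)
  moreover have "\<bar>\<bar>l\<bar> powi (-3)\<bar> > 0" using l by simp
  ultimately show False
    using N[OF n(1) l] dens n A by (simp add: mult_le_0_iff)
qed

text \<open>The tail bound fails if \<open>\<beta>\<close> may tend to \<open>0\<close> and \<open>C\<close> may not depend on \<open>\<beta>\<close>: for
  \<open>C \<beta> \<lambda>\<^sup>3 < 1\<close>, it would bound the probability of unsatisfiability away from \<open>1\<close>.\<close>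

lemma max_sat_le: "max_sat F \<le> length F"
  unfolding max_sat_def using finite_range_num_sat
  by (subst Max_le_iff) (auto simp: num_sat_def)

lemma satisfiable_iff: "satisfiable F \<longleftrightarrow> (\<exists>\<sigma>. \<forall>C \<in> set F. clause_sat \<sigma> C)"
proof
  assume "satisfiable F"
  moreover have "max_sat F \<in> range (\<lambda>\<sigma>. num_sat \<sigma> F)"
    unfolding max_sat_def using finite_range_num_sat by (intro Max_in) auto
  ultimately obtain \<sigma> where "num_sat \<sigma> F = length F"
    unfolding satisfiable_def by auto
  then have "\<forall>C \<in> set F. clause_sat \<sigma> C"
    unfolding num_sat_def using length_filter_less[of _ F "clause_sat \<sigma>"] by fastforce
  then show "\<exists>\<sigma>. \<forall>C \<in> set F. clause_sat \<sigma> C" by (rule exI[of _ \<sigma>])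
next
  assume "\<exists>\<sigma>. \<forall>C \<in> set F. clause_sat \<sigma> C"
  then obtain \<sigma> where "\<forall>C \<in> set F. clause_sat \<sigma> C" ..
  then have "num_sat \<sigma> F = length F" by (simp add: num_sat_def)
  then have "length F \<le> max_sat F"
    unfolding max_sat_def using Max_ge[OF finite_range_num_sat rangeI, of \<sigma> F] by simp
  then show "satisfiable F"
    unfolding satisfiable_def using max_sat_le[of F] by simp
qed

lemma finite_proper_clauses: "finite (proper_clauses n)"
  by (rule finite_subset[of _ "Pow ({..<n} \<times> UNIV)"]) (auto simp: proper_clauses_def)

lemma replicate_pmf_of_set:
  assumes "finite A" "A \<noteq> {}"
  shows "replicate_pmf m (pmf_of_set A) = pmf_of_set {xs. set xs \<subseteq> A \<and> length xs = m}"
proof (rule pmf_eqI)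
  fix xs
  have fin: "finite {xs. set xs \<subseteq> A \<and> length xs = m}" for m
    using assms(1) by (rule finite_lists_length_eq)
  have ne: "{xs. set xs \<subseteq> A \<and> length xs = m} \<noteq> {}" for m
    using assms(2) by (auto intro!: exI[of _ "replicate m (SOME x. x \<in> A)"] simp: some_in_eq)
  have "pmf (replicate_pmf m (pmf_of_set A)) xs =
      (if length xs = m then prod_list (map (pmf (pmf_of_set A)) xs) else 0)" for m
  proof (induction m arbitrary: xs)
    case (Suc m)
    have eq: "replicate_pmf (Suc m) (pmf_of_set A) =
        map_pmf (\<lambda>(x, xs). x # xs) (pair_pmf (pmf_of_set A) (replicate_pmf m (pmf_of_set A)))"
      by (simp add: pair_pmf_def map_bind_pmf)
    show ?case
    proof (cases xs)
      case Nil
      then show ?thesis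
        unfolding eq by (auto simp: pmf_eq_0_set_pmf)
    next
      case (Cons y ys)
      have "pmf (replicate_pmf (Suc m) (pmf_of_set A)) ((\<lambda>(x, xs). x # xs) (y, ys)) =
          pmf (pair_pmf (pmf_of_set A) (replicate_pmf m (pmf_of_set A))) (y, ys)"
        unfolding eq by (rule pmf_map_inj') (auto simp: inj_def)
      then show ?thesis
        by (simp add: Cons pmf_pair Suc.IH)
    qed
  qed (auto simp: indicator_def)
  moreover have "prod_list (map (pmf (pmf_of_set A)) xs) =
      (if set xs \<subseteq> A then 1 / real (card A) ^ length xs else 0)"
    using assms by (induction xs) (auto simp: indicator_def)
  ultimately show "pmf (replicate_pmf m (pmf_of_set A)) xs =
      pmf (pmf_of_set {xs. set xs \<subseteq> A \<and> length xs = m}) xs"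
    using assms fin ne by (auto simp: card_lists_length_eq indicator_def)
qed

lemma card_clause_sat:
  "card {C \<in> proper_clauses n. clause_sat \<sigma> C} \<le> 3 * (n choose 2)"
proof -
  let ?g = "\<lambda>S. (\<lambda>i. (i, \<not> \<sigma> i)) ` S"
  let ?P = "{S. S \<subseteq> {..<n} \<and> card S = 2}"
  have inj: "inj_on ?g ?P"
    by (rule inj_on_inverseI[of _ "image fst"]) (simp add: image_image)
  have sub: "?g ` ?P \<subseteq> proper_clauses n"
  proof clarify
    fix S assume S: "S \<subseteq> {..<n}" "card S = 2"
    from S(2) obtain i j where "S = {i, j}" "i \<noteq> j" by (auto simp: card_2_iff)
    with S(1) have "?g S = {(i, \<not> \<sigma> i), (j, \<not> \<sigma> j)}" "i < n" "j < n" "i \<noteq> j" by auto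
    then show "?g S \<in> proper_clauses n" unfolding proper_clauses_def by blast
  qed
  have "{C \<in> proper_clauses n. clause_sat \<sigma> C} \<subseteq> proper_clauses n - ?g ` ?P"
    by (auto simp: clause_sat_def)
  then have "card {C \<in> proper_clauses n. clause_sat \<sigma> C} \<le> card (proper_clauses n - ?g ` ?P)"
    using finite_proper_clauses by (intro card_mono) auto
  also have "\<dots> = card (proper_clauses n) - card (?g ` ?P)"
    using sub finite_proper_clauses by (intro card_Diff_subset) (auto intro: finite_subset)
  also have "card (?g ` ?P) = n choose 2"
    using card_image[OF inj] n_subsets[of "{..<n}" 2] by simp
  finally show ?thesis by (simp add: card_proper_clauses)
qed

lemma prob_satisfiable_le:
  assumes "n \<ge> 2"
  shows "prob_satisfiable n m \<le> 2 ^ n * (3 / 4) ^ m"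
proof -
  let ?A = "proper_clauses n"
  let ?B = "\<lambda>\<sigma>. {C \<in> ?A. clause_sat \<sigma> C}"
  let ?L = "\<lambda>A. {xs. set xs \<subseteq> A \<and> length xs = m}"
  let ?S = "{..<n} \<rightarrow>\<^sub>E (UNIV :: bool set)"
  have ch: "n choose 2 > 0" using assms by (simp add: zero_less_binomial)
  have fin: "finite A \<Longrightarrow> finite (?L A)" for A :: "clause set"
    by (rule finite_lists_length_eq)
  have ne: "?A \<noteq> {}" using ch card_proper_clauses[of n] by auto
  have cardL: "card (?L ?A) = (4 * (n choose 2)) ^ m"
    using finite_proper_clauses[of n] by (simp add: card_lists_length_eq card_proper_clauses)
  then have "card (?L ?A) > 0" using ch by simp
  then have neL: "?L ?A \<noteq> {}" by (simp only: card_gt_0_iff simp_thms)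
  have sub: "?L ?A \<inter> {F. satisfiable F} \<subseteq> (\<Union>\<sigma>\<in>?S. ?L (?B \<sigma>))"
  proof
    fix F assume F: "F \<in> ?L ?A \<inter> {F. satisfiable F}"
    then obtain \<sigma> where \<sigma>: "\<forall>C\<in>set F. clause_sat \<sigma> C" by (auto simp: satisfiable_iff)
    have "clause_sat (restrict \<sigma> {..<n}) C" if "C \<in> set F" for C
    proof -
      from that F have "C \<in> ?A" by auto
      then obtain i a j b where "C = {(i, a), (j, b)}" "i < n" "j < n"
        unfolding proper_clauses_def by blast
      with \<sigma> that show ?thesis by (force simp: clause_sat_def)
    qed
    with F have "F \<in> ?L (?B (restrict \<sigma> {..<n}))" by auto
    moreover have "restrict \<sigma> {..<n} \<in> ?S" by auto
    ultimately show "F \<in> (\<Union>\<sigma>\<in>?S. ?L (?B \<sigma>))" by blast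
  qed
  have finS: "finite ?S" by (intro finite_PiE) auto
  have "card (?L ?A \<inter> {F. satisfiable F}) \<le> card (\<Union>\<sigma>\<in>?S. ?L (?B \<sigma>))"
    using finS finite_proper_clauses by (intro card_mono[OF _ sub] finite_UN_I fin) auto
  also have "\<dots> \<le> (\<Sum>\<sigma>\<in>?S. card (?L (?B \<sigma>)))"
    by (rule card_UN_le[OF finS])
  also have "\<dots> \<le> (\<Sum>\<sigma>\<in>?S. (3 * (n choose 2)) ^ m)"
  proof (rule sum_mono)
    fix \<sigma>
    have "card (?L (?B \<sigma>)) = card (?B \<sigma>) ^ m"
      using finite_proper_clauses by (intro card_lists_length_eq) auto
    then show "card (?L (?B \<sigma>)) \<le> (3 * (n choose 2)) ^ m"
      using card_clause_sat[of n \<sigma>] by (simp only: power_mono)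
  qed
  also have "\<dots> = 2 ^ n * (3 * (n choose 2)) ^ m"
    by (simp add: card_PiE)
  finally have le: "card (?L ?A \<inter> {F. satisfiable F}) \<le> 2 ^ n * (3 * (n choose 2)) ^ m" .
  have "prob_satisfiable n m = real (card (?L ?A \<inter> {F. satisfiable F})) / real (card (?L ?A))"
    unfolding prob_satisfiable_def random_formula_def
      replicate_pmf_of_set[OF finite_proper_clauses ne]
    by (rule measure_pmf_of_set[OF neL fin[OF finite_proper_clauses]])
  also have "\<dots> \<le> real (2 ^ n * (3 * (n choose 2)) ^ m) / real (card (?L ?A))"
    using le by (intro divide_right_mono) (simp_all only: of_nat_le_iff of_nat_0_le_iff)
  also have "\<dots> = 2 ^ n * (3 / 4) ^ m"
    unfolding cardL using ch by (simp add: power_mult_distrib power_divide)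
  finally show ?thesis .
qed

lemma tail_bound_fails_for_small_beta:
  "\<not> (\<exists>C>0. \<exists>N. \<forall>\<beta>>0. \<forall>n\<ge>N. \<forall>l>1.
        measure_pmf.prob (random_formula n (num_clauses n l))
          {F. real (num_clauses n l) - real (max_sat F) > C * \<beta> * l ^ 3}
        \<le> exp (- \<beta> * l ^ 3))"
proof clarify
  fix C :: real and N
  assume C: "C > 0" and bound: "\<forall>\<beta>>0. \<forall>n\<ge>N. \<forall>l>1.
        measure_pmf.prob (random_formula n (num_clauses n l))
          {F. real (num_clauses n l) - real (max_sat F) > C * \<beta> * l ^ 3}
        \<le> exp (- \<beta> * l ^ 3)"
  define q where "q = 1 - exp (- 1 / (2 * C))"
  have "q > 0" using C by (simp add: q_def)
  then have "eventually (\<lambda>n. (162 / 256 :: real) ^ n < q) sequentially"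
    by (intro order_tendstoD(2)[OF LIMSEQ_realpow_zero]) auto
  then obtain M where M: "\<And>n. n \<ge> M \<Longrightarrow> (162 / 256 :: real) ^ n < q"
    by (auto simp: eventually_sequentially)
  define n where "n = max M (max N 2)"
  have n: "n \<ge> M" "n \<ge> N" "n \<ge> 2" by (auto simp: n_def)
  define l where "l = 3 * real n powr (1 / 3)"
  have "1 \<le> real n powr (1 / 3)" using n by (intro ge_one_powr_ge_zero) auto
  then have l: "l > 1" by (simp add: l_def)
  have "real n powr (1 / 3) * real n powr (- 1 / 3) = 1"
    using n by (simp flip: powr_add)
  then have "clause_density n l = 4" unfolding clause_density_def l_def by simp
  then have "num_clauses n l = nat \<lfloor>real (4 * n)\<rfloor>" by (simp add: num_clauses_def)
  then have m: "num_clauses n l = 4 * n" by (simp only: floor_of_nat nat_int)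
  define \<beta> where "\<beta> = 1 / (2 * C * l ^ 3)"
  have \<beta>: "\<beta> > 0" "\<beta> * l ^ 3 = 1 / (2 * C)" "C * \<beta> * l ^ 3 = 1 / 2"
    using C l by (auto simp: \<beta>_def)
  let ?p = "random_formula n (4 * n)"
  let ?D = "{F. real (4 * n) - real (max_sat F) > 1 / 2}"
  have len: "length F = 4 * n" if "F \<in> set_pmf ?p" for F
    using that by (simp add: random_formula_def set_replicate_pmf)
  have "measure_pmf.prob ?p (- {F. satisfiable F}) = measure_pmf.prob ?p (- {F. satisfiable F} \<inter> set_pmf ?p)"
    by (simp add: measure_Int_set_pmf)
  also have "\<dots> \<le> measure_pmf.prob ?p ?D"
  proof (rule measure_pmf.finite_measure_mono)
    show "- {F. satisfiable F} \<inter> set_pmf ?p \<subseteq> ?D"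
    proof
      fix F assume F: "F \<in> - {F. satisfiable F} \<inter> set_pmf ?p"
      then have "max_sat F < length F" using max_sat_le[of F] by (auto simp: satisfiable_def)
      with F len[of F] show "F \<in> ?D" by simp
    qed
  qed simp
  also have "\<dots> \<le> exp (- \<beta> * l ^ 3)"
    using bound[rule_format, OF \<beta>(1) n(2) l] by (simp add: m \<beta>(3))
  also have "\<dots> = 1 - q" using \<beta>(2) by (simp add: q_def)
  finally have "measure_pmf.prob ?p (- {F. satisfiable F}) \<le> 1 - q" .
  moreover have "measure_pmf.prob ?p (- {F. satisfiable F}) = 1 - prob_satisfiable n (4 * n)"
    using measure_pmf.prob_compl[of "{F. satisfiable F}" ?p]
    by (simp add: prob_satisfiable_def Compl_eq_Diff_UNIV)
  ultimately have "q \<le> prob_satisfiable n (4 * n)" by linarith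
  also have "\<dots> \<le> 2 ^ n * (3 / 4) ^ (4 * n)" by (rule prob_satisfiable_le[OF n(3)])
  also have "\<dots> = (2 * (3 / 4) ^ 4) ^ n"
    by (simp only: power_mult power_mult_distrib)
  also have "(2 * (3 / 4) ^ 4 :: real) = 162 / 256"
    by (simp add: power4_eq_xxxx)
  finally show False using M[OF n(1)] by simp
qed

end

theory Submission
  imports Defs
begin

text \<open>Let \<open>D F\<close> be the number of clauses of \<open>F\<close> that an optimal assignment violates. It is monotone in the number
  of clauses, so it suffices to treat \<open>\<lambda> \<le> -1\<close> (for lower bounds, \<open>\<lambda> \<le> -100\<close>) and \<open>\<lambda> \<ge> 100\<close>; the window in between
  follows by changing \<open>\<lambda>\<close> by a constant.

  Appending a clause \<open>C\<close> to \<open>F\<close> increases \<open>D\<close> only if both literals of \<open>C\<close> lie in the spine of \<open>F\<close>, that is, imply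
  their own negations. Below the threshold, implication paths from a literal are explored clause by clause; they
  are subcritical, and a union bound over the paths shows that the number of clauses hitting the spine is at least
  \<open>d\<close> with probability at most \<open>(O(d) / \<bar>\<lambda>\<bar>\<^sup>3)\<^sup>d\<close>, and has mean \<open>O(\<bar>\<lambda>\<bar>\<^sup>-\<^sup>3)\<close>.
  For the converse, a bicycle is an unsatisfiable formula, there are about \<open>\<bar>\<lambda>\<bar>\<^sup>-\<^sup>3\<close> expected bicycles of
  length about \<open>n\<^bsup>1/3\<^esup> / \<bar>\<lambda>\<bar>\<close>, and with positive probability such a bicycle meets no other one, so that
  distinct bicycles contribute almost disjoint events.

  Above the threshold, with \<open>x = \<epsilon>\<^sup>3 n = \<lambda>\<^sup>3\<close>, the unit clause algorithm assigns about \<open>50 \<epsilon> n\<close> variables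
  until the remaining formula is subcritical. During this time there are \<open>O(\<epsilon>\<^sup>2 n)\<close> unit clauses, so \<open>O(x)\<close>
  clauses are violated up to a tail exponential in \<open>x\<close>, and none is violated with probability at least \<open>exp (-O(x))\<close>.\<close>

text \<open>The constants must be uniform in n and \<lambda>, so all estimates are explicit
  inequalities. Below the threshold the obstacle is dependence: the ears behind different bad times
  may share variables and clauses. The exploration therefore carries the pattern exposed so far, and
  its weight \<open>growth\<close> depends on the number of explored variables only; the factor d in
  the base of the d-th power is the price of such meetings. Above the threshold no stopping times
  are used. The state is the list of clause codes and expectations are bounded backwards in time;
  reflection, stopping and conditioning on no violated clause all become one-step inequalities for
  the single function \<open>over\<close>. The analysis of the algorithm requires \<epsilon> \<le>
  1/200. For larger \<epsilon> the number m of clauses is itself O(\<lambda>^3): the deficit is at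
  most m, and the all-true assignment satisfies everything with probability at least exp (-m). The
  range \<lambda> \<ge> 100 means \<epsilon>^3 n \<ge> 1000000, which lets constant factors be
  absorbed into the exponential tail.\<close>

definition neg :: "literal \<Rightarrow> literal" where
  "neg z = (fst z, \<not> snd z)"

lemma fst_neg [simp]: "fst (neg z) = fst z"
  and neg_neg [simp]: "neg (neg z) = z"
  and neg_neq [simp]: "neg z \<noteq> z" "z \<noteq> neg z"
  and neg_eq_iff [simp]: "neg z = neg w \<longleftrightarrow> z = w"
  by (auto simp: neg_def prod_eq_iff)

lemma same_var_cases: "fst z = fst w \<Longrightarrow> z = w \<or> z = neg w"
  by (auto simp: neg_def prod_eq_iff)

definition lit_true :: "(nat \<Rightarrow> bool) \<Rightarrow> literal \<Rightarrow> bool" where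
  "lit_true \<sigma> z \<longleftrightarrow> \<sigma> (fst z) = snd z"

lemma lit_true_neg [simp]: "lit_true \<sigma> (neg z) \<longleftrightarrow> \<not> lit_true \<sigma> z"
  by (auto simp: lit_true_def neg_def)

lemma clause_sat_iff: "clause_sat \<sigma> C \<longleftrightarrow> (\<exists>z\<in>C. lit_true \<sigma> z)"
  by (simp add: clause_sat_def lit_true_def case_prod_unfold)

definition clauses_on :: "nat set \<Rightarrow> clause set" where
  "clauses_on V = {{x, y} | x y. fst x \<in> V \<and> fst y \<in> V \<and> fst x \<noteq> fst y}"

lemma proper_clauses_eq: "proper_clauses n = clauses_on {..<n}"
proof -
  have "proper_clauses n = {{x, y} | x y. fst x < n \<and> fst y < n \<and> fst x \<noteq> fst y}"
    unfolding proper_clauses_def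
  proof (intro Collect_cong iffI)
    fix C assume "\<exists>i a j b. C = {(i, a), (j, b)} \<and> i < n \<and> j < n \<and> i \<noteq> j"
    then obtain i a j b where "C = {(i, a), (j, b)} \<and> i < n \<and> j < n \<and> i \<noteq> j" by blast
    then show "\<exists>x y. C = {x, y} \<and> fst x < n \<and> fst y < n \<and> fst x \<noteq> fst y"
      by (intro exI[of _ "(i, a)"] exI[of _ "(j, b)"]) simp
  next
    fix C :: clause assume "\<exists>x y. C = {x, y} \<and> fst x < n \<and> fst y < n \<and> fst x \<noteq> fst y"
    then obtain x y where "C = {x, y} \<and> fst x < n \<and> fst y < n \<and> fst x \<noteq> fst y" by blast
    then show "\<exists>i a j b. C = {(i, a), (j, b)} \<and> i < n \<and> j < n \<and> i \<noteq> j"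
      by (intro exI[of _ "fst x"] exI[of _ "snd x"] exI[of _ "fst y"] exI[of _ "snd y"]) simp
  qed
  then show ?thesis by (simp add: clauses_on_def)
qed

subsection \<open>Deficits\<close>

definition num_unsat :: "(nat \<Rightarrow> bool) \<Rightarrow> formula \<Rightarrow> nat" where
  "num_unsat \<sigma> F = length (filter (\<lambda>C. \<not> clause_sat \<sigma> C) F)"

definition deficit :: "formula \<Rightarrow> nat" where
  "deficit F = length F - max_sat F"

lemma num_sat_unsat: "num_sat \<sigma> F + num_unsat \<sigma> F = length F"
  unfolding num_sat_def num_unsat_def by (rule sum_length_filter_compl)

lemma num_unsat_simps [simp]:
  "num_unsat \<sigma> [] = 0"
  "num_unsat \<sigma> (C # F) = (if clause_sat \<sigma> C then 0 else 1) + num_unsat \<sigma> F"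
  "num_unsat \<sigma> (F @ G) = num_unsat \<sigma> F + num_unsat \<sigma> G"
  by (auto simp: num_unsat_def)

lemma deficit_le: "deficit F \<le> num_unsat \<sigma> F"
proof -
  have "num_sat \<sigma> F \<le> max_sat F"
    unfolding max_sat_def by (rule Max_ge[OF finite_range_num_sat]) auto
  then show ?thesis using num_sat_unsat[of \<sigma> F] by (auto simp: deficit_def)
qed

lemma deficit_attained: "\<exists>\<sigma>. num_unsat \<sigma> F = deficit F"
proof -
  have "max_sat F \<in> range (\<lambda>\<sigma>. num_sat \<sigma> F)"
    unfolding max_sat_def by (rule Max_in[OF finite_range_num_sat]) auto
  then obtain \<sigma> where "max_sat F = num_sat \<sigma> F" by auto
  then show ?thesis using num_sat_unsat[of \<sigma> F] by (intro exI[of _ \<sigma>]) (auto simp: deficit_def)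
qed

lemma deficit_eq_0_iff: "deficit F = 0 \<longleftrightarrow> satisfiable F"
  using max_sat_le[of F] by (auto simp: deficit_def satisfiable_def)

lemma deficit_le_length: "deficit F \<le> length F"
  by (simp add: deficit_def)

lemma real_deficit: "real (length F) - real (max_sat F) = real (deficit F)"
  using max_sat_le[of F] by (simp add: deficit_def)

lemma deficit_mono:
  assumes "\<And>\<sigma>. \<exists>\<sigma>'. num_unsat \<sigma>' F \<le> num_unsat \<sigma> G"
  shows "deficit F \<le> deficit G"
proof -
  obtain \<sigma> where \<sigma>: "num_unsat \<sigma> G = deficit G" using deficit_attained by blast
  obtain \<sigma>' where "num_unsat \<sigma>' F \<le> num_unsat \<sigma> G" using assms by blast
  then show ?thesis using deficit_le[of F \<sigma>'] \<sigma> by linarith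
qed

lemma deficit_Cons_ge: "deficit F \<le> deficit (C # F)"
  by (rule deficit_mono) (metis le_add2 num_unsat_simps(2))

subsection \<open>The spine\<close>

definition edges :: "clause set \<Rightarrow> (literal \<times> literal) set" where
  "edges S = {(z, w). {neg z, w} \<in> S}"

definition spine :: "clause set \<Rightarrow> literal set" where
  "spine S = {x. (x, neg x) \<in> (edges S)\<^sup>*}"

lemma edges_contrapositive: "(z, w) \<in> (edges S)\<^sup>* \<Longrightarrow> (neg w, neg z) \<in> (edges S)\<^sup>*"
proof (induction rule: rtrancl_induct)
  case (step y z)
  then have "(neg z, neg y) \<in> edges S" by (auto simp: edges_def insert_commute)
  with step show ?case by (meson converse_rtrancl_into_rtrancl)
qed simp

text \<open>The literals reachable from \<open>x\<close> are consistent: if \<open>x\<close> implies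
  both \<open>z\<close> and \<open>neg z\<close>, the contraposed first path continues the second
  one to \<open>neg x\<close>, so \<open>x\<close> is in the spine. After they are all made true, a
  clause with a literal falsified by this has its other literal reachable. Reachability uses all of
  \<open>S\<close>, but only the clauses in \<open>S'\<close> need be satisfied before, so that the
  lemma applies to an optimal assignment of an unsatisfiable formula.\<close>

lemma flip_closure:
  assumes x: "x \<notin> spine S" and S': "S' \<subseteq> S" and two: "\<And>C. C \<in> S' \<Longrightarrow> \<exists>a b. C = {a, b}"
    and sat: "\<And>C. C \<in> S' \<Longrightarrow> clause_sat \<sigma> C"
  shows "\<exists>\<sigma>'. lit_true \<sigma>' x \<and> (\<forall>C\<in>S'. clause_sat \<sigma>' C)"
proof -
  define R where "R = {z. (x, z) \<in> (edges S)\<^sup>*}"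
  define \<sigma>' where "\<sigma>' i = (if (i, True) \<in> R then True else if (i, False) \<in> R then False else \<sigma> i)" for i
  have cons: "neg z \<notin> R" if "z \<in> R" for z
  proof
    assume "neg z \<in> R"
    moreover have "(neg z, neg x) \<in> (edges S)\<^sup>*" using that edges_contrapositive by (auto simp: R_def)
    ultimately have "(x, neg x) \<in> (edges S)\<^sup>*" by (auto simp: R_def)
    with x show False by (simp add: spine_def)
  qed
  have R_true: "lit_true \<sigma>' z" if "z \<in> R" for z
    using that cons[OF that] by (cases z; cases "snd z") (auto simp: lit_true_def \<sigma>'_def neg_def)
  have same: "lit_true \<sigma>' z \<longleftrightarrow> lit_true \<sigma> z" if "z \<notin> R" "neg z \<notin> R" for z
    using that by (cases z; cases "snd z") (auto simp: lit_true_def \<sigma>'_def neg_def)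
  have "clause_sat \<sigma>' C" if C: "C \<in> S'" for C
  proof -
    obtain a b where ab: "C = {a, b}" using two[OF C] by auto
    have "(neg a, b) \<in> edges S" "(neg b, a) \<in> edges S"
      using C S' ab by (auto simp: edges_def insert_commute)
    then have "neg a \<in> R \<Longrightarrow> b \<in> R" "neg b \<in> R \<Longrightarrow> a \<in> R"
      by (auto simp: R_def intro: rtrancl_into_rtrancl)
    moreover have "lit_true \<sigma> a \<or> lit_true \<sigma> b" using sat[OF C] by (auto simp: clause_sat_iff ab)
    ultimately have "lit_true \<sigma>' a \<or> lit_true \<sigma>' b" using R_true same by metis
    then show ?thesis by (auto simp: clause_sat_iff ab)
  qed
  moreover have "lit_true \<sigma>' x" by (rule R_true) (simp add: R_def)
  ultimately show ?thesis by blast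
qed

lemma clauses_on_two: "C \<in> clauses_on V \<Longrightarrow> \<exists>a b. C = {a, b}"
  by (auto simp: clauses_on_def)

lemma deficit_snoc:
  assumes "set F \<subseteq> clauses_on V" "C \<in> clauses_on V"
  shows "deficit (F @ [C]) \<le> deficit F + (if C \<subseteq> spine (set F) then 1 else 0)"
proof -
  obtain \<sigma> where \<sigma>: "num_unsat \<sigma> F = deficit F" using deficit_attained by blast
  show ?thesis
  proof (cases "C \<subseteq> spine (set F)")
    case True
    then show ?thesis using deficit_le[of "F @ [C]" \<sigma>] \<sigma> by (auto split: if_splits)
  next
    case False
    then obtain x where x: "x \<in> C" "x \<notin> spine (set F)" by blast
    obtain \<sigma>' where s: "lit_true \<sigma>' x" "\<And>B. B \<in> set F \<Longrightarrow> clause_sat \<sigma> B \<Longrightarrow> clause_sat \<sigma>' B"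
    proof -
      have "\<exists>\<sigma>'. lit_true \<sigma>' x \<and> (\<forall>B\<in>{B \<in> set F. clause_sat \<sigma> B}. clause_sat \<sigma>' B)"
      proof (rule flip_closure[OF x(2)])
        show "\<exists>a b. B = {a, b}" if "B \<in> {B \<in> set F. clause_sat \<sigma> B}" for B
          using that assms(1) by (intro clauses_on_two[of B V]) blast
      qed auto
      then show ?thesis using that by blast
    qed
    have "length (filter (\<lambda>B. \<not> clause_sat \<sigma>' B) F) \<le> length (filter (\<lambda>B. \<not> clause_sat \<sigma> B) F)"
      if "\<And>B. B \<in> set F \<Longrightarrow> clause_sat \<sigma> B \<Longrightarrow> clause_sat \<sigma>' B" for F
      using that
    proof (induction F)
      case (Cons a F)
      from Cons.IH Cons.prems show ?case by (auto simp: le_SucI)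
    qed simp
    then have "num_unsat \<sigma>' F \<le> num_unsat \<sigma> F" using s by (simp add: num_unsat_def)
    moreover have "clause_sat \<sigma>' C" using s x by (auto simp: clause_sat_iff)
    ultimately show ?thesis using deficit_le[of "F @ [C]" \<sigma>'] \<sigma> False by simp
  qed
qed

definition bad :: "(nat \<Rightarrow> clause) \<Rightarrow> nat \<Rightarrow> bool" where
  "bad f t \<longleftrightarrow> f t \<subseteq> spine (f ` {..<t})"

lemma deficit_le_card_bad:
  assumes "f \<in> {..<m} \<rightarrow> clauses_on V"
  shows "deficit (map f [0..<m]) \<le> card {t \<in> {..<m}. bad f t}"
  using assms
proof (induction m)
  case 0
  then show ?case using deficit_le_length[of "[]"] by simp
next
  case (Suc m)
  have IH: "deficit (map f [0..<m]) \<le> card {t \<in> {..<m}. bad f t}"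
    using Suc by (intro Suc.IH) auto
  have "deficit (map f [0..<m] @ [f m]) \<le> deficit (map f [0..<m]) + (if f m \<subseteq> spine (set (map f [0..<m])) then 1 else 0)"
    using Suc.prems by (intro deficit_snoc[of _ V]) auto
  moreover have "set (map f [0..<m]) = f ` {..<m}" by (auto simp: atLeast0LessThan)
  moreover have "{t \<in> {..<Suc m}. bad f t} = (if bad f m then insert m {t \<in> {..<m}. bad f t} else {t \<in> {..<m}. bad f t})"
    by (auto simp: less_Suc_eq)
  moreover have "m \<notin> {t \<in> {..<m}. bad f t}" "finite {t \<in> {..<m}. bad f t}" by auto
  ultimately show ?case using IH by (cases "bad f m") (auto simp: bad_def)
qed

text \<open>When the clauses at the times in \<open>I\<close> are added in order, a time that is not
  bad offers a literal to flip, so satisfiability persists. Badness refers to all earlier clauses,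
  not only to those in \<open>I\<close>; a bad time can thus be located inside a second
  bicycle.\<close>

lemma unsat_imp_bad:
  assumes f: "f \<in> {..<m} \<rightarrow> clauses_on V" and I: "I \<subseteq> {..<m}"
    and unsat: "\<And>\<sigma>. \<exists>p\<in>I. \<not> clause_sat \<sigma> (f p)"
  shows "\<exists>t\<in>I. bad f t"
proof (rule ccontr)
  assume no: "\<not> (\<exists>t\<in>I. bad f t)"
  have "finite I" using I finite_subset by blast
  have sat: "J \<subseteq> I \<Longrightarrow> \<exists>\<sigma>. \<forall>p\<in>J. clause_sat \<sigma> (f p)" if "finite J" for J
    using that
  proof (induction J rule: finite_linorder_max_induct)
    case (insert b A)
    then obtain \<sigma> where \<sigma>: "\<forall>p\<in>A. clause_sat \<sigma> (f p)" by auto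
    have "\<not> bad f b" using insert no by auto
    then obtain x where x: "x \<in> f b" "x \<notin> spine (f ` {..<b})" by (auto simp: bad_def)
    have "\<exists>\<sigma>'. lit_true \<sigma>' x \<and> (\<forall>C\<in>f ` A. clause_sat \<sigma>' C)"
    proof (rule flip_closure[OF x(2)])
      show "f ` A \<subseteq> f ` {..<b}" using insert by auto
      show "\<exists>a b. C = {a, b}" if "C \<in> f ` A" for C
        using that insert.prems I f clauses_on_two by blast
      show "clause_sat \<sigma> C" if "C \<in> f ` A" for C using that \<sigma> by auto
    qed
    then show ?case using x(1) by (auto simp: clause_sat_iff)
  qed simp
  from sat[OF \<open>finite I\<close>] unsat show False by auto
qed

section \<open>Counting clauses and literals on a set of variables\<close>

lemma card_clauses_on:
  assumes "finite A"
  shows "card (clauses_on A) = 2 * card A * (card A - 1)" "finite (clauses_on A)"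
proof -
  let ?n = "card A"
  obtain g where g: "bij_betw g {..<?n} A"
    using ex_bij_betw_nat_finite[OF assms] by (auto simp: atLeast0LessThan)
  let ?h = "map_prod g id :: literal \<Rightarrow> literal"
  have inj: "inj_on ?h ({..<?n} \<times> UNIV)"
    using g by (auto simp: bij_betw_def inj_on_def)
  have eq: "clauses_on A = (\<lambda>C. ?h ` C) ` clauses_on {..<?n}"
  proof (intro subset_antisym subsetI)
    fix C assume "C \<in> clauses_on A"
    then obtain x y where C: "C = {x, y}" "fst x \<in> A" "fst y \<in> A" "fst x \<noteq> fst y"
      by (auto simp: clauses_on_def)
    then obtain i j where ij: "i < ?n" "j < ?n" "g i = fst x" "g j = fst y"
    proof -
      have "fst x \<in> g ` {..<?n}" "fst y \<in> g ` {..<?n}" using C g by (simp_all add: bij_betw_def)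
      then obtain i j where "i < ?n" "j < ?n" "fst x = g i" "fst y = g j" by blast
      then show ?thesis using that by simp
    qed
    have "C = ?h ` {(i, snd x), (j, snd y)}" using C ij by auto
    moreover have "{(i, snd x), (j, snd y)} \<in> clauses_on {..<?n}"
      unfolding clauses_on_def mem_Collect_eq using ij C
      by (intro exI[of _ "(i, snd x)"] exI[of _ "(j, snd y)"]) auto
    ultimately show "C \<in> (\<lambda>C. ?h ` C) ` clauses_on {..<?n}" by blast
  next
    fix C assume "C \<in> (\<lambda>C. ?h ` C) ` clauses_on {..<?n}"
    then obtain x y where C: "C = {?h x, ?h y}" "fst x < ?n" "fst y < ?n" "fst x \<noteq> fst y"
      by (auto simp: clauses_on_def)
    then have "fst (?h x) \<in> A" "fst (?h y) \<in> A" "fst (?h x) \<noteq> fst (?h y)"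
      using g by (auto simp: bij_betw_def inj_on_def)
    with C(1) show "C \<in> clauses_on A" unfolding clauses_on_def by blast
  qed
  have "inj_on (\<lambda>C. ?h ` C) (clauses_on {..<?n})"
  proof (rule inj_onI)
    fix C D assume CD: "C \<in> clauses_on {..<?n}" "D \<in> clauses_on {..<?n}" "?h ` C = ?h ` D"
    have "C \<subseteq> {..<?n} \<times> UNIV" "D \<subseteq> {..<?n} \<times> UNIV"
      using CD(1,2) by (auto simp: clauses_on_def)
    with CD(3) show "C = D" using inj_on_image_eq_iff[OF inj] by blast
  qed
  then have "card (clauses_on A) = card (proper_clauses ?n)"
    by (simp add: eq card_image proper_clauses_eq)
  also have "\<dots> = 2 * ?n * (?n - 1)"
  proof -
    have "even (?n * (?n - 1))" by auto
    then have "2 * (?n choose 2) = ?n * (?n - 1)" unfolding choose_two by (rule dvd_mult_div_cancel)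
    then show ?thesis by (simp add: card_proper_clauses)
  qed
  finally show "card (clauses_on A) = 2 * card A * (card A - 1)" .
  show "finite (clauses_on A)"
    unfolding eq using finite_proper_clauses[of ?n] by (simp add: proper_clauses_eq)
qed

lemma clauses_onD: "{x, y} \<in> clauses_on A \<Longrightarrow> fst x \<in> A \<and> fst y \<in> A \<and> fst x \<noteq> fst y"
  unfolding clauses_on_def by (auto simp: doubleton_eq_iff)

definition lits :: "nat set \<Rightarrow> literal set" where
  "lits A = A \<times> UNIV"

lemma lits_iff: "x \<in> lits A \<longleftrightarrow> fst x \<in> A"
  by (cases x) (simp add: lits_def)

lemma finite_lits [simp]: "finite A \<Longrightarrow> finite (lits A)"
  and card_lits: "card (lits A) = 2 * card A"
  by (simp_all add: lits_def card_cartesian_product)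

subsection \<open>Exploration of the implication graph\<close>

text \<open>A pattern prescribes the clauses at finitely many times; \<open>Ev R\<close> is the event that \<open>R\<close> occurs.\<close>

definition Ev :: "(nat \<times> clause) set \<Rightarrow> (nat \<Rightarrow> clause) set" where
  "Ev R = {f. \<forall>(p, C)\<in>R. f p = C}"

lemma Ev_insert: "Ev (insert (p, C) R) = {f. f p = C} \<inter> Ev R"
  by (auto simp: Ev_def)

text \<open>An implication path from \<open>z\<close> that visits new variables until it hits \<open>W\<close> or itself.\<close>

inductive Ear :: "nat set \<Rightarrow> (nat \<Rightarrow> clause) \<Rightarrow> nat \<Rightarrow> nat set \<Rightarrow> literal \<Rightarrow> bool"
  for A :: "nat set" and f :: "nat \<Rightarrow> clause" and t :: nat
  where
    close: "p < t \<Longrightarrow> f p = {neg z, w} \<Longrightarrow> fst w \<in> A \<Longrightarrow> fst w \<in> W \<Longrightarrow> Ear A f t W z"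
  | extend: "p < t \<Longrightarrow> f p = {neg z, w} \<Longrightarrow> fst w \<in> A \<Longrightarrow> fst w \<notin> W \<Longrightarrow>
      Ear A f t (insert (fst w) W) w \<Longrightarrow> Ear A f t W z"

text \<open>The walk is followed up to the first variable that is already known; since its last
  variable lies in \<open>W\<close>, one occurs. Only this part is kept, so that every extension
  leads to a fresh variable.\<close>

lemma walk_imp_Ear:
  assumes f: "f ` {..<t} \<subseteq> clauses_on A"
  shows "(z, v) \<in> (edges (f ` {..<t}))\<^sup>+ \<Longrightarrow> fst v \<in> W \<Longrightarrow> Ear A f t W z"
proof (induction arbitrary: W rule: converse_trancl_induct)
  case (base y)
  then obtain p where p: "p < t" "f p = {neg y, v}" by (auto simp: edges_def)
  then have "{neg y, v} \<in> clauses_on A" using f by (metis imageI lessThan_iff subsetD)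
  with p base show ?case by (intro Ear.close[of p t f y v]) (auto dest: clauses_onD)
next
  case (step y w)
  then obtain p where p: "p < t" "f p = {neg y, w}" by (auto simp: edges_def)
  then have "{neg y, w} \<in> clauses_on A" using f by (metis imageI lessThan_iff subsetD)
  then have w: "fst w \<in> A" by (auto dest: clauses_onD)
  show ?case
  proof (cases "fst w \<in> W")
    case True
    with p w show ?thesis by (intro Ear.close[of p t f y w])
  next
    case False
    with p w step show ?thesis by (intro Ear.extend[of p t f y w]) auto
  qed
qed

lemma spine_imp_Ear:
  assumes "f ` {..<t} \<subseteq> clauses_on A" "x \<in> spine (f ` {..<t})" "fst x \<in> W"
  shows "Ear A f t W x"
proof -
  have "(x, neg x) \<in> (edges (f ` {..<t}))\<^sup>+"
    using assms(2) by (auto simp: spine_def rtrancl_eq_or_trancl)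
  from walk_imp_Ear[OF assms(1) this] assms(3) show ?thesis by simp
qed

section \<open>Patterns in a uniform sequence of clauses\<close>

locale random_clauses =
  fixes A :: "nat set" and m :: nat
  assumes finite_A [simp]: "finite A" and card_A: "card A \<ge> 2"
begin

abbreviation n :: nat where "n \<equiv> card A"

definition q :: real where "q = 1 / (2 * real n * (real n - 1))"

definition \<Omega> :: "(nat \<Rightarrow> clause) set" where
  "\<Omega> = {..<m} \<rightarrow>\<^sub>E clauses_on A"

definition pr :: "(nat \<Rightarrow> clause) set \<Rightarrow> real" where
  "pr E = measure_pmf.prob (pmf_of_set \<Omega>) E"

lemma card_cl: "real (card (clauses_on A)) = 1 / q" and q_pos: "q > 0"
proof -
  show "q > 0" using card_A by (auto simp: q_def)
  show "real (card (clauses_on A)) = 1 / q"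
    using card_A by (simp add: q_def card_clauses_on of_nat_diff)
qed

lemma finite_\<Omega> [simp]: "finite \<Omega>"
  unfolding \<Omega>_def by (intro finite_PiE) (auto simp: card_clauses_on)

lemma card_\<Omega>: "real (card \<Omega>) = (1 / q) ^ m"
  by (simp add: \<Omega>_def card_PiE card_cl)

lemma \<Omega>_ne [simp]: "\<Omega> \<noteq> {}"
proof -
  have "real (card \<Omega>) > 0" unfolding card_\<Omega> using q_pos by simp
  then show ?thesis by auto
qed

lemma pr_eq: "pr E = real (card (\<Omega> \<inter> E)) / real (card \<Omega>)"
  unfolding pr_def by (rule measure_pmf_of_set) auto

lemma pr_nonneg [simp]: "pr E \<ge> 0"
  by (simp add: pr_def)

lemma pr_mono: "(\<And>f. f \<in> \<Omega> \<Longrightarrow> f \<in> E \<Longrightarrow> f \<in> F) \<Longrightarrow> pr E \<le> pr F"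
  unfolding pr_eq by (intro divide_right_mono) (auto intro!: card_mono)

lemma pr_UN_le:
  assumes "finite I" "\<And>f. f \<in> \<Omega> \<Longrightarrow> f \<in> E \<Longrightarrow> \<exists>i\<in>I. f \<in> B i"
  shows "pr E \<le> (\<Sum>i\<in>I. pr (B i))"
proof -
  have "pr E \<le> pr (\<Union>i\<in>I. B i)" using assms by (intro pr_mono) auto
  also have "\<dots> \<le> (\<Sum>i\<in>I. pr (B i))"
    unfolding pr_def using assms by (intro measure_pmf.finite_measure_subadditive_finite) auto
  finally show ?thesis .
qed

definition wf_pat :: "(nat \<times> clause) set \<Rightarrow> bool" where
  "wf_pat R \<longleftrightarrow> finite R \<and> inj_on fst R \<and> fst ` R \<subseteq> {..<m} \<and> snd ` R \<subseteq> clauses_on A"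

lemma pr_Ev:
  assumes "wf_pat R"
  shows "pr (Ev R) = q ^ card R"
proof -
  define D where "D = fst ` R"
  have R: "finite R" "inj_on fst R" "D \<subseteq> {..<m}" "snd ` R \<subseteq> clauses_on A"
    using assms by (auto simp: wf_pat_def D_def)
  have cD: "card D = card R" unfolding D_def using R by (simp add: card_image)
  define B where "B p = (if p \<in> D then {SOME C. (p, C) \<in> R} else clauses_on A)" for p
  have some: "(p, C) \<in> R \<Longrightarrow> (SOME C. (p, C) \<in> R) = C" for p C
  proof -
    assume pC: "(p, C) \<in> R"
    have "C' = C" if "(p, C') \<in> R" for C'
      using inj_onD[OF R(2), of "(p, C')" "(p, C)"] pC that by simp
    with pC show ?thesis by (intro some_equality)
  qed
  have B1: "B p = {C}" if "(p, C) \<in> R" for p C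
    using that some[OF that] by (force simp: B_def D_def)
  have "\<Omega> \<inter> Ev R = PiE {..<m} B"
  proof (intro subset_antisym subsetI)
    fix f assume f: "f \<in> \<Omega> \<inter> Ev R"
    have "f p \<in> B p" if "p < m" for p
    proof (cases "p \<in> D")
      case True
      then obtain C where C: "(p, C) \<in> R" by (auto simp: D_def)
      with f have "f p = C" by (auto simp: Ev_def)
      then show ?thesis using B1[OF C] by simp
    next
      case False
      then show ?thesis using f that by (auto simp: \<Omega>_def B_def)
    qed
    then show "f \<in> PiE {..<m} B" using f by (auto simp: \<Omega>_def PiE_def)
  next
    fix f assume f: "f \<in> PiE {..<m} B"
    have *: "f p = C" if "(p, C) \<in> R" for p C
    proof -
      have "p < m" using that R by (auto simp: D_def)
      then show ?thesis using f B1[OF that] by (auto simp: PiE_def Pi_def)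
    qed
    have "B p \<subseteq> clauses_on A" for p
    proof (cases "p \<in> D")
      case True
      then obtain C where C: "(p, C) \<in> R" by (auto simp: D_def)
      then show ?thesis using B1[OF C] R(4) by force
    qed (simp add: B_def)
    then have "f p \<in> clauses_on A" if "p < m" for p using f that by (auto simp: PiE_def Pi_def)
    then show "f \<in> \<Omega> \<inter> Ev R" using f * by (auto simp: \<Omega>_def Ev_def PiE_def Pi_def)
  qed
  then have "real (card (\<Omega> \<inter> Ev R)) = (\<Prod>p<m. real (card (B p)))"
    by (simp add: card_PiE)
  also have "\<dots> = (\<Prod>p<m. if p \<in> D then 1 else 1 / q)"
    by (intro prod.cong) (auto simp: B_def card_cl)
  also have "\<dots> = (1 / q) ^ card ({..<m} - D)"
  proof -
    have "(\<Prod>p<m. if p \<in> D then 1 else 1 / q) = (\<Prod>p\<in>{..<m} - D. 1 / q)"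
      by (intro prod.mono_neutral_cong_right) auto
    then show ?thesis by simp
  qed
  also have "card ({..<m} - D) = m - card R"
    using R cD by (simp add: card_Diff_subset finite_subset)
  finally have "pr (Ev R) = (1 / q) ^ (m - card R) / (1 / q) ^ m"
    by (simp add: pr_eq card_\<Omega>)
  moreover have "card R \<le> m" using card_mono[OF _ R(3)] cD by simp
  ultimately show ?thesis using q_pos by (simp add: power_diff power_divide field_simps)
qed

text \<open>Explorations are iterated: \<open>M\<close> will itself be a sum of probabilities of having further ears, bounded by
  the hypothesis of \<open>ear_bound\<close> in terms of the number of variables explored so far.\<close>

definition subadd :: "((nat \<Rightarrow> clause) set \<Rightarrow> real) \<Rightarrow> bool" where
  "subadd M \<longleftrightarrow> (\<forall>E (I :: (nat \<times> literal) set) B. finite I \<longrightarrow>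
     (\<forall>f\<in>\<Omega>. f \<in> E \<longrightarrow> (\<exists>i\<in>I. f \<in> B i)) \<longrightarrow> M E \<le> (\<Sum>i\<in>I. M (B i)))"

lemma subadd_le:
  assumes "subadd M" "\<And>f. f \<in> \<Omega> \<Longrightarrow> f \<in> E \<Longrightarrow> f \<in> F"
  shows "M E \<le> M F"
proof -
  have "M E \<le> (\<Sum>i\<in>{undefined :: nat \<times> literal}. M F)"
    using assms(1)[unfolded subadd_def, rule_format, of "{undefined}" E "\<lambda>_. F"] assms(2) by auto
  then show ?thesis by simp
qed

text \<open>Sums allow one exploration to start inside another: for the first literal of a clause,
  the functional already sums over the second literal and includes what has to happen later.\<close>

lemma subadd_sum:
  assumes "finite X"
  shows "subadd (\<lambda>E. \<Sum>x\<in>X. pr (E \<inter> Q x))"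
  unfolding subadd_def
proof (intro allI impI)
  fix E and I :: "(nat \<times> literal) set" and B
  assume I: "finite I" "\<forall>f\<in>\<Omega>. f \<in> E \<longrightarrow> (\<exists>i\<in>I. f \<in> B i)"
  have "(\<Sum>x\<in>X. pr (E \<inter> Q x)) \<le> (\<Sum>x\<in>X. \<Sum>i\<in>I. pr (B i \<inter> Q x))"
    using I by (intro sum_mono pr_UN_le) auto
  then show "(\<Sum>x\<in>X. pr (E \<inter> Q x)) \<le> (\<Sum>i\<in>I. \<Sum>x\<in>X. pr (B i \<inter> Q x))"
    by (subst sum.swap)
qed

lemma subadd_pr: "subadd (\<lambda>E. pr (E \<inter> Q))"
  using subadd_sum[of "{()}" "\<lambda>_. Q"] by simp

definition vars :: "(nat \<times> clause) set \<Rightarrow> nat set" where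
  "vars R = (\<Union>e\<in>R. fst ` snd e)"

lemma vars_insert [simp]: "vars (insert e R) = fst ` snd e \<union> vars R"
  by (simp add: vars_def)

lemma sum_lits_le:
  assumes "W \<subseteq> A" "g \<ge> 0" "s \<ge> (0 :: real)"
  shows "(\<Sum>x\<in>lits A. if fst x \<in> W then g else s) \<le> 2 * real (card W) * g + 2 * real n * s"
proof -
  have "(\<Sum>x\<in>lits A. if fst x \<in> W then g else s) \<le> (\<Sum>x\<in>lits A. (if x \<in> lits W then g else 0) + s)"
    using assms by (intro sum_mono) (auto simp: lits_iff)
  also have "\<dots> = (\<Sum>x\<in>lits A \<inter> lits W. g) + (\<Sum>x\<in>lits A. s)"
    by (simp add: sum.distrib sum.inter_restrict[symmetric])
  also have "lits A \<inter> lits W = lits W" using assms by (auto simp: lits_iff)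
  finally show ?thesis by (simp add: card_lits)
qed

definition extends :: "nat \<Rightarrow> (nat \<times> clause) set \<Rightarrow> nat set \<Rightarrow> (nat \<times> clause) set \<Rightarrow> nat set \<Rightarrow> bool" where
  "extends t R W R' W' \<longleftrightarrow> wf_pat R' \<and> R \<subseteq> R' \<and> W \<subseteq> W' \<and> W' \<subseteq> A \<and> vars R' \<subseteq> W' \<and> fst ` (R' - R) \<subseteq> {..<t}"

text \<open>The ear is exposed clause by clause. By the last premise no prescribed clause before
  \<open>t\<close> contains \<open>neg z\<close>, so each step fixes the clause at a new time,
  chosen among \<open>t\<close>, and costs a factor \<open>q\<close>. At most
  \<open>2 * card W\<close> literals close the ear, where \<open>hyp\<close> takes over with weight
  \<open>G\<close>; at most \<open>2 * n\<close> literals extend it to one more variable. Hence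
  every \<open>S\<close> with the recursive inequality is an upper bound, by induction on the
  unexplored variables.\<close>

lemma ear_bound:
  assumes t: "t \<le> m" and M: "subadd M" and \<kappa>: "\<kappa> \<ge> 0"
    and G: "\<And>w. G w \<ge> 0" and S0: "\<And>w. S w \<ge> 0"
    and S: "\<And>w. w \<le> n \<Longrightarrow> real t * q * (2 * real w * G w + 2 * real n * S (Suc w)) \<le> S w"
    and hyp: "\<And>R' W'. extends t R W R' W' \<Longrightarrow> M (Ev R') \<le> \<kappa> * q ^ card R' * G (card W')"
    and R: "wf_pat R" "vars R \<subseteq> W" "W \<subseteq> A" "fst z \<in> W" "\<And>p C. (p, C) \<in> R \<Longrightarrow> p < t \<Longrightarrow> neg z \<notin> C"
  shows "M (Ev R \<inter> {f. Ear A f t W z}) \<le> \<kappa> * q ^ card R * S (card W)"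
  using R hyp
proof (induction "card (A - W)" arbitrary: R W z rule: less_induct)
  case less
  note wf = less.prems(1) and vR = less.prems(2) and WA = less.prems(3) and zW = less.prems(4)
    and nz = less.prems(5) and hyp = less.prems(6)
  have finR: "finite R" using wf by (simp add: wf_pat_def)
  let ?I = "{..<t} \<times> lits A"
  define R1 where "R1 p w = insert (p, {neg z, w}) R" for p w
  define ok where "ok p w \<longleftrightarrow> p \<notin> fst ` R \<and> fst w \<noteq> fst z" for p and w :: literal
  define B where "B = (\<lambda>(p, w). if ok p w then
      if fst w \<in> W then Ev (R1 p w) else Ev (R1 p w) \<inter> {f. Ear A f t (insert (fst w) W) w} else {})"
  have cover: "\<exists>i\<in>?I. f \<in> B i" if f: "f \<in> \<Omega>" "f \<in> Ev R \<inter> {f. Ear A f t W z}" for f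
  proof -
    have ok: "ok p w" if p: "p < t" "f p = {neg z, w}" for p w
    proof -
      have "p \<notin> fst ` R"
      proof
        assume "p \<in> fst ` R"
        then obtain C where C: "(p, C) \<in> R" by auto
        then have "f p = C" using f(2) by (auto simp: Ev_def)
        then show False using nz[OF C p(1)] p(2) by auto
      qed
      moreover have "f p \<in> clauses_on A" using f(1) p(1) t by (auto simp: \<Omega>_def)
      then have "fst w \<noteq> fst z" using p(2) clauses_onD[of "neg z" w A] by auto
      ultimately show ?thesis by (simp add: ok_def)
    qed
    have "Ear A f t W z" using f(2) by simp
    then show ?thesis
    proof cases
      case (close p w)
      then have "(p, w) \<in> ?I" "f \<in> B (p, w)"
        using ok[of p w] f(2) by (auto simp: B_def R1_def Ev_insert lits_iff)
      then show ?thesis by blast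
    next
      case (extend p w)
      then have "(p, w) \<in> ?I" "f \<in> B (p, w)"
        using ok[of p w] f(2) by (auto simp: B_def R1_def Ev_insert lits_iff)
      then show ?thesis by blast
    qed
  qed
  have bound: "M (B (p, w)) \<le> \<kappa> * q ^ Suc (card R) * (if fst w \<in> W then G (card W) else S (Suc (card W)))"
    if pw: "p < t" "fst w \<in> A" for p w
  proof (cases "ok p w")
    case False
    have "M {} \<le> 0" using M[unfolded subadd_def, rule_format, of "{}" "{}" "\<lambda>_. {}"] by simp
    moreover have "0 \<le> \<kappa> * q ^ Suc (card R) * (if fst w \<in> W then G (card W) else S (Suc (card W)))"
      using \<kappa> G S0 q_pos by (intro mult_nonneg_nonneg) auto
    ultimately show ?thesis using False by (simp add: B_def)
  next
    case True
    then have ok: "p \<notin> fst ` R" "fst w \<noteq> fst z" by (auto simp: ok_def)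
    have "(p, {neg z, w}) \<notin> R" using ok(1) by force
    then have card1: "card (R1 p w) = Suc (card R)" using finR by (simp add: R1_def)
    have "{neg z, w} \<in> clauses_on A"
      unfolding clauses_on_def mem_Collect_eq using ok pw zW WA
      by (intro exI[of _ "neg z"] exI[of _ w]) auto
    then have wf1: "wf_pat (R1 p w)"
      using wf ok pw t unfolding wf_pat_def R1_def by auto
    have ext: "extends t R W R' W'" if "extends t (R1 p w) W1 R' W'" "W \<subseteq> W1" for R' W' W1
    proof -
      have "R' - R \<subseteq> insert (p, {neg z, w}) (R' - R1 p w)" by (auto simp: R1_def)
      from image_mono[OF this, of fst] have "fst ` (R' - R) \<subseteq> insert p (fst ` (R' - R1 p w))" by simp
      note sub = this
      have e: "wf_pat R'" "R1 p w \<subseteq> R'" "W1 \<subseteq> W'" "W' \<subseteq> A" "vars R' \<subseteq> W'"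
        "fst ` (R' - R1 p w) \<subseteq> {..<t}"
        using that(1) by (simp_all add: extends_def)
      have "insert p (fst ` (R' - R1 p w)) \<subseteq> {..<t}" using e(6) pw(1) by simp
      with sub have 1: "fst ` (R' - R) \<subseteq> {..<t}" by (rule subset_trans)
      have "R \<subseteq> R1 p w" by (simp add: R1_def subset_insertI)
      with e(2) have 2: "R \<subseteq> R'" by (rule subset_trans[rotated])
      have 3: "W \<subseteq> W'" using that(2) e(3) by (rule subset_trans)
      show ?thesis unfolding extends_def using e(1,4,5) 1 2 3 by (intro conjI)
    qed
    show ?thesis
    proof (cases "fst w \<in> W")
      case inW: True
      have "extends t R W (R1 p w) W"
        unfolding extends_def using wf1 WA vR inW zW pw by (auto simp: R1_def)
      from hyp[OF this] show ?thesis using True inW card1 by (simp add: B_def)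
    next
      case notW: False
      have "M (Ev (R1 p w) \<inter> {f. Ear A f t (insert (fst w) W) w}) \<le>
          \<kappa> * q ^ card (R1 p w) * S (card (insert (fst w) W))"
      proof (rule less.hyps)
        show "card (A - insert (fst w) W) < card (A - W)"
          using notW pw by (intro psubset_card_mono) auto
        show "wf_pat (R1 p w)" by (rule wf1)
        show "vars (R1 p w) \<subseteq> insert (fst w) W" using vR zW by (auto simp: R1_def)
        show "insert (fst w) W \<subseteq> A" using pw WA by auto
        show "fst w \<in> insert (fst w) W" by simp
        \<comment> \<open>Older clauses lie within \<open>W\<close>, which misses the variable of
          \<open>w\<close>; the newest one contains \<open>w\<close> and not
          \<open>neg w\<close>.\<close>
        show "neg w \<notin> C" if "(p', C) \<in> R1 p w" "p' < t" for p' C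
        proof (cases "(p', C) \<in> R")
          case True
          then have "fst ` C \<subseteq> W" using vR by (force simp: vars_def)
          then show ?thesis using notW by (metis fst_neg imageI subsetD)
        next
          case False
          then have "C = {neg z, w}" using that by (auto simp: R1_def)
          then show ?thesis using ok(2) by auto
        qed
        show "M (Ev R') \<le> \<kappa> * q ^ card R' * G (card W')"
          if "extends t (R1 p w) (insert (fst w) W) R' W'" for R' W'
          using hyp[OF ext[OF that]] by auto
      qed
      moreover have "card (insert (fst w) W) = Suc (card W)"
        using notW finite_subset[OF WA] by simp
      ultimately show ?thesis using True notW card1 by (simp add: B_def)
    qed
  qed
  have "M (Ev R \<inter> {f. Ear A f t W z}) \<le> (\<Sum>i\<in>?I. M (B i))"
    using M[unfolded subadd_def, rule_format, of ?I "Ev R \<inter> {f. Ear A f t W z}" B] cover by auto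
  also have "\<dots> \<le> (\<Sum>(p, w)\<in>?I. \<kappa> * q ^ Suc (card R) * (if fst w \<in> W then G (card W) else S (Suc (card W))))"
    using bound by (intro sum_mono) (auto simp: lits_iff)
  also have "\<dots> = real t * (\<kappa> * q ^ Suc (card R) * (\<Sum>w\<in>lits A. if fst w \<in> W then G (card W) else S (Suc (card W))))"
    by (simp add: sum.cartesian_product[symmetric] sum_distrib_left)
  also have "\<dots> \<le> real t * (\<kappa> * q ^ Suc (card R) * (2 * real (card W) * G (card W) + 2 * real n * S (Suc (card W))))"
    using \<kappa> q_pos G S0 WA by (intro mult_left_mono sum_lits_le) auto
  also have "\<dots> = \<kappa> * q ^ card R * (real t * q * (2 * real (card W) * G (card W) + 2 * real n * S (Suc (card W))))"
    by (simp add: algebra_simps)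
  also have "\<dots> \<le> \<kappa> * q ^ card R * S (card W)"
    using \<kappa> q_pos WA by (intro mult_left_mono S) (auto intro: card_mono)
  finally show ?case .
qed

lemma root_bound:
  assumes t: "t \<le> m" and M: "subadd M" and \<kappa>: "\<kappa> \<ge> 0"
    and G: "\<And>w. G w \<ge> 0" and S0: "\<And>w. S w \<ge> 0"
    and S: "\<And>w. w \<le> n \<Longrightarrow> real t * q * (2 * real w * G w + 2 * real n * S (Suc w)) \<le> S w"
    and hyp: "\<And>R' W'. extends t R (insert (fst x) W) R' W' \<Longrightarrow> M (Ev R') \<le> \<kappa> * q ^ card R' * G (card W')"
    and R: "wf_pat R" "vars R \<subseteq> W" "W \<subseteq> A" "x \<in> lits A"
  shows "M (Ev R \<inter> {f. x \<in> spine (f ` {..<t})}) \<le>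
    \<kappa> * q ^ card R * (if fst x \<in> W then G (card W) else S (Suc (card W)))"
proof (cases "fst x \<in> W")
  case True
  have "extends t R (insert (fst x) W) R W" using R True by (auto simp: extends_def)
  from hyp[OF this] have "M (Ev R) \<le> \<kappa> * q ^ card R * G (card W)" .
  moreover have "M (Ev R \<inter> {f. x \<in> spine (f ` {..<t})}) \<le> M (Ev R)" by (rule subadd_le[OF M]) auto
  ultimately show ?thesis using True by auto
next
  case False
  have "M (Ev R \<inter> {f. x \<in> spine (f ` {..<t})}) \<le> M (Ev R \<inter> {f. Ear A f t (insert (fst x) W) x})"
  proof (rule subadd_le[OF M])
    fix f assume f: "f \<in> \<Omega>" "f \<in> Ev R \<inter> {f. x \<in> spine (f ` {..<t})}"
    have "f ` {..<t} \<subseteq> clauses_on A" using f t by (auto simp: \<Omega>_def)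
    then show "f \<in> Ev R \<inter> {f. Ear A f t (insert (fst x) W) x}"
      using f spine_imp_Ear[of f t A x "insert (fst x) W"] by simp
  qed
  also have "\<dots> \<le> \<kappa> * q ^ card R * S (card (insert (fst x) W))"
  proof (rule ear_bound[OF t M \<kappa>, of G S])
    show "neg x \<notin> C" if "(p, C) \<in> R" for p C
    proof -
      have "fst ` C \<subseteq> W" using that R(2) by (force simp: vars_def)
      then show ?thesis using False by (metis fst_neg imageI subsetD)
    qed
  qed (use R G S0 S hyp in \<open>auto simp: lits_iff\<close>)
  also have "card (insert (fst x) W) = Suc (card W)"
    using False finite_subset[OF R(3)] by simp
  finally show ?thesis using False by simp
qed

end

text \<open>Up to the factor \<open>(2 / (a\<^sup>2 n))\<^sup>j\<close>, a supersolution of the recursion for attaching \<open>j\<close> ears to \<open>w\<close> variables.\<close>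

definition growth :: "real \<Rightarrow> nat \<Rightarrow> nat \<Rightarrow> real" where
  "growth a j w = (a * real w + 4 * real j) ^ j"

lemma growth_nonneg: "a \<ge> 0 \<Longrightarrow> growth a j w \<ge> 0"
  by (simp add: growth_def)

lemma growth_mono: "0 \<le> a \<Longrightarrow> a \<le> a' \<Longrightarrow> growth a j w \<le> growth a' j w"
  unfolding growth_def by (intro power_mono add_mono mult_right_mono) auto

text \<open>The second bound is the reason for the summand \<open>4 * j\<close>: it limits the j
  factors 1 + a/Y together to exp (a/4), so a new variable increases the weight by a relative 5a/16,
  which the factor 1 - a of a further step outweighs.\<close>

lemma growth_Suc:
  assumes "0 < a" "a \<le> 1"
  shows "real w * growth a j w \<le> growth a (Suc j) w / a"
    and "growth a j (Suc w) \<le> (1 + 5 * a / 16) * growth a j w"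
proof -
  have "a * real w * growth a j w \<le> growth a (Suc j) w"
  proof -
    have "(a * real w + 4 * real j) ^ j \<le> (a * real w + 4 * real (Suc j)) ^ j"
      using assms by (intro power_mono) auto
    moreover have "a * real w \<le> a * real w + 4 * real (Suc j)" by simp
    ultimately show ?thesis unfolding growth_def power_Suc using assms by (intro mult_mono) auto
  qed
  then show "real w * growth a j w \<le> growth a (Suc j) w / a"
    using assms by (simp add: field_simps)
  show "growth a j (Suc w) \<le> (1 + 5 * a / 16) * growth a j w"
  proof (cases "j = 0")
    case False
    define Y where "Y = a * real w + 4 * real j"
    have Y: "Y > 0" "4 * real j \<le> Y" using False assms by (auto simp: Y_def add_nonneg_pos)
    have "Y * (1 + a / Y) = Y + a" using Y by (simp add: distrib_left)
    moreover have "a * real (Suc w) + 4 * real j = Y + a" by (simp add: Y_def algebra_simps)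
    ultimately have "growth a j (Suc w) = (Y * (1 + a / Y)) ^ j" by (simp add: growth_def)
    also have "\<dots> = Y ^ j * (1 + a / Y) ^ j" by (simp add: power_mult_distrib)
    also have "(1 + a / Y) ^ j \<le> exp (a / Y) ^ j"
      using assms Y by (intro power_mono) auto
    also have "exp (a / Y) ^ j = exp (real j * (a / Y))" by (rule exp_of_nat_mult[symmetric])
    also have "\<dots> \<le> exp (a / 4)"
    proof -
      have "real j * a \<le> Y / 4 * a" using Y assms by (intro mult_right_mono) auto
      then show ?thesis using Y by (simp add: field_simps)
    qed
    also have "\<dots> \<le> 1 + a / 4 + (a / 4)\<^sup>2" using assms by (intro exp_bound) auto
    also have "\<dots> \<le> 1 + 5 * a / 16"
      using assms mult_mono[of a 1 a a] by (simp add: power2_eq_square)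
    finally show ?thesis using Y by (simp add: growth_def Y_def mult.commute)
  qed (use assms in \<open>simp add: growth_def\<close>)
qed

text \<open>Elementary symmetric polynomials: every product over a \<open>k\<close>-set occurs
  \<open>fact k\<close> times in the expanded power of the sum.\<close>

lemma sum_prod_subsets_le:
  fixes z :: "nat \<Rightarrow> real"
  assumes "\<And>t. z t \<ge> 0"
  shows "(\<Sum>T | T \<subseteq> {..<m} \<and> card T = k. \<Prod>t\<in>T. z t) \<le> (\<Sum>t<m. z t) ^ k / fact k"
proof (induction m arbitrary: k)
  case 0
  have "{T. T \<subseteq> {..<0::nat} \<and> card T = k} = (if k = 0 then {{}} else {})" by auto
  then show ?case by simp
next
  case (Suc m)
  show ?case
  proof (cases k)
    case 0
    have "{T. T \<subseteq> {..<Suc m} \<and> card T = 0} = {{}}"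
      by (auto dest: finite_subset)
    with 0 show ?thesis by simp
  next
    case (Suc k')
    let ?P = "\<lambda>m k. {T. T \<subseteq> {..<m::nat} \<and> card T = k}"
    have fin: "finite (?P m k)" for m k
      by (rule finite_subset[of _ "Pow {..<m}"]) auto
    have split: "?P (Suc m) k = ?P m k \<union> insert m ` ?P m k'"
    proof (intro subset_antisym subsetI)
      fix T assume T: "T \<in> ?P (Suc m) k"
      show "T \<in> ?P m k \<union> insert m ` ?P m k'"
      proof (cases "m \<in> T")
        case True
        then have "T = insert m (T - {m})" by auto
        moreover have "T - {m} \<in> ?P m k'" using T True Suc by (auto simp: lessThan_Suc card_Diff_singleton)
        ultimately show ?thesis by blast
      next
        case False
        then show ?thesis using T by (auto simp: lessThan_Suc)
      qed
    next
      fix T assume "T \<in> ?P m k \<union> insert m ` ?P m k'"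
      then show "T \<in> ?P (Suc m) k"
      proof
        assume "T \<in> insert m ` ?P m k'"
        then obtain T' where T': "T = insert m T'" "T' \<subseteq> {..<m}" "card T' = k'" by auto
        then have "m \<notin> T'" "finite T'" by (auto intro: finite_subset)
        with T' show ?thesis using Suc by (auto simp: lessThan_Suc)
      qed (auto simp: lessThan_Suc)
    qed
    have inj: "inj_on (insert m) (?P m k')"
    proof (rule inj_onI)
      fix S T assume "S \<in> ?P m k'" "T \<in> ?P m k'" "insert m S = insert m T"
      moreover from this have "m \<notin> S" "m \<notin> T" by auto
      ultimately show "S = T" by (metis Diff_insert_absorb)
    qed
    define s where "s = (\<Sum>t<m. z t)"
    have s: "s \<ge> 0" unfolding s_def using assms by (intro sum_nonneg) auto
    have "(\<Sum>T\<in>?P (Suc m) k. \<Prod>t\<in>T. z t) = (\<Sum>T\<in>?P m k. \<Prod>t\<in>T. z t) + (\<Sum>T\<in>insert m ` ?P m k'. \<Prod>t\<in>T. z t)"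
      unfolding split using fin by (intro sum.union_disjoint) auto
    also have "(\<Sum>T\<in>insert m ` ?P m k'. \<Prod>t\<in>T. z t) = (\<Sum>T\<in>?P m k'. \<Prod>t\<in>insert m T. z t)"
      using inj by (simp add: sum.reindex)
    also have "\<dots> = (\<Sum>T\<in>?P m k'. z m * (\<Prod>t\<in>T. z t))"
      by (intro sum.cong refl prod.insert) (auto intro: finite_subset)
    also have "\<dots> = z m * (\<Sum>T\<in>?P m k'. \<Prod>t\<in>T. z t)" by (simp add: sum_distrib_left)
    also have "\<dots> \<le> z m * (s ^ k' / fact k')"
      unfolding s_def using assms by (intro mult_left_mono Suc.IH) auto
    also have "(\<Sum>T\<in>?P m k. \<Prod>t\<in>T. z t) \<le> s ^ k / fact k" unfolding s_def by (rule Suc.IH)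
    finally have "(\<Sum>T\<in>?P (Suc m) k. \<Prod>t\<in>T. z t) \<le> s ^ k / fact k + z m * (s ^ k' / fact k')" by simp
    also have "\<dots> = (s ^ k + real k * z m * s ^ k') / fact k"
    proof -
      have "s ^ k' / fact k' = real k * s ^ k' / fact k"
        using Suc by (simp del: of_nat_Suc)
      then show ?thesis by (simp add: add_divide_distrib)
    qed
    also have "\<dots> \<le> (s + z m) ^ k / fact k"
    proof (intro divide_right_mono)
      have "s ^ j * s + real (Suc j) * z m * s ^ j \<le> (s + z m) ^ Suc j" for j
      proof (induction j)
        case (Suc j)
        have "s ^ Suc j * s + real (Suc (Suc j)) * z m * s ^ Suc j
            \<le> (s + z m) * (s ^ j * s + real (Suc j) * z m * s ^ j)"
          using assms[of m] s by (simp add: algebra_simps)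
        also have "\<dots> \<le> (s + z m) * (s + z m) ^ Suc j"
          using Suc assms[of m] s by (intro mult_left_mono) auto
        finally show ?case by simp
      qed simp
      from this[of k'] show "s ^ k + real k * z m * s ^ k' \<le> (s + z m) ^ k"
        using Suc by (simp add: algebra_simps)
    qed simp
    finally show ?thesis by (simp add: s_def add.commute)
  qed
qed

section \<open>Weights of ears below the threshold\<close>

context random_clauses
begin

lemma A_ne [simp]: "A \<noteq> {}"
  using card_A by auto

text \<open>The parameter \<open>a t\<close> is the distance of the clause density at time \<open>t\<close> from the threshold;
  a path in the implication graph of the first \<open>t\<close> clauses has expected length about \<open>1 / a t\<close>.\<close>

definition gap :: "nat \<Rightarrow> real" where
  "gap t = 1 - real t / (real n - 1)"

lemma extends_trans:
  assumes "extends t R W R1 W1" "extends t R1 W2 R2 W3" "W1 \<subseteq> W2"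
  shows "extends t R W R2 W3"
proof -
  have e: "R \<subseteq> R1" "R1 \<subseteq> R2" "W \<subseteq> W1" "W2 \<subseteq> W3" "wf_pat R2" "W3 \<subseteq> A" "vars R2 \<subseteq> W3"
    "fst ` (R1 - R) \<subseteq> {..<t}" "fst ` (R2 - R1) \<subseteq> {..<t}"
    using assms by (simp_all add: extends_def)
  have "R2 - R \<subseteq> (R2 - R1) \<union> (R1 - R)" by auto
  from image_mono[OF this, of fst]
  have "fst ` (R2 - R) \<subseteq> fst ` (R2 - R1) \<union> fst ` (R1 - R)" by (simp add: image_Un)
  moreover have "fst ` (R2 - R1) \<union> fst ` (R1 - R) \<subseteq> {..<t}" using e by simp
  ultimately have "fst ` (R2 - R) \<subseteq> {..<t}" by (rule subset_trans)
  moreover have "R \<subseteq> R2" using e(1,2) by (rule subset_trans)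
  moreover have "W \<subseteq> W3" using e(3) assms(3) e(4) by simp
  ultimately show ?thesis using e by (simp add: extends_def)
qed

text \<open>The bound on the mean number of continuations of an implication path: t times, 2n second
  literals, probability q each. Counting all 2n literals instead of the 2(n - 1) admissible ones
  puts n - 1 into the denominator of \<open>gap\<close>.\<close>

lemma q_gap: "real t * q * (2 * real n) = 1 - gap t"
proof -
  have "real t * (1 / (2 * N * c)) * (2 * N) = 1 - (1 - real t / c)" if "N > 0" for N c :: real
    using that by simp
  from this[of "real n" "real n - 1"] card_A show ?thesis by (simp add: gap_def q_def)
qed

lemma gap_le_1: "gap t \<le> 1" and gap_antimono: "s \<le> t \<Longrightarrow> gap t \<le> gap s"
  using card_A by (auto simp: gap_def divide_right_mono)

text \<open>Relative to the right-hand side, closing contributes a/2 and extending at most 1 +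
  5a/16, and (1 - a)(1 + 13a/16) \<le> 1. The 2 in 2/(a^2 n) is what reduces closing to a/2.\<close>

lemma ear_weight:
  assumes a: "gap t > 0"
  shows "real t * q * (2 * real w * growth (gap t) j w + 2 * real n * (2 / ((gap t)\<^sup>2 * real n) * growth (gap t) (Suc j) (Suc w)))
    \<le> 2 / ((gap t)\<^sup>2 * real n) * growth (gap t) (Suc j) w"
proof -
  define a where "a = gap t"
  have a: "0 < a" "a \<le> 1" using assms gap_le_1 by (auto simp: a_def)
  have n: "real n > 0" using card_A by simp
  define g where "g = growth a (Suc j) w"
  have g: "g \<ge> 0" using a by (simp add: g_def growth_nonneg)
  have 1: "real w * growth a j w \<le> g / a" using growth_Suc(1)[OF a] by (simp add: g_def)
  have 2: "growth a (Suc j) (Suc w) \<le> (1 + 5 * a / 16) * g" using growth_Suc(2)[OF a] by (simp add: g_def)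
  have "real t * q * (2 * real w * growth a j w + 2 * real n * (2 / (a\<^sup>2 * real n) * growth a (Suc j) (Suc w)))
    = (1 - a) * ((real w * growth a j w) / real n + 2 / (a\<^sup>2 * real n) * growth a (Suc j) (Suc w))"
  proof -
    have "real t * q * (2 * real w * x + 2 * real n * y) = (real t * q * (2 * real n)) * (real w * x / real n + y)" for x y
      using n by (simp add: field_simps)
    then have "real t * q * (2 * real w * x + 2 * real n * y) = (1 - gap t) * (real w * x / real n + y)" for x y
      by (simp only: q_gap)
    then show ?thesis unfolding a_def .
  qed
  also have "\<dots> \<le> (1 - a) * ((g / a) / real n + 2 / (a\<^sup>2 * real n) * ((1 + 5 * a / 16) * g))"
    using a n 1 2 by (intro mult_left_mono add_mono divide_right_mono) auto
  also have "\<dots> = 2 / (a\<^sup>2 * real n) * g * ((1 - a) * (a / 2 + (1 + 5 * a / 16)))"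
  proof -
    define h c where "h = 2 / (a\<^sup>2 * real n) * g" and "c = 1 + 5 * a / 16"
    have "(g / a) / real n = h * (a / 2)"
      using a n by (simp add: h_def field_simps power2_eq_square)
    moreover have "2 / (a\<^sup>2 * real n) * (c * g) = h * c" by (simp add: h_def)
    moreover have "(1 - a) * (h * (a / 2) + h * c) = h * ((1 - a) * (a / 2 + c))"
      by (simp add: algebra_simps)
    ultimately show ?thesis by (simp only: h_def[symmetric] c_def[symmetric])
  qed
  also have "\<dots> \<le> 2 / (a\<^sup>2 * real n) * g * 1"
  proof (intro mult_left_mono)
    have "(1 - a) * (a / 2 + (1 + 5 * a / 16)) = 1 - 3 * a / 16 - 13 * a\<^sup>2 / 16"
      by (simp add: field_simps power2_eq_square)
    moreover have "0 \<le> a\<^sup>2" by simp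
    ultimately show "(1 - a) * (a / 2 + (1 + 5 * a / 16)) \<le> 1" using a by linarith
  qed (use a n g in auto)
  also have "\<dots> = 2 / (a\<^sup>2 * real n) * g" by simp
  finally show ?thesis unfolding a_def g_def .
qed

lemma roots_weight:
  assumes a: "gap t > 0"
  shows "2 * real w * growth (gap t) j w + 2 * real n * (2 / ((gap t)\<^sup>2 * real n) * growth (gap t) (Suc j) (Suc w))
    \<le> 8 / (gap t)\<^sup>2 * growth (gap t) (Suc j) w"
proof -
  define a where "a = gap t"
  have a: "0 < a" "a \<le> 1" using assms gap_le_1 by (auto simp: a_def)
  have n: "real n > 0" using card_A by simp
  define g where "g = growth a (Suc j) w"
  have g: "g \<ge> 0" using a by (simp add: g_def growth_nonneg)
  have 1: "real w * growth a j w \<le> g / a" using growth_Suc(1)[OF a] by (simp add: g_def)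
  have 2: "growth a (Suc j) (Suc w) \<le> (1 + 5 * a / 16) * g" using growth_Suc(2)[OF a] by (simp add: g_def)
  have "2 * real w * growth a j w + 2 * real n * (2 / (a\<^sup>2 * real n) * growth a (Suc j) (Suc w))
    = 2 * (real w * growth a j w) + 4 / a\<^sup>2 * growth a (Suc j) (Suc w)"
    using n by (simp add: field_simps)
  also have "\<dots> \<le> 2 * (g / a) + 4 / a\<^sup>2 * ((1 + 5 * a / 16) * g)"
    using a 1 2 by (intro add_mono mult_left_mono) auto
  also have "\<dots> = g / a\<^sup>2 * (2 * a + 4 + 5 * a / 4)"
    using a by (simp add: field_simps power2_eq_square)
  also have "\<dots> \<le> g / a\<^sup>2 * 8"
    using a g by (intro mult_left_mono) auto
  also have "\<dots> = 8 / a\<^sup>2 * g" by simp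
  finally show ?thesis unfolding a_def g_def .
qed

text \<open>Nested explorations for the two literals of a clause. The inner one, from
  \<open>y\<close>, starts with all that the outer one has exposed, so shared variables are
  accounted for; each contributes a factor 8/a^2 and raises the index of \<open>growth\<close> by
  one. \<open>Q x y\<close> stands for the rest of the event, that is, the clause at time
  \<open>t\<close> itself and the later bad times.\<close>

lemma two_roots:
  assumes t: "t \<le> m" and a: "gap t > 0" and \<kappa>: "\<kappa> \<ge> 0"
    and hyp: "\<And>R' W' x y. extends t R W R' W' \<Longrightarrow> fst x \<in> W' \<Longrightarrow> fst y \<in> W' \<Longrightarrow>
      pr (Ev R' \<inter> Q x y) \<le> \<kappa> * q ^ card R' * growth (gap t) j (card W')"
    and R: "wf_pat R" "vars R \<subseteq> W" "W \<subseteq> A"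
  shows "(\<Sum>x\<in>lits A. \<Sum>y\<in>lits A. pr (Ev R \<inter> {f. x \<in> spine (f ` {..<t})} \<inter> {f. y \<in> spine (f ` {..<t})} \<inter> Q x y))
    \<le> \<kappa> * q ^ card R * (64 / gap t ^ 4) * growth (gap t) (Suc (Suc j)) (card W)"
proof -
  define a where "a = gap t"
  have a: "0 < a" using assms by (auto simp: a_def)
  have n: "real n > 0" using card_A by simp
  define S where "S j w = 2 / (a\<^sup>2 * real n) * growth a (Suc j) w" for j w
  have gg0: "growth a j w \<ge> 0" for j w using a by (simp add: growth_nonneg)
  have S0: "S j w \<ge> 0" for j w using a n gg0 by (simp add: S_def)
  have Sw: "real t * q * (2 * real w * growth a j w + 2 * real n * S j (Suc w)) \<le> S j w" for j w
    using ear_weight[of t w j] assms(2) by (simp add: S_def a_def)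
  have Tw: "2 * real w * growth a j w + 2 * real n * S j (Suc w) \<le> 8 / a\<^sup>2 * growth a (Suc j) w" for j w
    using roots_weight[of t w j] assms(2) by (simp add: S_def a_def)
  define spn where "spn x = {f :: nat \<Rightarrow> clause. x \<in> spine (f ` {..<t})}" for x
  have inner: "(\<Sum>y\<in>lits A. pr (Ev R' \<inter> spn y \<inter> Q x y)) \<le> \<kappa> * q ^ card R' * (8 / a\<^sup>2) * growth a (Suc j) (card W')"
    if ext: "extends t R (insert (fst x) W) R' W'" and x: "x \<in> lits A" for x R' W'
  proof -
    have R': "wf_pat R'" "vars R' \<subseteq> W'" "W' \<subseteq> A" "fst x \<in> W'" "extends t R W R' W'"
      using ext by (auto simp: extends_def)
    have "(\<Sum>y\<in>lits A. pr (Ev R' \<inter> spn y \<inter> Q x y)) \<le>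
        (\<Sum>y\<in>lits A. \<kappa> * q ^ card R' * (if fst y \<in> W' then growth a j (card W') else S j (Suc (card W'))))"
    proof (rule sum_mono)
      fix y assume y: "y \<in> lits A"
      show "pr (Ev R' \<inter> spn y \<inter> Q x y) \<le> \<kappa> * q ^ card R' * (if fst y \<in> W' then growth a j (card W') else S j (Suc (card W')))"
        unfolding spn_def
      proof (rule root_bound[OF t subadd_pr[of "Q x y"] \<kappa>, of "growth a j" "S j"])
        show "pr (Ev R'' \<inter> Q x y) \<le> \<kappa> * q ^ card R'' * growth a j (card W'')"
          if e: "extends t R' (insert (fst y) W') R'' W''" for R'' W''
        proof -
          have "extends t R W R'' W''" by (rule extends_trans[OF R'(5) e]) (rule subset_insertI)
          moreover have "fst x \<in> W''" "fst y \<in> W''" using e R'(4) by (auto simp: extends_def)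
          ultimately show ?thesis using hyp by (simp add: a_def)
        qed
      qed (use R' y gg0 S0 Sw in auto)
    qed
    also have "\<dots> = \<kappa> * q ^ card R' * (\<Sum>y\<in>lits A. if fst y \<in> W' then growth a j (card W') else S j (Suc (card W')))"
      by (simp add: sum_distrib_left)
    also have "\<dots> \<le> \<kappa> * q ^ card R' * (2 * real (card W') * growth a j (card W') + 2 * real n * S j (Suc (card W')))"
      using \<kappa> q_pos R' gg0 S0 by (intro mult_left_mono sum_lits_le) auto
    also have "\<dots> \<le> \<kappa> * q ^ card R' * (8 / a\<^sup>2 * growth a (Suc j) (card W'))"
      using \<kappa> q_pos by (intro mult_left_mono Tw) auto
    finally show ?thesis by simp
  qed
  define \<kappa>' where "\<kappa>' = \<kappa> * (8 / a\<^sup>2)"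
  have \<kappa>': "\<kappa>' \<ge> 0" using \<kappa> by (simp add: \<kappa>'_def)
  have "(\<Sum>x\<in>lits A. \<Sum>y\<in>lits A. pr (Ev R \<inter> spn x \<inter> spn y \<inter> Q x y)) \<le>
      (\<Sum>x\<in>lits A. \<kappa>' * q ^ card R * (if fst x \<in> W then growth a (Suc j) (card W) else S (Suc j) (Suc (card W))))"
  proof (rule sum_mono)
    fix x assume x: "x \<in> lits A"
    have M: "subadd (\<lambda>E. \<Sum>y\<in>lits A. pr (E \<inter> (spn y \<inter> Q x y)))"
      by (rule subadd_sum) simp
    have "(\<Sum>y\<in>lits A. pr (Ev R \<inter> {f. x \<in> spine (f ` {..<t})} \<inter> (spn y \<inter> Q x y))) \<le>
       \<kappa>' * q ^ card R * (if fst x \<in> W then growth a (Suc j) (card W) else S (Suc j) (Suc (card W)))"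
    proof (rule root_bound[OF t M \<kappa>', of "growth a (Suc j)" "S (Suc j)"])
      show "(\<Sum>y\<in>lits A. pr (Ev R' \<inter> (spn y \<inter> Q x y))) \<le> \<kappa>' * q ^ card R' * growth a (Suc j) (card W')"
        if "extends t R (insert (fst x) W) R' W'" for R' W'
        using inner[OF that x] by (simp add: \<kappa>'_def Int_assoc mult_ac)
    qed (use R x gg0 S0 Sw in auto)
    then show "(\<Sum>y\<in>lits A. pr (Ev R \<inter> spn x \<inter> spn y \<inter> Q x y)) \<le>
       \<kappa>' * q ^ card R * (if fst x \<in> W then growth a (Suc j) (card W) else S (Suc j) (Suc (card W)))"
      by (simp add: Int_assoc spn_def)
  qed
  also have "\<dots> = \<kappa>' * q ^ card R * (\<Sum>x\<in>lits A. if fst x \<in> W then growth a (Suc j) (card W) else S (Suc j) (Suc (card W)))"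
    by (simp add: sum_distrib_left)
  also have "\<dots> \<le> \<kappa>' * q ^ card R * (2 * real (card W) * growth a (Suc j) (card W) + 2 * real n * S (Suc j) (Suc (card W)))"
    using \<kappa>' q_pos R gg0 S0 by (intro mult_left_mono sum_lits_le) auto
  also have "\<dots> \<le> \<kappa>' * q ^ card R * (8 / a\<^sup>2 * growth a (Suc (Suc j)) (card W))"
    using \<kappa>' q_pos by (intro mult_left_mono Tw) auto
  also have "\<dots> = \<kappa> * q ^ card R * (64 / a ^ 4) * growth a (Suc (Suc j)) (card W)"
    by (simp add: \<kappa>'_def field_simps power2_eq_square power4_eq_xxxx)
  finally show ?thesis by (simp add: a_def spn_def)
qed

end

definition random_cnf :: "nat set \<Rightarrow> nat \<Rightarrow> formula pmf" where
  "random_cnf A m = replicate_pmf m (pmf_of_set (clauses_on A))"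

lemma random_formula_eq: "random_formula n m = random_cnf {..<n} m"
  by (simp add: random_formula_def random_cnf_def proper_clauses_eq)

lemma power_div_fact_le_exp: "real k ^ k / fact k \<le> exp (real k)"
proof -
  have "(\<Sum>i\<in>{k}. real k ^ i /\<^sub>R fact i) \<le> (\<Sum>i. real k ^ i /\<^sub>R fact i)"
    using summable_exp_generic[of "real k"] by (intro sum_le_suminf) auto
  then show ?thesis by (simp add: exp_def divide_inverse mult.commute)
qed

section \<open>Bad times below the threshold\<close>

context random_clauses
begin

lemma extends_fst: "extends t R W R' W' \<Longrightarrow> fst ` R' \<subseteq> fst ` R \<union> {..<t}"
proof -
  assume e: "extends t R W R' W'"
  have "fst ` R' = fst ` (R' - R) \<union> fst ` R"
    using e by (metis Un_Diff_cancel2 extends_def image_Un sup.absorb1)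
  then show ?thesis using e by (auto simp: extends_def)
qed

text \<open>The earliest time is treated first. It exposes only clauses at times up to
  \<open>t\<close>, so the later times are untouched and the induction hypothesis applies to the
  enlarged pattern. Each bad time contributes 64 / gap^4 for its two literals and \<open>q\<close>
  \<le> 1/n^2 for its clause. Times interact only through the number of explored variables, hence
  the single \<open>growth\<close> with two ears per time; as \<open>gap\<close> decreases in time,
  the first one dominates.\<close>

lemma bad_times:
  assumes "sorted_wrt (<) ts" "set ts \<subseteq> {..<m}" "\<And>t. t \<in> set ts \<Longrightarrow> gap t > 0" "set ts \<inter> fst ` R = {}"
    and "wf_pat R" "vars R \<subseteq> W" "W \<subseteq> A"
  shows "pr (Ev R \<inter> {f. \<forall>t\<in>set ts. bad f t}) \<le>
    q ^ card R * (\<Prod>t\<leftarrow>ts. 64 / (gap t ^ 4 * (real n)\<^sup>2)) * growth (case ts of [] \<Rightarrow> 1 | t # _ \<Rightarrow> gap t) (2 * length ts) (card W)"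
  using assms
proof (induction ts arbitrary: R W)
  case Nil
  then show ?case using pr_Ev[of R] by (simp add: growth_def)
next
  case (Cons t ts)
  define P where "P = (\<Prod>t\<leftarrow>ts. 64 / (gap t ^ 4 * (real n)\<^sup>2))"
  have P: "P \<ge> 0" unfolding P_def by (induction ts) auto
  define Q where "Q x y = {f. f t = {x, y} \<and> (\<forall>t\<in>set ts. bad f t)}" for x y :: literal
  have t: "t < m" "gap t > 0" "t \<notin> fst ` R" using Cons.prems by auto
  have key: "pr (Ev R' \<inter> Q x y) \<le> (q * P) * q ^ card R' * growth (gap t) (2 * length ts) (card W')"
    if e: "extends t R W R' W'" and xy: "fst x \<in> W'" "fst y \<in> W'" for R' W' x y
  proof (cases "{x, y} \<in> clauses_on A")
    case False
    have "pr (Ev R' \<inter> Q x y) \<le> pr {}"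
    proof (rule pr_mono)
      fix f assume f: "f \<in> \<Omega>" "f \<in> Ev R' \<inter> Q x y"
      have "f t \<in> clauses_on A" using f(1) t by (auto simp: \<Omega>_def PiE_def Pi_def)
      moreover have "f t = {x, y}" using f(2) by (simp add: Q_def)
      ultimately show "f \<in> {}" using False by simp
    qed
    also have "\<dots> = 0" by (simp add: pr_eq)
    also have "\<dots> \<le> (q * P) * q ^ card R' * growth (gap t) (2 * length ts) (card W')"
      using P q_pos t by (simp add: growth_nonneg)
    finally show ?thesis .
  next
    case True
    define R'' where "R'' = insert (t, {x, y}) R'"
    have R': "wf_pat R'" "vars R' \<subseteq> W'" "W' \<subseteq> A" "fst ` R' \<subseteq> fst ` R \<union> {..<t}"
      using e extends_fst[OF e] by (auto simp: extends_def)
    have tR': "t \<notin> fst ` R'" using R'(4) t(3) by blast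
    then have "(t, {x, y}) \<notin> R'" by force
    then have card: "card R'' = Suc (card R')" using R'(1) by (simp add: R''_def wf_pat_def)
    have wf: "wf_pat R''" using R'(1) tR' t True unfolding wf_pat_def R''_def by auto
    have disj: "set ts \<inter> fst ` R'' = {}"
    proof -
      have "t' \<notin> fst ` R''" if "t' \<in> set ts" for t'
      proof -
        have "t < t'" "t' \<notin> fst ` R" using that Cons.prems by auto
        then show ?thesis using R'(4) by (auto simp: R''_def)
      qed
      then show ?thesis by blast
    qed
    have "pr (Ev R' \<inter> Q x y) \<le> pr (Ev R'' \<inter> {f. \<forall>t\<in>set ts. bad f t})"
      by (intro pr_mono) (auto simp: Q_def R''_def Ev_insert)
    also have "\<dots> \<le> q ^ card R'' * P * growth (case ts of [] \<Rightarrow> 1 | t # _ \<Rightarrow> gap t) (2 * length ts) (card W')"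
      unfolding P_def using Cons.prems wf disj R' xy
      by (intro Cons.IH) (auto simp: R''_def)
    also have "\<dots> \<le> q ^ card R'' * P * growth (gap t) (2 * length ts) (card W')"
    proof (intro mult_left_mono)
      show "growth (case ts of [] \<Rightarrow> 1 | t # _ \<Rightarrow> gap t) (2 * length ts) (card W') \<le> growth (gap t) (2 * length ts) (card W')"
      proof (cases ts)
        case (Cons t' ts')
        then have "t < t'" "gap t' > 0" using Cons.prems by auto
        then have "gap t' \<le> gap t" "gap t' \<ge> 0" by (auto intro!: gap_antimono)
        then show ?thesis unfolding Cons by (simp add: growth_mono)
      qed (simp add: growth_def)
    qed (use P q_pos in auto)
    finally show ?thesis using card by (simp add: mult_ac)
  qed
  have "pr (Ev R \<inter> {f. \<forall>t\<in>set (t # ts). bad f t}) \<le>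
      (\<Sum>i\<in>lits A \<times> lits A. pr (Ev R \<inter> {f. fst i \<in> spine (f ` {..<t})} \<inter> {f. snd i \<in> spine (f ` {..<t})} \<inter> Q (fst i) (snd i)))"
  proof (rule pr_UN_le)
    fix f assume f: "f \<in> \<Omega>" "f \<in> Ev R \<inter> {f. \<forall>t\<in>set (t # ts). bad f t}"
    have "f t \<in> clauses_on A" using f t by (auto simp: \<Omega>_def)
    then obtain x y where xy: "f t = {x, y}" "fst x \<in> A" "fst y \<in> A" by (auto simp: clauses_on_def)
    have "bad f t" using f by simp
    then have "x \<in> spine (f ` {..<t})" "y \<in> spine (f ` {..<t})" by (auto simp: bad_def xy)
    then show "\<exists>i\<in>lits A \<times> lits A. f \<in> Ev R \<inter> {f. fst i \<in> spine (f ` {..<t})} \<inter> {f. snd i \<in> spine (f ` {..<t})} \<inter> Q (fst i) (snd i)"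
      using xy f by (intro bexI[of _ "(x, y)"]) (auto simp: Q_def lits_iff)
  qed simp
  also have "\<dots> = (\<Sum>x\<in>lits A. \<Sum>y\<in>lits A. pr (Ev R \<inter> {f. x \<in> spine (f ` {..<t})} \<inter> {f. y \<in> spine (f ` {..<t})} \<inter> Q x y))"
    by (simp add: sum.cartesian_product case_prod_unfold)
  also have "\<dots> \<le> (q * P) * q ^ card R * (64 / gap t ^ 4) * growth (gap t) (Suc (Suc (2 * length ts))) (card W)"
    using t P q_pos Cons.prems key by (intro two_roots) auto
  also have "\<dots> = q * (q ^ card R * P * (64 / gap t ^ 4) * growth (gap t) (2 * length (t # ts)) (card W))"
    by simp
  also have "\<dots> \<le> 1 / (real n)\<^sup>2 * (q ^ card R * P * (64 / gap t ^ 4) * growth (gap t) (2 * length (t # ts)) (card W))"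
  proof (rule mult_right_mono)
    have "(real n)\<^sup>2 \<le> 2 * real n * (real n - 1)"
      using card_A mult_left_mono[of 2 "real n" "real n"] by (simp add: algebra_simps power2_eq_square)
    then show "q \<le> 1 / (real n)\<^sup>2" unfolding q_def using card_A by (intro divide_left_mono) auto
  qed (use P q_pos t in \<open>simp add: growth_nonneg\<close>)
  also have "\<dots> = q ^ card R * (\<Prod>t\<leftarrow>t # ts. 64 / (gap t ^ 4 * (real n)\<^sup>2)) * growth (case t # ts of [] \<Rightarrow> 1 | t # _ \<Rightarrow> gap t) (2 * length (t # ts)) (card W)"
    by (simp add: P_def mult_ac)
  finally show ?case .
qed

lemma gap_pos: "gap m > 0 \<Longrightarrow> t \<le> m \<Longrightarrow> gap t > 0"
  using gap_antimono[of t m] by linarith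

text \<open>Telescoping: 1 / gap^2 at k is at most 1 / (gap (k+1) * gap k), which is n - 1 times the
  increment of 1 / gap.\<close>

lemma sum_gap_le:
  assumes "gap m > 0"
  shows "(\<Sum>t<m. 1 / (gap t)\<^sup>2) \<le> (real n - 1) / gap m"
proof -
  have n: "real n - 1 > 0" using card_A by simp
  have "k \<le> m \<Longrightarrow> (\<Sum>t<k. 1 / (gap t)\<^sup>2) \<le> (real n - 1) / gap k" for k
  proof (induction k)
    case 0
    then show ?case using n by (simp add: gap_def)
  next
    case (Suc k)
    have g: "gap (Suc k) > 0" "gap k > 0" using Suc.prems gap_pos[OF assms] by auto
    have d: "gap k - gap (Suc k) = 1 / (real n - 1)"
      by (simp add: gap_def diff_divide_distrib[symmetric] add_divide_distrib)
    have "(real n - 1) / gap (Suc k) - (real n - 1) / gap k = (real n - 1) * (gap k - gap (Suc k)) / (gap (Suc k) * gap k)"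
      using g by (simp add: field_simps)
    also have "\<dots> = 1 / (gap (Suc k) * gap k)" unfolding d using n by simp
    finally have "(real n - 1) / gap (Suc k) = (real n - 1) / gap k + 1 / (gap (Suc k) * gap k)" by simp
    moreover have "1 / (gap k)\<^sup>2 \<le> 1 / (gap (Suc k) * gap k)"
      using g gap_antimono[of k "Suc k"] by (intro divide_left_mono) (auto simp: power2_eq_square intro!: mult_right_mono)
    ultimately show ?case using Suc by simp
  qed
  then show ?thesis by simp
qed

lemma sum_gap4_le:
  assumes "gap m > 0"
  shows "(\<Sum>t<m. 64 / (gap t ^ 4 * (real n)\<^sup>2) * growth (gap t) 2 w) \<le> 64 * (gap m * real w + 8)\<^sup>2 / (gap m ^ 3 * real n)"
    and "(\<Sum>t<m. 64 / (gap t ^ 4 * (real n)\<^sup>2)) \<le> 64 / (gap m ^ 3 * real n)"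
proof -
  define a where "a = gap m"
  have a: "a > 0" using assms by (simp add: a_def)
  have n: "real n > 0" using card_A by simp
  \<comment> \<open>Common form of both sums: the bound on \<open>h\<close> trades two of the four
    powers of \<open>gap t\<close> for powers of \<open>a\<close> and leaves the telescoping
    sum.\<close>
  have main: "(\<Sum>t<m. 64 / (gap t ^ 4 * (real n)\<^sup>2) * h t) \<le> 64 * c / (a ^ 3 * real n)"
    if h: "\<And>t. t < m \<Longrightarrow> h t \<le> (gap t)\<^sup>2 / a\<^sup>2 * c" and c: "c \<ge> 0" for h c
  proof -
    have "(\<Sum>t<m. 64 / (gap t ^ 4 * (real n)\<^sup>2) * h t) \<le> (\<Sum>t<m. 64 * c / (a\<^sup>2 * (real n)\<^sup>2) * (1 / (gap t)\<^sup>2))"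
    proof (rule sum_mono)
      fix t assume t: "t \<in> {..<m}"
      then have g: "gap t > 0" using gap_pos[OF assms] by auto
      have "64 / (gap t ^ 4 * (real n)\<^sup>2) * h t \<le> 64 / (gap t ^ 4 * (real n)\<^sup>2) * ((gap t)\<^sup>2 / a\<^sup>2 * c)"
        using h t g by (intro mult_left_mono) auto
      also have "\<dots> = 64 * c / (a\<^sup>2 * (real n)\<^sup>2) * (1 / (gap t)\<^sup>2)"
        using g a n by (simp add: field_simps power2_eq_square power4_eq_xxxx)
      finally show "64 / (gap t ^ 4 * (real n)\<^sup>2) * h t \<le> 64 * c / (a\<^sup>2 * (real n)\<^sup>2) * (1 / (gap t)\<^sup>2)" .
    qed
    also have "\<dots> = 64 * c / (a\<^sup>2 * (real n)\<^sup>2) * (\<Sum>t<m. 1 / (gap t)\<^sup>2)"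
      by (simp add: sum_distrib_left)
    also have "\<dots> \<le> 64 * c / (a\<^sup>2 * (real n)\<^sup>2) * (real n / a)"
    proof (rule mult_left_mono)
      have "(real n - 1) / gap m \<le> real n / a" using a by (simp add: a_def divide_right_mono)
      then show "(\<Sum>t<m. 1 / (gap t)\<^sup>2) \<le> real n / a" using sum_gap_le[OF assms] by simp
    qed (use c in auto)
    also have "\<dots> = 64 * c / (a ^ 3 * real n)"
      using a n by (simp add: field_simps power2_eq_square power3_eq_cube)
    finally show ?thesis .
  qed
  have ga: "gap t \<ge> a" if "t < m" for t using gap_antimono[of t m] that by (simp add: a_def)
  have 1: "growth (gap t) 2 w \<le> (gap t)\<^sup>2 / a\<^sup>2 * (a * real w + 8)\<^sup>2" if t: "t < m" for t
  proof -
    have "gap t * real w + 8 \<le> gap t / a * (a * real w + 8)"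
      using a ga[OF t] by (simp add: field_simps)
    then have "(gap t * real w + 8)\<^sup>2 \<le> (gap t / a * (a * real w + 8))\<^sup>2"
      using a ga[OF t] by (intro power_mono) auto
    then show ?thesis by (simp add: growth_def power_mult_distrib power_divide)
  qed
  show "(\<Sum>t<m. 64 / (gap t ^ 4 * (real n)\<^sup>2) * growth (gap t) 2 w) \<le> 64 * (gap m * real w + 8)\<^sup>2 / (gap m ^ 3 * real n)"
    using main[of "\<lambda>t. growth (gap t) 2 w" "(a * real w + 8)\<^sup>2"] 1 by (simp add: a_def)
  have 2: "1 \<le> (gap t)\<^sup>2 / a\<^sup>2 * 1" if t: "t < m" for t
  proof -
    have "a\<^sup>2 \<le> (gap t)\<^sup>2" using a ga[OF t] by (intro power_mono) auto
    then show ?thesis using a by simp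
  qed
  show "(\<Sum>t<m. 64 / (gap t ^ 4 * (real n)\<^sup>2)) \<le> 64 / (gap m ^ 3 * real n)"
    using main[of "\<lambda>t. 1" 1] 2 by (simp add: a_def)
qed

lemma pr_bad:
  assumes "gap m > 0" "wf_pat R" "vars R \<subseteq> W" "W \<subseteq> A"
  shows "(\<Sum>t\<in>{..<m} - fst ` R. pr (Ev R \<inter> {f. bad f t})) \<le> q ^ card R * (64 * (gap m * real (card W) + 8)\<^sup>2 / (gap m ^ 3 * real n))"
proof -
  have "(\<Sum>t\<in>{..<m} - fst ` R. pr (Ev R \<inter> {f. bad f t})) \<le>
      (\<Sum>t\<in>{..<m} - fst ` R. q ^ card R * (64 / (gap t ^ 4 * (real n)\<^sup>2) * growth (gap t) 2 (card W)))"
  proof (rule sum_mono)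
    fix t assume t: "t \<in> {..<m} - fst ` R"
    then show "pr (Ev R \<inter> {f. bad f t}) \<le> q ^ card R * (64 / (gap t ^ 4 * (real n)\<^sup>2) * growth (gap t) 2 (card W))"
      using bad_times[of "[t]" R W] gap_pos[OF assms(1), of t] assms by (auto simp: numeral_2_eq_2)
  qed
  also have "\<dots> \<le> (\<Sum>t<m. q ^ card R * (64 / (gap t ^ 4 * (real n)\<^sup>2) * growth (gap t) 2 (card W)))"
  proof (rule sum_mono2)
    show "0 \<le> q ^ card R * (64 / (gap t ^ 4 * (real n)\<^sup>2) * growth (gap t) 2 (card W))"
      if "t \<in> {..<m} - ({..<m} - fst ` R)" for t
      using q_pos gap_pos[OF assms(1), of t] that by (simp add: growth_nonneg)
  qed auto
  also have "\<dots> = q ^ card R * (\<Sum>t<m. 64 / (gap t ^ 4 * (real n)\<^sup>2) * growth (gap t) 2 (card W))"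
    by (simp add: sum_distrib_left)
  also have "\<dots> \<le> q ^ card R * (64 * (gap m * real (card W) + 8)\<^sup>2 / (gap m ^ 3 * real n))"
    using q_pos by (intro mult_left_mono sum_gap4_le assms) auto
  finally show ?thesis .
qed

text \<open>For k bad times there are 2k ears, and \<open>growth\<close> from the empty set is
  (8k)^(2k). Summing over k-sets gives a factor 1/k!; what remains is (64 * 64 * k^2 / (gap^3 n))^k
  / k!, and k^k / k! \<le> e^k with 4096 e < 12000 yields the constant.\<close>

lemma pr_many_bad:
  assumes a: "gap m > 0"
  shows "pr {f. k \<le> card {t \<in> {..<m}. bad f t}} \<le> (12000 * real k / (gap m ^ 3 * real n)) ^ k"
proof -
  have n: "real n > 0" using card_A by simp
  let ?z = "\<lambda>t. 64 / (gap t ^ 4 * (real n)\<^sup>2)"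
  let ?P = "{T. T \<subseteq> {..<m} \<and> card T = k}"
  have fin: "finite ?P" by (rule finite_subset[of _ "Pow {..<m}"]) auto
  have "pr {f. k \<le> card {t \<in> {..<m}. bad f t}} \<le> (\<Sum>T\<in>?P. pr {f. \<forall>t\<in>T. bad f t})"
  proof (rule pr_UN_le[OF fin])
    fix f assume "f \<in> {f. k \<le> card {t \<in> {..<m}. bad f t}}"
    then obtain T where "T \<subseteq> {t \<in> {..<m}. bad f t}" "card T = k"
      using obtain_subset_with_card_n[of k "{t \<in> {..<m}. bad f t}"] by auto
    then show "\<exists>T\<in>?P. f \<in> {f. \<forall>t\<in>T. bad f t}" by (intro bexI[of _ T]) auto
  qed
  also have "\<dots> \<le> (\<Sum>T\<in>?P. (\<Prod>t\<in>T. ?z t) * (8 * real k) ^ (2 * k))"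
  proof (rule sum_mono)
    fix T assume T: "T \<in> ?P"
    then have fT: "finite T" by (auto intro: finite_subset)
    let ?ts = "sorted_list_of_set T"
    have "pr (Ev {} \<inter> {f. \<forall>t\<in>set ?ts. bad f t}) \<le>
      q ^ card ({} :: (nat \<times> clause) set) * (\<Prod>t\<leftarrow>?ts. ?z t) * growth (case ?ts of [] \<Rightarrow> 1 | t # _ \<Rightarrow> gap t) (2 * length ?ts) (card ({} :: nat set))"
      using T fT gap_pos[OF a] by (intro bad_times) (auto simp: wf_pat_def vars_def)
    moreover have "(\<Prod>t\<leftarrow>?ts. ?z t) = (\<Prod>t\<in>T. ?z t)"
      using fT by (simp add: prod.distinct_set_conv_list[symmetric])
    moreover have "growth c (2 * length ?ts) (card ({} :: nat set)) = (8 * real k) ^ (2 * k)" for c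
      using T fT by (simp add: growth_def)
    ultimately show "pr {f. \<forall>t\<in>T. bad f t} \<le> (\<Prod>t\<in>T. ?z t) * (8 * real k) ^ (2 * k)"
      using fT by (simp add: Ev_def)
  qed
  also have "\<dots> = (\<Sum>T\<in>?P. \<Prod>t\<in>T. ?z t) * (8 * real k) ^ (2 * k)" by (simp add: sum_distrib_right)
  also have "\<dots> \<le> ((\<Sum>t<m. ?z t) ^ k / fact k) * (8 * real k) ^ (2 * k)"
    by (intro mult_right_mono sum_prod_subsets_le) (auto simp: zero_le_even_power)
  also have "\<dots> \<le> ((64 / (gap m ^ 3 * real n)) ^ k / fact k) * (8 * real k) ^ (2 * k)"
    by (intro mult_right_mono divide_right_mono power_mono sum_gap4_le a sum_nonneg) (auto simp: zero_le_even_power)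
  also have "\<dots> = (64 / (gap m ^ 3 * real n) * (64 * real k)) ^ k * (real k ^ k / fact k)"
  proof -
    have e: "(8 * real k) ^ (2 * k) = (64 * real k * real k) ^ k"
    proof -
      have "(8 * real k)\<^sup>2 = 64 * real k * real k" by (simp add: power2_eq_square)
      then show ?thesis by (simp only: power_mult)
    qed
    have "(64 :: real) ^ k * 64 ^ k = 4096 ^ k" by (simp flip: power_mult_distrib)
    then show ?thesis by (subst e) (simp add: power_mult_distrib power_divide)
  qed
  also have "\<dots> \<le> (64 / (gap m ^ 3 * real n) * (64 * real k)) ^ k * exp (real k)"
    using a n by (intro mult_left_mono power_div_fact_le_exp) auto
  also have "exp (real k) = exp 1 ^ k" by (simp add: exp_of_nat_mult[symmetric])
  also have "(64 / (gap m ^ 3 * real n) * (64 * real k)) ^ k * exp 1 ^ k = (exp 1 * 4096 * real k / (gap m ^ 3 * real n)) ^ k"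
  proof -
    have "64 / (gap m ^ 3 * real n) * (64 * real k) * exp 1 = exp 1 * 4096 * real k / (gap m ^ 3 * real n)" by simp
    then show ?thesis unfolding power_mult_distrib[symmetric] by (rule arg_cong)
  qed
  also have "\<dots> \<le> (12000 * real k / (gap m ^ 3 * real n)) ^ k"
  proof (intro power_mono divide_right_mono mult_right_mono)
    show "exp 1 * 4096 \<le> (12000 :: real)" using e_less_272 by simp
  qed (use a n in auto)
  finally show ?thesis .
qed

lemma random_cnf_eq: "random_cnf A m = map_pmf (\<lambda>f. map f [0..<m]) (pmf_of_set \<Omega>)"
proof -
  have cl: "finite (clauses_on A)" "clauses_on A \<noteq> {}"
  proof -
    show "finite (clauses_on A)" by (simp add: card_clauses_on)
    have "real (card (clauses_on A)) > 0" using card_cl q_pos by simp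
    then show "clauses_on A \<noteq> {}" by auto
  qed
  have "bij_betw (\<lambda>f. map f [0..<m]) \<Omega> {xs. set xs \<subseteq> clauses_on A \<and> length xs = m}"
  proof (rule bij_betw_byWitness[where f' = "\<lambda>xs. restrict (\<lambda>i. xs ! i) {..<m}"])
    show "\<forall>f\<in>\<Omega>. restrict (\<lambda>i. map f [0..<m] ! i) {..<m} = f"
    proof
      fix f assume f: "f \<in> \<Omega>"
      show "restrict (\<lambda>i. map f [0..<m] ! i) {..<m} = f"
      proof
        fix i show "restrict (\<lambda>i. map f [0..<m] ! i) {..<m} i = f i"
          using f by (cases "i < m") (auto simp: \<Omega>_def PiE_def extensional_def)
      qed
    qed
    show "\<forall>xs\<in>{xs. set xs \<subseteq> clauses_on A \<and> length xs = m}. map (restrict (\<lambda>i. xs ! i) {..<m}) [0..<m] = xs"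
      by (auto intro!: nth_equalityI)
    show "(\<lambda>f. map f [0..<m]) ` \<Omega> \<subseteq> {xs. set xs \<subseteq> clauses_on A \<and> length xs = m}"
      by (auto simp: \<Omega>_def PiE_def Pi_def)
    show "(\<lambda>xs. restrict (\<lambda>i. xs ! i) {..<m}) ` {xs. set xs \<subseteq> clauses_on A \<and> length xs = m} \<subseteq> \<Omega>"
      by (auto simp: \<Omega>_def dest: nth_mem)
  qed
  then show ?thesis unfolding random_cnf_def
    using map_pmf_of_set_bij_betw[of "\<lambda>f. map f [0..<m]" \<Omega>] replicate_pmf_of_set[OF cl, of m] by simp
qed

lemma prob_random_cnf: "measure_pmf.prob (random_cnf A m) E = pr {f. map f [0..<m] \<in> E}"
  by (simp add: random_cnf_eq pr_def vimage_def)

lemma deficit_le_card_bad': "f \<in> \<Omega> \<Longrightarrow> deficit (map f [0..<m]) \<le> card {t \<in> {..<m}. bad f t}"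
  by (rule deficit_le_card_bad[of f m A]) (auto simp: \<Omega>_def)

theorem subcritical_deficit_tail:
  assumes "gap m > 0"
  shows "measure_pmf.prob (random_cnf A m) {F. k \<le> deficit F} \<le> (12000 * real k / (gap m ^ 3 * real n)) ^ k"
proof -
  have "measure_pmf.prob (random_cnf A m) {F. k \<le> deficit F} \<le> pr {f. k \<le> card {t \<in> {..<m}. bad f t}}"
    unfolding prob_random_cnf using deficit_le_card_bad' by (intro pr_mono) (auto intro: le_trans)
  also have "\<dots> \<le> (12000 * real k / (gap m ^ 3 * real n)) ^ k" by (rule pr_many_bad[OF assms])
  finally show ?thesis .
qed

text \<open>The bounds of \<open>subcritical_deficit_tail\<close> exceed 1 once \<open>k\<close> is
  of order gap^3 n and cannot be summed over all \<open>k\<close>. The mean number of bad times is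
  used instead; the empty pattern in \<open>pr_bad\<close> gives 64 * 8^2 = 4096.\<close>

theorem subcritical_expected_deficit:
  assumes "gap m > 0"
  shows "measure_pmf.expectation (random_cnf A m) (\<lambda>F. real (deficit F)) \<le> 4096 / (gap m ^ 3 * real n)"
proof -
  have "measure_pmf.expectation (random_cnf A m) (\<lambda>F. real (deficit F))
      = (\<Sum>f\<in>\<Omega>. real (deficit (map f [0..<m]))) / real (card \<Omega>)"
    by (simp add: random_cnf_eq integral_pmf_of_set)
  also have "\<dots> \<le> (\<Sum>f\<in>\<Omega>. \<Sum>t<m. if bad f t then 1 else 0) / real (card \<Omega>)"
  proof (intro divide_right_mono sum_mono)
    fix f assume "f \<in> \<Omega>"
    from deficit_le_card_bad'[OF this] have "real (deficit (map f [0..<m])) \<le> real (card {t \<in> {..<m}. bad f t})" by simp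
    also have "\<dots> = (\<Sum>t<m. if bad f t then 1 else 0)" by (simp flip: sum.inter_filter)
    finally show "real (deficit (map f [0..<m])) \<le> (\<Sum>t<m. if bad f t then 1 else 0)" .
  qed simp
  also have "\<dots> = (\<Sum>t<m. pr {f. bad f t})"
    by (subst sum.swap) (simp add: pr_eq sum_divide_distrib sum.If_cases Collect_conj_eq)
  also have "\<dots> \<le> 4096 / (gap m ^ 3 * real n)"
    using pr_bad[of "{}" "{}"] assms by (simp add: wf_pat_def vars_def Ev_def)
  finally show ?thesis .
qed

end

text \<open>From any literal on \<open>X\<close> some clause leads to another literal on
  \<open>X\<close>; since \<open>X\<close> is finite, a variable is eventually hit again. The
  variables of a bicycle form such a set.\<close>

lemma Ear_exists:
  assumes X: "finite X" "X \<subseteq> A" "\<And>u. fst u \<in> X \<Longrightarrow> \<exists>p<t. \<exists>w. f p = {neg u, w} \<and> fst w \<in> X"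
  shows "fst u \<in> X \<Longrightarrow> Ear A f t W u"
proof (induction "card (X - W)" arbitrary: W u rule: less_induct)
  case less
  obtain p w where p: "p < t" "f p = {neg u, w}" "fst w \<in> X" using X(3)[OF less.prems] by blast
  show ?case
  proof (cases "fst w \<in> W")
    case True
    with p X(2) show ?thesis by (intro Ear.close[of p t f u w]) auto
  next
    case False
    have "card (X - insert (fst w) W) < card (X - W)"
      using p(3) False X(1) by (intro psubset_card_mono) auto
    then have "Ear A f t (insert (fst w) W) w" using less.hyps p(3) by blast
    with p X(2) False show ?thesis by (intro Ear.extend[of p t f u w]) auto
  qed
qed

subsection \<open>Bicycles\<close>

text \<open>A bicycle: the walk \<open>lit i q us 0 \<rightarrow> \<dots> \<rightarrow> lit i q us K\<close>, \<open>K = length us + 1\<close>, through literals on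
  distinct variables, except that the literal number \<open>i\<close> is the negation of the literal number \<open>0\<close> and the
  last one is the negation of the literal number \<open>q\<close>.\<close>

definition lit :: "nat \<Rightarrow> nat \<Rightarrow> literal list \<Rightarrow> nat \<Rightarrow> literal" where
  "lit i q us j = (if j = i then neg (us ! 0) else if j < i then us ! j
     else if j = Suc (length us) then neg (us ! (q - 1)) else us ! (j - 1))"

text \<open>The strict bounds make both loops proper: step \<open>i - 1\<close> differs from step 0,
  and the last step from step \<open>q\<close>.\<close>

definition bicycle :: "nat \<Rightarrow> nat \<Rightarrow> literal list \<Rightarrow> bool" where
  "bicycle i q us \<longleftrightarrow> 2 \<le> i \<and> i < q \<and> q < length us \<and> distinct (map fst us)"

definition step :: "nat \<Rightarrow> nat \<Rightarrow> literal list \<Rightarrow> nat \<Rightarrow> clause" where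
  "step i q us j = {neg (lit i q us j), lit i q us (Suc j)}"

definition pat :: "nat \<Rightarrow> nat \<Rightarrow> literal list \<Rightarrow> nat list \<Rightarrow> (nat \<times> clause) set" where
  "pat i q us ps = (\<lambda>j. (ps ! j, step i q us j)) ` {..length us}"

context
  fixes i q :: nat and us :: "literal list"
  assumes b: "bicycle i q us"
begin

private abbreviation K :: nat where "K \<equiv> Suc (length us)"

lemma ineqs: "2 \<le> i" "i < q" "q < length us"
  using b by (auto simp: bicycle_def)

definition idx :: "nat \<Rightarrow> nat" where
  "idx j = (if j = i then 0 else if j < i then j else if j = K then q - 1 else j - 1)"

lemma idx_less: "j \<le> K \<Longrightarrow> idx j < length us"
  using ineqs by (auto simp: idx_def)

lemma lit_idx: "lit i q us j = (if j = i \<or> j = K then neg (us ! idx j) else us ! idx j)"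
  using ineqs by (auto simp: lit_def idx_def)

lemma fst_us_eq: "a < length us \<Longrightarrow> c < length us \<Longrightarrow> fst (us ! a) = fst (us ! c) \<Longrightarrow> a = c"
  using b nth_eq_iff_index_eq[of "map fst us" a c] by (auto simp: bicycle_def)

lemma fst_lit: "fst (lit i q us j) = fst (us ! idx j)"
  by (simp add: lit_idx)

lemma idx_eq:
  assumes "j \<le> K" "l \<le> K" "idx j = idx l" "j < l"
  shows "j = 0 \<and> l = i \<or> j = q \<and> l = K"
  using assms ineqs by (auto simp: idx_def split: if_splits)

lemma same_var:
  assumes "j \<le> K" "l \<le> K" "fst (lit i q us j) = fst (lit i q us l)" "j < l"
  shows "j = 0 \<and> l = i \<or> j = q \<and> l = K"
  using idx_eq[OF assms(1,2) _ assms(4)] fst_us_eq[of "idx j" "idx l"] assms idx_less by (auto simp: fst_lit)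

lemma lit_i: "lit i q us i = neg (lit i q us 0)" and lit_K: "lit i q us K = neg (lit i q us q)"
  using ineqs by (auto simp: lit_def)

lemma lit_inj:
  assumes "j \<le> K" "l \<le> K" "lit i q us j = lit i q us l"
  shows "j = l"
proof (rule ccontr)
  assume "j \<noteq> l"
  then consider "j < l" | "l < j" by linarith
  then show False
  proof cases
    case 1
    then show ?thesis using same_var[of j l] assms lit_i lit_K by auto
  next
    case 2
    then show ?thesis using same_var[of l j] assms lit_i lit_K by auto
  qed
qed

lemma lit_eq_neg:
  assumes "j \<le> K" "l \<le> K" "lit i q us j = neg (lit i q us l)"
  shows "j = 0 \<and> l = i \<or> j = q \<and> l = K \<or> l = 0 \<and> j = i \<or> l = q \<and> j = K"
proof -
  have "fst (lit i q us j) = fst (lit i q us l)" using assms by simp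
  moreover have "j \<noteq> l" using assms by auto
  ultimately show ?thesis using same_var[of j l] same_var[of l j] assms by (auto simp: neq_iff)
qed

lemma step_vars: "j < K \<Longrightarrow> fst (lit i q us j) \<noteq> fst (lit i q us (Suc j))"
  using same_var[of j "Suc j"] ineqs by auto

lemma neg_in_step: "neg z \<in> step i q us j \<longleftrightarrow> z = lit i q us j \<or> z = neg (lit i q us (Suc j))"
proof -
  have "neg z = w \<longleftrightarrow> z = neg w" for w by (metis neg_neg)
  then show ?thesis by (simp add: step_def)
qed

lemma neg_lit_in_step: "neg (lit i q us j) \<in> step i q us j"
  and neg_lit_q_in_last: "neg (lit i q us q) \<in> step i q us (length us)"
  using lit_K by (auto simp: step_def)

text \<open>A bicycle on L variables has L + 1 clauses, hence 2L + 2 literal occurrences, two more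
  than there are literals. The surplus sits at the two closing points, whose negated literals occur
  in steps 0 and \<open>i - 1\<close>, and in steps \<open>q\<close> and \<open>length us\<close>.
  This lets the walk be recovered from its set of clauses.\<close>

lemma double_literal:
  assumes "j < K" "l < K" "j \<noteq> l" "neg z \<in> step i q us j" "neg z \<in> step i q us l"
  shows "z = lit i q us 0 \<or> z = lit i q us q"
proof -
  consider "lit i q us j = lit i q us l" | "lit i q us j = neg (lit i q us (Suc l))" "z = lit i q us j"
    | "lit i q us l = neg (lit i q us (Suc j))" "z = lit i q us l" | "lit i q us (Suc j) = lit i q us (Suc l)"
    using assms(4,5) by (auto simp: neg_in_step)
  then show ?thesis
  proof cases
    case 1 then show ?thesis using lit_inj[of j l] assms by auto
  next
    case 2 then show ?thesis using lit_eq_neg[of j "Suc l"] assms by auto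
  next
    case 3 then show ?thesis using lit_eq_neg[of l "Suc j"] assms by auto
  next
    case 4 then show ?thesis using lit_inj[of "Suc j" "Suc l"] assms by auto
  qed
qed

lemma neg_lit_in_stepD:
  assumes "j < K" "l \<le> K" "neg (lit i q us l) \<in> step i q us j"
  shows "j = l \<or> l = 0 \<and> Suc j = i \<or> l = q \<and> Suc j = K \<or> 0 = Suc j \<and> l = i \<or> Suc j = q \<and> l = K"
proof -
  have "lit i q us l = lit i q us j \<or> lit i q us l = neg (lit i q us (Suc j))"
    using assms(3) by (simp only: neg_in_step)
  then show ?thesis
  proof
    assume "lit i q us l = lit i q us j"
    from lit_inj[OF _ _ this] assms show ?thesis by simp
  next
    assume "lit i q us l = neg (lit i q us (Suc j))"
    from lit_eq_neg[OF _ _ this] assms show ?thesis by simp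
  qed
qed

lemma step_of_0: "j < K \<Longrightarrow> neg (lit i q us 0) \<in> step i q us j \<Longrightarrow> j = 0 \<or> j = i - 1"
  using neg_lit_in_stepD[of j 0] ineqs by simp linarith

lemma step_of_q: "j < K \<Longrightarrow> neg (lit i q us q) \<in> step i q us j \<Longrightarrow> j = q \<or> j = length us"
  using neg_lit_in_stepD[of j q] ineqs by auto

lemma fst_lit_image: "(\<lambda>j. fst (lit i q us j)) ` {..length us} = fst ` set us"
proof (intro subset_antisym subsetI)
  fix x assume "x \<in> (\<lambda>j. fst (lit i q us j)) ` {..length us}"
  then obtain j where "j \<le> length us" "x = fst (us ! idx j)" by (auto simp: fst_lit)
  then show "x \<in> fst ` set us" using idx_less[of j] by auto
next
  fix x assume "x \<in> fst ` set us"
  then obtain k where k: "k < length us" "x = fst (us ! k)" by (auto simp: in_set_conv_nth)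
  then have "x = fst (lit i q us (if k < i then k else Suc k))" using ineqs by (auto simp: lit_def)
  moreover have "(if k < i then k else Suc k) \<in> {..length us}" using k by auto
  ultimately show "x \<in> (\<lambda>j. fst (lit i q us j)) ` {..length us}" by blast
qed

lemma lit_var: "j \<le> K \<Longrightarrow> fst (lit i q us j) \<in> fst ` set us"
  using idx_less[of j] by (auto simp: fst_lit)

lemma bicycle_closed:
  assumes "fst z \<in> fst ` set us"
  shows "\<exists>j<K. neg z \<in> step i q us j"
proof -
  obtain j where j: "j \<le> length us" "fst z = fst (lit i q us j)"
    using assms fst_lit_image by (metis (no_types, lifting) atMost_iff imageE)
  from same_var_cases[OF j(2)] show ?thesis
  proof
    assume "z = lit i q us j"
    then show ?thesis using j by (intro exI[of _ j]) (auto simp: step_def)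
  next
    assume z: "z = neg (lit i q us j)"
    show ?thesis
    proof (cases j)
      case 0
      then have "z = lit i q us i" using z lit_i by simp
      then show ?thesis using ineqs by (intro exI[of _ i]) (auto simp: step_def)
    next
      case (Suc l)
      then show ?thesis using j z by (intro exI[of _ l]) (auto simp: step_def)
    qed
  qed
qed

text \<open>The first loop forces literal number 0 to be false, so literal number \<open>i\<close>
  is true; from there the walk reaches both literal number \<open>q\<close> and its
  negation.\<close>

lemma bicycle_unsat: "\<exists>j<K. \<not> clause_sat \<sigma> (step i q us j)"
proof (rule ccontr)
  assume "\<not> ?thesis"
  then have all: "j < K \<Longrightarrow> lit_true \<sigma> (lit i q us j) \<Longrightarrow> lit_true \<sigma> (lit i q us (Suc j))" for j
    by (auto simp: clause_sat_iff step_def)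
  have fwd: "lit_true \<sigma> (lit i q us j) \<Longrightarrow> j \<le> l \<Longrightarrow> l \<le> K \<Longrightarrow> lit_true \<sigma> (lit i q us l)" for j l
  proof (induction l)
    case (Suc l)
    then show ?case using all[of l] by (cases "j = Suc l") auto
  qed simp
  have "\<not> lit_true \<sigma> (lit i q us 0)"
    using fwd[of 0 i] ineqs lit_i by auto
  then have "lit_true \<sigma> (lit i q us i)" using lit_i by simp
  from fwd[OF this, of q] have "lit_true \<sigma> (lit i q us q)" using ineqs by auto
  moreover from fwd[OF this, of K] have "lit_true \<sigma> (neg (lit i q us q))" using ineqs lit_K by auto
  ultimately show False by simp
qed

text \<open>Consecutive clauses of the walk share a variable, hence the clauses cannot be split into some
  inside and some outside of a set of variables.\<close>

lemma bicycle_connected: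
  assumes split: "\<And>j. j < K \<Longrightarrow> fst ` step i q us j \<subseteq> W \<or> fst ` step i q us j \<inter> W = {}"
    and l: "l < K" "fst ` step i q us l \<inter> W = {}"
  shows "j < K \<Longrightarrow> fst ` step i q us j \<inter> W = {}"
proof -
  have iff: "fst (lit i q us j) \<in> W \<longleftrightarrow> fst (lit i q us 0) \<in> W" if "j \<le> K" for j
    using that
  proof (induction j)
    case (Suc j)
    then show ?case using split[of j] by (auto simp: step_def)
  qed simp
  have "fst (lit i q us 0) \<notin> W" using l iff[of l] by (auto simp: step_def)
  then show "j < K \<Longrightarrow> fst ` step i q us j \<inter> W = {}" using iff[of j] iff[of "Suc j"] by (auto simp: step_def)
qed

end

text \<open>The walk is retraced from its first literal. At literal number j the next clause is the
  only one containing its negation, unless j is 0 or \<open>q\<close>, where there are two and the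
  prescribed times tell which one comes next. A clause and its starting literal give the next
  literal.\<close>

lemma bicycle_eq:
  assumes b: "bicycle i q us" "bicycle i' q' us'"
    and ps: "length ps = Suc (length us)" "distinct ps" "length ps' = Suc (length us')" "distinct ps'"
    and pat: "pat i q us ps = pat i' q' us' ps'"
    and key: "lit i q us 0 = lit i' q' us' 0" "ps ! 0 = ps' ! 0" "ps ! q = ps' ! q'"
  shows "i = i' \<and> q = q' \<and> us = us' \<and> ps = ps'"
proof -
  let ?K = "Suc (length us)"
  let ?v = "lit i q us" and ?v' = "lit i' q' us'"
  have fst_pat: "fst ` pat i q us ps = set ps" if "length ps = Suc (length us)" for i q us ps
    using that by (auto simp: pat_def image_image in_set_conv_nth less_Suc_eq_le)
  have "set ps = set ps'" using pat fst_pat ps by metis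
  then have "length ps = length ps'" using ps distinct_card by metis
  then have len: "length us' = length us" using ps by simp
  note q = ineqs[OF b(1)] and q' = ineqs[OF b(2)]
  have clause: "step i' q' us' l = step i q us j" if "j < ?K" "l < ?K" "ps ! j = ps' ! l" for j l
  proof -
    have "(ps ! j, step i q us j) \<in> pat i' q' us' ps'" 
      unfolding pat[symmetric] unfolding pat_def using that(1) by (intro image_eqI[of _ _ j]) auto
    then obtain l' where l': "l' < ?K" "ps ! j = ps' ! l'" "step i q us j = step i' q' us' l'"
      using len by (auto simp: pat_def less_Suc_eq_le)
    then have "l' = l" using that ps len nth_eq_iff_index_eq[of ps' l' l] by auto
    with l' show ?thesis by simp
  qed
  have ex': "\<exists>l<?K. ps' ! l = ps ! j" if "j < ?K" for j
    using that \<open>set ps = set ps'\<close> ps len by (metis in_set_conv_nth)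
  have ex: "\<exists>l<?K. ps ! l = ps' ! j" if "j < ?K" for j
    using that \<open>set ps = set ps'\<close> ps len by (metis in_set_conv_nth)
  have main: "j \<le> ?K \<Longrightarrow> ?v j = ?v' j \<and> (\<forall>l<j. ps ! l = ps' ! l \<and> (l = q \<longleftrightarrow> l = q'))" for j
  proof (induction j)
    case 0
    then show ?case using key by simp
  next
    case (Suc j)
    then have j: "j < ?K" and vj: "?v j = ?v' j" by auto
    have pos: "ps ! j = ps' ! j \<and> (j = q \<longleftrightarrow> j = q')"
    proof (cases "j = 0")
      case True
      then show ?thesis using key q q' by simp
    next
      case False
      \<comment> \<open>Which literals are doubled depends on the pattern only: literal number
        \<open>q\<close> is doubled, so in the second walk it has number 0 or \<open>q'\<close>, and
        0 is excluded as \<open>j \<noteq> 0\<close>.\<close>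
      have d: "j = q'" if jq: "j = q"
      proof -
        obtain l where l: "l < ?K" "ps' ! l = ps ! q" using ex'[of q] q by auto
        obtain l2 where l2: "l2 < ?K" "ps' ! l2 = ps ! length us" using ex'[of "length us"] by auto
        have "l \<noteq> l2" using l l2 ps q nth_eq_iff_index_eq[of ps q "length us"] by auto
        moreover have "neg (?v q) \<in> step i' q' us' l" "neg (?v q) \<in> step i' q' us' l2"
          using clause[of q l] clause[of "length us" l2] l l2 q neg_lit_in_step[OF b(1), of q] neg_lit_q_in_last[OF b(1)]
          by simp_all
        ultimately have "?v q = ?v' 0 \<or> ?v q = ?v' q'"
          using double_literal[OF b(2), of l l2 "?v q"] l l2 len by auto
        then show ?thesis using vj jq False lit_inj[OF b(2), of j 0] lit_inj[OF b(2), of j q'] len q' j by auto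
      qed
      have d': "j = q" if jq: "j = q'"
      proof -
        obtain l where l: "l < ?K" "ps ! l = ps' ! q'" using ex[of q'] q' len by auto
        obtain l2 where l2: "l2 < ?K" "ps ! l2 = ps' ! length us" using ex[of "length us"] by auto
        have "l \<noteq> l2" using l l2 ps q' len nth_eq_iff_index_eq[of ps' q' "length us"] by auto
        moreover have "neg (?v' q') \<in> step i q us l" "neg (?v' q') \<in> step i q us l2"
          using clause[of l q'] clause[of l2 "length us"] l l2 q' neg_lit_in_step[OF b(2), of q'] neg_lit_q_in_last[OF b(2)] len
          by simp_all
        ultimately have "?v' q' = ?v 0 \<or> ?v' q' = ?v q"
          using double_literal[OF b(1), of l l2 "?v' q'"] l l2 len by auto
        then show ?thesis using vj jq False lit_inj[OF b(1), of j 0] lit_inj[OF b(1), of j q] len q j by auto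
      qed
      show ?thesis
      proof (cases "j = q")
        case True
        then show ?thesis using d key by auto
      next
        case jq: False
        obtain l where l: "l < ?K" "ps ! l = ps' ! j" using ex[OF j] by auto
        have "neg (?v j) \<in> step i q us l"
          using clause[of l j] l j vj neg_lit_in_step[OF b(2), of j] by simp
        moreover have "neg (?v j) \<in> step i q us j" by (rule neg_lit_in_step[OF b(1)])
        ultimately have "l = j"
          using double_literal[OF b(1), of l j "?v j"] lit_inj[OF b(1), of j 0] lit_inj[OF b(1), of j q] l j jq False q
          by auto
        then show ?thesis using l jq d' by auto
      qed
    qed
    have "step i' q' us' j = step i q us j" using clause[OF j j] pos by simp
    then have "?v (Suc j) = ?v' (Suc j)" using vj by (auto simp: step_def doubleton_eq_iff)
    then show ?case using Suc pos by (auto simp: less_Suc_eq)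
  qed
  have v: "?v j = ?v' j" if "j \<le> ?K" for j using main[OF that] by simp
  have "ps = ps'" using main[of ?K] ps len by (intro nth_equalityI) auto
  moreover have "q = q'"
  proof -
    have "\<forall>l<?K. l = q \<longleftrightarrow> l = q'" using main[of ?K] by simp
    from this[rule_format, of q] show ?thesis using q by simp
  qed
  moreover have i: "i = i'"
  proof -
    have "?v' i = neg (?v' 0)" using v[of i] v[of 0] lit_i[OF b(1)] q by simp
    then show ?thesis using lit_eq_neg[OF b(2), of i 0] q q' len by auto
  qed
  moreover have "us = us'"
  proof (rule nth_equalityI)
    fix k assume k: "k < length us"
    show "us ! k = us' ! k"
      using v[of k] v[of "Suc k"] k i len by (cases "k < i") (auto simp: lit_def)
  qed (simp add: len)
  ultimately show ?thesis by simp
qed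

section \<open>A second bicycle next to a given one\<close>

context random_clauses
begin

definition start_ear :: "(nat \<times> clause) set \<Rightarrow> nat set \<Rightarrow> (nat \<Rightarrow> clause) \<Rightarrow> bool" where
  "start_ear R W f \<longleftrightarrow> (\<exists>p<m. p \<notin> fst ` R \<and> (\<exists>z w. fst z \<in> W \<and> fst w \<in> A \<and> f p = {neg z, w} \<and>
     (fst w \<in> W \<or> Ear A f m (insert (fst w) W) w)))"

text \<open>The first clause leaves from one of \<open>2 * card W\<close> literals on explored
  variables; from there on it is the recursion for an ear with \<open>growth\<close> of index 1. A
  further bicycle that shares variables with the first one produces such a path.\<close>

lemma pr_start_ear:
  assumes a: "gap m > 0" and R: "wf_pat R" "vars R \<subseteq> W" "W \<subseteq> A"
  shows "pr (Ev R \<inter> {f. start_ear R W f}) \<le>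
    q ^ card R * (4 * real (card W) / ((gap m)\<^sup>2 * real n) * (gap m * real (card W) + 4))"
proof -
  define S where "S w = 2 / ((gap m)\<^sup>2 * real n) * growth (gap m) 1 w" for w
  have S0: "S w \<ge> 0" for w using a by (simp add: S_def growth_nonneg)
  have Sw: "real m * q * (2 * real w * 1 + 2 * real n * S (Suc w)) \<le> S w" for w
    using ear_weight[OF a, of w 0] by (simp add: S_def growth_def)
  have finR: "finite R" using R by (simp add: wf_pat_def)
  let ?I = "({..<m} \<times> lits W) \<times> lits A"
  define R1 where "R1 p z w = insert (p, {neg z, w}) R" for p z w
  define ok where "ok p z w \<longleftrightarrow> p \<notin> fst ` R \<and> fst w \<noteq> fst z" for p and z w :: literal
  define B where "B = (\<lambda>((p, z), w). if ok p z w then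
      if fst w \<in> W then Ev (R1 p z w) else Ev (R1 p z w) \<inter> {f. Ear A f m (insert (fst w) W) w} else {})"
  have finW: "finite W" by (rule finite_subset[OF R(3)]) simp
  have "pr (Ev R \<inter> {f. start_ear R W f}) \<le> (\<Sum>i\<in>?I. pr (B i))"
  proof (rule pr_UN_le)
    fix f assume f: "f \<in> \<Omega>" "f \<in> Ev R \<inter> {f. start_ear R W f}"
    then obtain p z w where p: "p < m" "p \<notin> fst ` R" "fst z \<in> W" "fst w \<in> A" "f p = {neg z, w}"
      "fst w \<in> W \<or> Ear A f m (insert (fst w) W) w" by (auto simp: start_ear_def)
    have "f p \<in> clauses_on A" using f(1) p(1) by (auto simp: \<Omega>_def)
    then have "fst w \<noteq> fst z" using p clauses_onD[of "neg z" w A] by auto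
    then have "f \<in> B ((p, z), w)" using p f by (auto simp: B_def ok_def R1_def Ev_insert)
    moreover have "((p, z), w) \<in> ?I" using p by (simp add: lits_iff)
    ultimately show "\<exists>i\<in>?I. f \<in> B i" by blast
  qed (use finW in simp)
  also have "\<dots> \<le> (\<Sum>i\<in>?I. q ^ Suc (card R) * (if fst (snd i) \<in> W then 1 else S (Suc (card W))))"
  proof (rule sum_mono)
    fix i assume "i \<in> ?I"
    then obtain p z w where i: "i = ((p, z), w)" "p < m" "fst z \<in> W" "fst w \<in> A" by (auto simp: lits_iff)
    show "pr (B i) \<le> q ^ Suc (card R) * (if fst (snd i) \<in> W then 1 else S (Suc (card W)))"
    proof (cases "ok p z w")
      case False
      then have "pr (B i) = 0" by (simp add: B_def i pr_eq)
      then show ?thesis using q_pos S0 by simp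
    next
      case True
      then have ok: "p \<notin> fst ` R" "fst w \<noteq> fst z" by (auto simp: ok_def)
      have "(p, {neg z, w}) \<notin> R" using ok(1) by force
      then have card1: "card (R1 p z w) = Suc (card R)" using finR by (simp add: R1_def)
      have "{neg z, w} \<in> clauses_on A"
        unfolding clauses_on_def mem_Collect_eq using ok i R
        by (intro exI[of _ "neg z"] exI[of _ w]) auto
      then have wf1: "wf_pat (R1 p z w)"
        using R(1) ok i unfolding wf_pat_def R1_def by auto
      show ?thesis
      proof (cases "fst w \<in> W")
        case inW: True
        then show ?thesis using True pr_Ev[OF wf1] card1 by (simp add: B_def i)
      next
        case notW: False
        have "pr (Ev (R1 p z w) \<inter> {f. Ear A f m (insert (fst w) W) w} \<inter> UNIV) \<le>
            1 * q ^ card (R1 p z w) * S (card (insert (fst w) W))"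
        proof (rule ear_bound[OF order_refl subadd_pr[of UNIV], of 1 "\<lambda>_. 1" S])
          show "pr (Ev R' \<inter> UNIV) \<le> 1 * q ^ card R' * 1"
            if "extends m (R1 p z w) (insert (fst w) W) R' W'" for R' W'
            using that pr_Ev[of R'] by (simp add: extends_def)
          show "vars (R1 p z w) \<subseteq> insert (fst w) W" using R i by (auto simp: R1_def)
          show "neg w \<notin> C" if "(p', C) \<in> R1 p z w" for p' C
          proof (cases "(p', C) \<in> R")
            case True
            then have "fst ` C \<subseteq> W" using R(2) by (force simp: vars_def)
            then show ?thesis using notW by (metis fst_neg imageI subsetD)
          next
            case False
            then have "C = {neg z, w}" using that by (auto simp: R1_def)
            then show ?thesis using ok(2) by auto
          qed
        qed (use wf1 R i S0 Sw in auto)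
        moreover have "card (insert (fst w) W) = Suc (card W)" using notW finW by simp
        ultimately show ?thesis using True notW card1 by (simp add: B_def i)
      qed
    qed
  qed
  also have "\<dots> = q ^ Suc (card R) * (real (m * (2 * card W)) * (\<Sum>w\<in>lits A. if fst w \<in> W then 1 else S (Suc (card W))))"
  proof -
    have "(\<Sum>i\<in>?I. g (snd i)) = real (m * (2 * card W)) * (\<Sum>w\<in>lits A. g w)" for g :: "literal \<Rightarrow> real"
    proof -
      have "(\<Sum>i\<in>?I. g (snd i)) = (\<Sum>x\<in>{..<m} \<times> lits W. \<Sum>w\<in>lits A. g w)"
        by (simp only: sum.cartesian_product case_prod_unfold snd_conv)
      then show ?thesis by (simp add: card_cartesian_product card_lits)
    qed
    from this[of "\<lambda>w. if fst w \<in> W then 1 else S (Suc (card W))"] show ?thesis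
      by (simp only: sum_distrib_left[symmetric])
  qed
  also have "\<dots> \<le> q ^ Suc (card R) * (real (m * (2 * card W)) * (2 * real (card W) * 1 + 2 * real n * S (Suc (card W))))"
    using q_pos R S0 by (intro mult_left_mono sum_lits_le) auto
  also have "\<dots> = q ^ card R * (2 * real (card W) * (real m * q * (2 * real (card W) * 1 + 2 * real n * S (Suc (card W)))))"
    by simp
  also have "\<dots> \<le> q ^ card R * (2 * real (card W) * S (card W))"
    using q_pos by (intro mult_left_mono Sw) auto
  finally show ?thesis by (simp add: S_def growth_def mult_ac)
qed

definition bike :: "nat \<Rightarrow> nat \<Rightarrow> literal list \<Rightarrow> nat list \<Rightarrow> bool" where
  "bike i h us ps \<longleftrightarrow> bicycle i h us \<and> fst ` set us \<subseteq> A \<and> length ps = Suc (length us) \<and> distinct ps \<and> set ps \<subseteq> {..<m}"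

lemma bike_pat:
  assumes "bike i h us ps"
  shows "wf_pat (pat i h us ps)" "card (pat i h us ps) = Suc (length us)" "vars (pat i h us ps) = fst ` set us"
    "fst ` pat i h us ps = set ps"
proof -
  note b = assms[unfolded bike_def]
  have fst_eq: "fst ` pat i h us ps = set ps"
    using b by (auto simp: pat_def image_image in_set_conv_nth less_Suc_eq_le)
  have inj: "inj_on (\<lambda>j. (ps ! j, step i h us j)) {..length us}"
    using b by (auto intro!: inj_onI simp: nth_eq_iff_index_eq)
  show "card (pat i h us ps) = Suc (length us)"
    unfolding pat_def by (subst card_image[OF inj]) simp
  have inj2: "inj_on fst (pat i h us ps)"
    using b by (auto intro!: inj_onI simp: pat_def nth_eq_iff_index_eq)
  have "step i h us j \<in> clauses_on A" if "j \<le> length us" for j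
  proof -
    have "fst (lit i h us j) \<noteq> fst (lit i h us (Suc j))" using step_vars b that by simp
    moreover have "fst (lit i h us j) \<in> A" "fst (lit i h us (Suc j)) \<in> A"
      using lit_var[of i h us j] lit_var[of i h us "Suc j"] b that by auto
    ultimately show ?thesis unfolding step_def clauses_on_def mem_Collect_eq
      by (intro exI[of _ "neg (lit i h us j)"] exI[of _ "lit i h us (Suc j)"]) auto
  qed
  then show "wf_pat (pat i h us ps)"
    unfolding wf_pat_def fst_eq using inj2 b by (auto simp: pat_def)
  show "vars (pat i h us ps) = fst ` set us"
  proof (intro subset_antisym subsetI)
    fix x assume "x \<in> vars (pat i h us ps)"
    then obtain j where "j \<le> length us" "x = fst (lit i h us j) \<or> x = fst (lit i h us (Suc j))"
      by (auto simp: vars_def pat_def step_def)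
    then show "x \<in> fst ` set us" using lit_var[of i h us j] lit_var[of i h us "Suc j"] b by auto
  next
    fix x assume "x \<in> fst ` set us"
    then obtain j where j: "j \<le> length us" "x = fst (lit i h us j)"
      using fst_lit_image[of i h us] b by (metis (no_types, lifting) atMost_iff imageE)
    then have "x \<in> fst ` step i h us j" by (simp add: step_def)
    then show "x \<in> vars (pat i h us ps)" using j(1) by (auto simp: vars_def pat_def)
  qed
  show "fst ` pat i h us ps = set ps" by (rule fst_eq)
qed

lemma Ev_patD: "f \<in> Ev (pat i h us ps) \<Longrightarrow> j \<le> length us \<Longrightarrow> f (ps ! j) = step i h us j"
  by (auto simp: Ev_def pat_def)

lemma bike_unsat:
  assumes "bike i h us ps" "f \<in> Ev (pat i h us ps)"
  shows "\<exists>p\<in>set ps. \<not> clause_sat \<sigma> (f p)"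
proof -
  obtain j where j: "j < Suc (length us)" "\<not> clause_sat \<sigma> (step i h us j)"
    using bicycle_unsat[of i h us \<sigma>] assms(1) unfolding bike_def by blast
  then have "\<not> clause_sat \<sigma> (f (ps ! j))" using Ev_patD[OF assms(2), of j] by simp
  moreover have "ps ! j \<in> set ps" using j assms(1) by (simp add: bike_def)
  ultimately show ?thesis by blast
qed

text \<open>If a clause of the second bicycle at a new time touches the first one, its other end is
  a literal of the second bicycle, from which an ear exists. Otherwise every clause lies inside
  \<open>vars R\<close> or is disjoint from it; by connectedness all are disjoint from it, hence at
  new times, and as they are unsatisfiable one of these times is bad.\<close>

lemma two_bikes:
  assumes f: "f \<in> \<Omega>" and b: "bike i h us ps" "f \<in> Ev (pat i h us ps)"
    and b': "bike i' h' us' ps'" "f \<in> Ev (pat i' h' us' ps')" and new: "\<not> pat i' h' us' ps' \<subseteq> pat i h us ps"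
  defines "R \<equiv> pat i h us ps"
  shows "start_ear R (vars R) f \<or> (\<exists>t\<in>{..<m} - fst ` R. bad f t)"
proof -
  let ?W = "vars R"
  have R: "wf_pat R" "?W \<subseteq> A" "fst ` R = set ps"
    using bike_pat[OF b(1)] b(1) by (auto simp: R_def bike_def)
  have bi': "bicycle i' h' us'" "length ps' = Suc (length us')" "distinct ps'" "set ps' \<subseteq> {..<m}" "fst ` set us' \<subseteq> A"
    using b'(1) by (auto simp: bike_def)
  have fp: "f (ps' ! j) = step i' h' us' j" "ps' ! j < m" if "j \<le> length us'" for j
  proof -
    show "f (ps' ! j) = step i' h' us' j" by (rule Ev_patD[OF b'(2) that])
    have "ps' ! j \<in> set ps'" using that bi'(2) by simp
    then show "ps' ! j < m" using bi'(4) by blast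
  qed
  have inR: "(ps' ! j, step i' h' us' j) \<in> R" if j: "j \<le> length us'" "ps' ! j \<in> fst ` R" for j
  proof -
    obtain C where C: "(ps' ! j, C) \<in> R" using j(2) by auto
    then have "f (ps' ! j) = C" using b(2) by (auto simp: Ev_def R_def)
    then show ?thesis using fp[OF j(1)] C by simp
  qed
  obtain l where l: "l \<le> length us'" "(ps' ! l, step i' h' us' l) \<notin> R"
    using new by (auto simp: pat_def R_def)
  show ?thesis
  proof (cases "\<exists>j\<le>length us'. ps' ! j \<notin> fst ` R \<and> fst ` step i' h' us' j \<inter> ?W \<noteq> {}")
    case True
    then obtain j where j: "j \<le> length us'" "ps' ! j \<notin> fst ` R" "fst ` step i' h' us' j \<inter> ?W \<noteq> {}" by blast
    define x y where "x = neg (lit i' h' us' j)" and "y = lit i' h' us' (Suc j)"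
    have st: "f (ps' ! j) = {x, y}" using fp[OF j(1)] by (simp add: step_def x_def y_def)
    have xy: "fst x \<in> fst ` set us'" "fst y \<in> fst ` set us'"
      using lit_var[OF bi'(1), of j] lit_var[OF bi'(1), of "Suc j"] j(1) by (auto simp: x_def y_def)
    have ear: "Ear A f m W u" if "fst u \<in> fst ` set us'" for u W
    proof (rule Ear_exists[of "fst ` set us'"])
      show "\<exists>p<m. \<exists>w. f p = {neg u, w} \<and> fst w \<in> fst ` set us'" if u: "fst u \<in> fst ` set us'" for u
      proof -
        obtain k where k: "k < Suc (length us')" "neg u \<in> step i' h' us' k"
          using bicycle_closed[OF bi'(1) u] by blast
        then have "neg u \<in> f (ps' ! k)" using fp[of k] by simp
        moreover have "f (ps' ! k) = {neg (lit i' h' us' k), lit i' h' us' (Suc k)}"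
          using fp[of k] k by (simp add: step_def)
        moreover have "fst (neg (lit i' h' us' k)) \<in> fst ` set us'" "fst (lit i' h' us' (Suc k)) \<in> fst ` set us'"
          using lit_var[OF bi'(1), of k] lit_var[OF bi'(1), of "Suc k"] k by auto
        ultimately obtain w where "f (ps' ! k) = {neg u, w}" "fst w \<in> fst ` set us'"
          by (metis empty_iff insert_commute insert_iff)
        then show ?thesis using fp[of k] k by (intro exI[of _ "ps' ! k"] conjI exI[of _ w]) auto
      qed
    qed (use bi' that in auto)
    obtain z0 w where zw: "f (ps' ! j) = {z0, w}" "fst z0 \<in> ?W" "fst w \<in> fst ` set us'"
    proof -
      have "fst x \<in> ?W \<or> fst y \<in> ?W" using j(3) fp[OF j(1)] st by auto
      then show ?thesis using that[of x y] that[of y x] st xy by (auto simp: insert_commute)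
    qed
    have "start_ear R ?W f"
      unfolding start_ear_def
    proof (intro exI conjI)
      show "ps' ! j < m" using fp j by simp
      show "ps' ! j \<notin> fst ` R" by (rule j(2))
      show "fst (neg z0) \<in> ?W" using zw by simp
      show "fst w \<in> A" using zw bi' by auto
      show "f (ps' ! j) = {neg (neg z0), w}" using zw by simp
      show "fst w \<in> ?W \<or> Ear A f m (insert (fst w) ?W) w" using ear zw by blast
    qed
    then show ?thesis by blast
  next
    case False
    have vR: "fst ` C \<subseteq> ?W" if "(p, C) \<in> R" for p C
      using that by (force simp: vars_def)
    have split: "fst ` step i' h' us' j \<subseteq> ?W \<or> fst ` step i' h' us' j \<inter> ?W = {}" if "j < Suc (length us')" for j
    proof (cases "ps' ! j \<in> fst ` R")
      case True
      then show ?thesis using inR[of j] vR that by simp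
    next
      case F: False
      have "j \<le> length us'" using that by simp
      then show ?thesis using False F by blast
    qed
    have "ps' ! l \<notin> fst ` R" using l inR by blast
    then have "fst ` step i' h' us' l \<inter> ?W = {}" using False l by blast
    then have out: "fst ` step i' h' us' j \<inter> ?W = {}" if "j < Suc (length us')" for j
      using bicycle_connected[OF bi'(1) split, of l j] l that by auto
    have disj: "ps' ! j \<notin> fst ` R" if "j \<le> length us'" for j
    proof
      assume "ps' ! j \<in> fst ` R"
      then have "fst ` step i' h' us' j \<subseteq> ?W" using inR[OF that] vR by blast
      then show False using out[of j] that by (auto simp: step_def)
    qed
    have "\<exists>t\<in>set ps'. bad f t"
      using f bi' bike_unsat[OF b'] by (intro unsat_imp_bad[of f m A]) (auto simp: \<Omega>_def)
    then obtain j where "j \<le> length us'" "bad f (ps' ! j)" using bi' by (auto simp: in_set_conv_nth less_Suc_eq_le)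
    then show ?thesis using disj fp by blast
  qed
qed

lemma pat_step:
  assumes "bike i h us ps" "bike i' h' us' ps'" "pat i h us ps = pat i' h' us' ps'" "j \<le> length us"
  shows "\<exists>l\<le>length us'. ps ! j = ps' ! l \<and> step i h us j = step i' h' us' l"
proof -
  have "(ps ! j, step i h us j) \<in> pat i h us ps" using assms(4) unfolding pat_def by (intro image_eqI[of _ _ j]) auto
  then show ?thesis unfolding assms(3) by (auto simp: pat_def)
qed

text \<open>A bicycle is determined by its pattern, its first literal, and the times of its steps \<open>0\<close> and \<open>h\<close>.\<close>

definition key :: "nat \<times> nat \<times> literal list \<times> nat list \<Rightarrow> literal \<times> nat \<times> nat" where
  "key = (\<lambda>(i, h, us, ps). (lit i h us 0, ps ! 0, ps ! h))"

text \<open>The keys are counted. The first literal is doubled in the pattern, which leaves two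
  choices. Steps 0 and \<open>h\<close> both contain the negation of a doubled literal, as do only
  the four steps 0, \<open>i0 - 1\<close>, \<open>h0\<close> and \<open>length us0\<close> of a
  reference bicycle: 2 * 4 * 4 = 32.\<close>

lemma card_same_pat:
  assumes X: "\<And>i h us ps. (i, h, us, ps) \<in> X \<Longrightarrow> bike i h us ps"
    "\<And>i h us ps i' h' us' ps'. (i, h, us, ps) \<in> X \<Longrightarrow> (i', h', us', ps') \<in> X \<Longrightarrow> pat i h us ps = pat i' h' us' ps'"
  shows "card X \<le> 32"
proof (cases "X = {}")
  case False
  then obtain i0 h0 us0 ps0 where t0: "(i0, h0, us0, ps0) \<in> X" by (metis ex_in_conv prod_cases4)
  note b0 = X(1)[OF t0]
  have bi0: "bicycle i0 h0 us0" using b0 by (simp add: bike_def)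
  define D where "D = {lit i0 h0 us0 0, lit i0 h0 us0 h0}"
  define U where "U = set (map (\<lambda>j. ps0 ! j) [0, i0 - 1, h0, length us0])"
  have "inj_on key X"
  proof (rule inj_onI)
    fix s t assume st: "s \<in> X" "t \<in> X" "key s = key t"
    obtain i h us ps where s: "s = (i, h, us, ps)" by (rule prod_cases4)
    obtain i' h' us' ps' where t: "t = (i', h', us', ps')" by (rule prod_cases4)
    have "i = i' \<and> h = h' \<and> us = us' \<and> ps = ps'"
    proof (rule bicycle_eq)
      have b: "bike i h us ps" "bike i' h' us' ps'" using X(1) st(1,2) unfolding s t by blast+
      show "bicycle i h us" "bicycle i' h' us'" "length ps = Suc (length us)" "distinct ps"
        "length ps' = Suc (length us')" "distinct ps'"
        using b by (simp_all add: bike_def)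
      show "pat i h us ps = pat i' h' us' ps'" by (rule X(2)[OF st(1)[unfolded s] st(2)[unfolded t]])
      show "lit i h us 0 = lit i' h' us' 0" "ps ! 0 = ps' ! 0" "ps ! h = ps' ! h'"
        using st(3) by (simp_all add: s t key_def)
    qed
    then show "s = t" by (simp add: s t)
  qed
  moreover have "key ` X \<subseteq> D \<times> U \<times> U"
  proof (rule image_subsetI)
    fix s assume sX: "s \<in> X"
    obtain i h us ps where s: "s = (i, h, us, ps)" by (rule prod_cases4)
    have b: "bike i h us ps" "bicycle i h us" using X(1) sX by (auto simp: s bike_def)
    have pe: "pat i h us ps = pat i0 h0 us0 ps0" by (rule X(2)[OF sX[unfolded s] t0])
    note ineq = ineqs[OF b(2)]
    have dbl: "z \<in> D" if jl: "neg z \<in> step i h us j" "neg z \<in> step i h us l" "j < l" "l \<le> length us" for z j l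
    proof -
      have jlen: "j \<le> length us" using jl by simp
      from pat_step[OF b(1) b0 pe jlen]
      obtain j' where j': "j' \<le> length us0" "ps ! j = ps0 ! j'" "step i h us j = step i0 h0 us0 j'"
        by (elim exE conjE)
      from pat_step[OF b(1) b0 pe jl(4)]
      obtain l' where l': "l' \<le> length us0" "ps ! l = ps0 ! l'" "step i h us l = step i0 h0 us0 l'"
        by (elim exE conjE)
      have "distinct ps" "j < length ps" "l < length ps" using b(1) jl by (auto simp: bike_def)
      then have "ps ! j \<noteq> ps ! l" using jl(3) nth_eq_iff_index_eq[of ps j l] by simp
      then have "j' \<noteq> l'" using j'(2) l'(2) by metis
      moreover have "neg z \<in> step i0 h0 us0 j'" "neg z \<in> step i0 h0 us0 l'" using jl(1,2) j'(3) l'(3) by simp_all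
      ultimately show ?thesis using double_literal[OF bi0, of j' l' z] j'(1) l'(1) by (simp add: D_def)
    qed
    have pos: "ps ! j \<in> U" if jl: "z \<in> D" "neg z \<in> step i h us j" "j \<le> length us" for z j
    proof -
      from pat_step[OF b(1) b0 pe jl(3)]
      obtain j' where j': "j' \<le> length us0" "ps ! j = ps0 ! j'" "step i h us j = step i0 h0 us0 j'"
        by (elim exE conjE)
      have st: "neg z \<in> step i0 h0 us0 j'" using jl(2) j'(3) by simp
      have "z = lit i0 h0 us0 0 \<or> z = lit i0 h0 us0 h0" using jl(1) by (simp add: D_def)
      then have "j' = 0 \<or> j' = i0 - 1 \<or> j' = h0 \<or> j' = length us0"
      proof
        assume "z = lit i0 h0 us0 0"
        then have "j' = 0 \<or> j' = i0 - 1" using step_of_0[OF bi0, of j'] st j'(1) by simp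
        then show ?thesis by (elim disjE) simp_all
      next
        assume "z = lit i0 h0 us0 h0"
        then have "j' = h0 \<or> j' = length us0" using step_of_q[OF bi0, of j'] st j'(1) by simp
        then show ?thesis by (elim disjE) simp_all
      qed
      then show ?thesis using j'(2) by (elim disjE) (simp_all add: U_def)
    qed
    have "neg (lit i h us 0) \<in> step i h us (i - 1)"
    proof -
      have "Suc (i - 1) = i" using ineq by simp
      then have e: "lit i h us (Suc (i - 1)) = neg (lit i h us 0)" by (simp only: lit_i[OF b(2)])
      show ?thesis unfolding step_def e by (rule insertI2[OF singletonI])
    qed
    note bk = this
    have len: "0 < i - 1" "i - 1 \<le> length us" "h < length us" "0 \<le> length us" "h \<le> length us"
      using ineq by linarith+
    have 1: "lit i h us 0 \<in> D"
      by (rule dbl[OF neg_lit_in_step[OF b(2), of 0] bk len(1,2)])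
    have 2: "lit i h us h \<in> D"
      by (rule dbl[OF neg_lit_in_step[OF b(2), of h] neg_lit_q_in_last[OF b(2)] len(3) order_refl])
    have "ps ! 0 \<in> U" by (rule pos[OF 1 neg_lit_in_step[OF b(2)] len(4)])
    moreover have "ps ! h \<in> U" by (rule pos[OF 2 neg_lit_in_step[OF b(2)] len(5)])
    ultimately show "key s \<in> D \<times> U \<times> U" using 1 by (simp add: s key_def)
  qed
  ultimately have "card X \<le> card (D \<times> U \<times> U)"
    by (rule card_inj_on_le) (simp add: D_def U_def)
  also have "\<dots> = card D * (card U * card U)" by (simp add: card_cartesian_product)
  also have "\<dots> \<le> 2 * (4 * 4)"
  proof (intro mult_le_mono)
    show "card D \<le> 2" by (simp add: D_def card_insert_if)
    show "card U \<le> 4" unfolding U_def using card_length[of "map (\<lambda>j. ps0 ! j) [0, i0 - 1, h0, length us0]"] by simp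
    then show "card U \<le> 4" .
  qed
  finally show ?thesis by simp
qed simp

end

section \<open>Counting bicycles and their expected number\<close>

lemma card_distinct_lists_ge:
  assumes "finite B" "k \<le> card B"
  shows "(card B - k) ^ k \<le> card {xs. length xs = k \<and> distinct xs \<and> set xs \<subseteq> B}"
proof -
  have "(card B - k) ^ k = (\<Prod>i\<in>{card B - k + 1 .. card B}. card B - k)"
    using assms by simp
  also have "\<dots> \<le> \<Prod>{card B - k + 1 .. card B}" by (rule prod_mono) auto
  also have "\<dots> = card {xs. length xs = k \<and> distinct xs \<and> set xs \<subseteq> B}"
    using assms by (rule card_lists_distinct_length_eq[symmetric])
  finally show ?thesis .
qed

lemma card_literal_lists_ge:
  assumes "finite B" "k \<le> card B"
  shows "(2 * (card B - k)) ^ k \<le> card {us :: literal list. length us = k \<and> distinct (map fst us) \<and> fst ` set us \<subseteq> B}"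
    and "finite {us :: literal list. length us = k \<and> distinct (map fst us) \<and> fst ` set us \<subseteq> B}"
proof -
  let ?X = "{xs. length xs = k \<and> distinct xs \<and> set xs \<subseteq> B}" and ?Y = "{bs :: bool list. length bs = k}"
  let ?U = "{us :: literal list. length us = k \<and> distinct (map fst us) \<and> fst ` set us \<subseteq> B}"
  have "?U \<subseteq> {us. set us \<subseteq> lits B \<and> length us = k}" by (auto simp: lits_iff)
  then show fin: "finite ?U"
    using finite_lists_length_eq[of "lits B" k] assms(1) finite_subset by auto
  have "inj_on (\<lambda>(xs, bs). zip xs bs) (?X \<times> ?Y)"
    by (rule inj_on_inverseI[where g = "\<lambda>zs. (map fst zs, map snd zs)"]) auto
  moreover have "(\<lambda>(xs, bs). zip xs bs) ` (?X \<times> ?Y) \<subseteq> ?U"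
  proof (rule image_subsetI)
    fix p assume "p \<in> ?X \<times> ?Y"
    then obtain xs bs where p: "p = (xs, bs)" "length xs = k" "distinct xs" "set xs \<subseteq> B" "length bs = k" by auto
    then have e: "map fst (zip xs bs) = xs" by simp
    then have "fst ` set (zip xs bs) = set xs" by (metis list.set_map)
    then show "(case p of (xs, bs) \<Rightarrow> zip xs bs) \<in> ?U" using p e by simp
  qed
  ultimately have le: "card (?X \<times> ?Y) \<le> card ?U" using fin by (rule card_inj_on_le)
  have Y: "card ?Y = 2 ^ k"
    using card_lists_length_eq[of "UNIV :: bool set" k] by simp
  have "(card B - k) ^ k * 2 ^ k \<le> card ?X * 2 ^ k"
    by (intro mult_le_mono1 card_distinct_lists_ge assms)
  also have "\<dots> = card (?X \<times> ?Y)" by (simp only: card_cartesian_product Y)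
  finally have "(card B - k) ^ k * 2 ^ k \<le> card ?U" using le by (rule order.trans)
  then show "(2 * (card B - k)) ^ k \<le> card ?U" by (simp add: power_mult_distrib mult.commute)
qed

context random_clauses
begin

text \<open>Events of isolated bicycles with different patterns are disjoint, so that no second moment is needed.\<close>

definition isolated :: "nat \<Rightarrow> nat \<Rightarrow> literal list \<Rightarrow> nat list \<Rightarrow> (nat \<Rightarrow> clause) set" where
  "isolated i h us ps = Ev (pat i h us ps) \<inter> {f. \<forall>i' h' us' ps'. bike i' h' us' ps' \<longrightarrow> f \<in> Ev (pat i' h' us' ps') \<longrightarrow>
     pat i' h' us' ps' \<subseteq> pat i h us ps}"

lemma pr_Un: "pr (E \<union> F) \<le> pr E + pr F"
proof -
  have "pr (E \<union> F) \<le> (\<Sum>b\<in>UNIV. pr (if b then E else F))"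
    by (rule pr_UN_le) (auto intro: exI[of _ True] exI[of _ False])
  then show ?thesis by (simp add: UNIV_bool)
qed

text \<open>Given the pattern, another bicycle forces a start of an ear, of probability at most 4 *
  5 * 9 / (gap^3 n), or a bad time outside, at most 64 * 13^2 / (gap^3 n), where 9 = 5 + 4 and 13 =
  5 + 8 come from \<open>gap m * length us \<le> 5\<close>. The sum 10996 / (gap^3 n) is at most 1/2
  by the bound 22000.\<close>

lemma pr_iso:
  assumes b: "bike i h us ps" and a: "gap m > 0" "gap m * real (length us) \<le> 5" "gap m ^ 3 * real n \<ge> 22000"
  shows "q ^ Suc (length us) / 2 \<le> pr (isolated i h us ps)"
proof -
  define R where "R = pat i h us ps"
  define g where "g = gap m"
  have g: "g > 0" using a by (simp add: g_def)
  have n: "real n > 0" using card_A by simp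
  note R = bike_pat[OF b, folded R_def]
  have WA: "vars R \<subseteq> A" using b R by (simp add: bike_def)
  have "distinct (map fst us)" using b by (simp add: bike_def bicycle_def)
  then have cW: "card (vars R) = length us"
    using R(3) distinct_card[of "map fst us"] by simp
  let ?E = "Ev R \<inter> {f. start_ear R (vars R) f}"
  let ?T = "{..<m} - fst ` R"
  have "pr (Ev R) \<le> pr (isolated i h us ps \<union> (?E \<union> (\<Union>t\<in>?T. Ev R \<inter> {f. bad f t})))"
  proof (rule pr_mono)
    fix f assume f: "f \<in> \<Omega>" "f \<in> Ev R"
    show "f \<in> isolated i h us ps \<union> (?E \<union> (\<Union>t\<in>?T. Ev R \<inter> {f. bad f t}))"
    proof (cases "f \<in> isolated i h us ps")
      case False
      then obtain i' h' us' ps' where "bike i' h' us' ps'" "f \<in> Ev (pat i' h' us' ps')" "\<not> pat i' h' us' ps' \<subseteq> pat i h us ps"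
        using f unfolding isolated_def R_def by blast
      from two_bikes[OF f(1) b f(2)[unfolded R_def] this]
      have "start_ear R (vars R) f \<or> (\<exists>t\<in>?T. bad f t)" by (simp only: R_def)
      then show ?thesis using f by blast
    qed simp
  qed
  also have "\<dots> \<le> pr (isolated i h us ps) + pr (?E \<union> (\<Union>t\<in>?T. Ev R \<inter> {f. bad f t}))" by (rule pr_Un)
  also have "pr (?E \<union> (\<Union>t\<in>?T. Ev R \<inter> {f. bad f t})) \<le> pr ?E + pr (\<Union>t\<in>?T. Ev R \<inter> {f. bad f t})" by (rule pr_Un)
  also have "pr (\<Union>t\<in>?T. Ev R \<inter> {f. bad f t}) \<le> (\<Sum>t\<in>?T. pr (Ev R \<inter> {f. bad f t}))"
    by (rule pr_UN_le) auto
  also have "\<dots> \<le> q ^ card R * (64 * (g * real (card (vars R)) + 8)\<^sup>2 / (g ^ 3 * real n))"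
    unfolding g_def by (rule pr_bad[OF a(1) R(1) order_refl WA])
  also have "\<dots> \<le> q ^ card R * (64 * 13\<^sup>2 / (g ^ 3 * real n))"
    using g n q_pos a unfolding cW g_def
    by (intro mult_left_mono divide_right_mono power_mono) auto
  also have "pr ?E \<le> q ^ card R * (4 * real (card (vars R)) / (g\<^sup>2 * real n) * (g * real (card (vars R)) + 4))"
    unfolding g_def by (rule pr_start_ear[OF a(1) R(1) order_refl WA])
  also have "\<dots> = q ^ card R * (4 * (g * real (length us)) * (g * real (length us) + 4) / (g ^ 3 * real n))"
    unfolding cW using g n by (simp add: field_simps power2_eq_square power3_eq_cube)
  also have "\<dots> \<le> q ^ card R * (4 * 5 * (5 + 4) / (g ^ 3 * real n))"
    using g n q_pos a unfolding g_def
    by (intro mult_left_mono divide_right_mono mult_mono add_mono) auto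
  finally have "pr (Ev R) \<le> pr (isolated i h us ps) + (q ^ card R * (4 * 5 * (5 + 4) / (g ^ 3 * real n)) + q ^ card R * (64 * 13\<^sup>2 / (g ^ 3 * real n)))"
    by simp
  moreover have "pr (Ev R) = q ^ card R" by (rule pr_Ev[OF R(1)])
  moreover have "q ^ card R * (4 * 5 * (5 + 4) / (g ^ 3 * real n)) + q ^ card R * (64 * 13\<^sup>2 / (g ^ 3 * real n))
      \<le> q ^ card R * (1 / 2)"
  proof -
    have "4 * 5 * (5 + 4) / (g ^ 3 * real n) + 64 * 13\<^sup>2 / (g ^ 3 * real n) = 10996 / (g ^ 3 * real n)"
      by (simp add: add_divide_distrib[symmetric])
    also have "\<dots> \<le> 1 / 2" using a(3) g n by (simp add: g_def field_simps)
    finally show ?thesis using q_pos by (simp only: distrib_left[symmetric]) (intro mult_left_mono, auto)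
  qed
  ultimately have "q ^ card R - q ^ card R * (1 / 2) \<le> pr (isolated i h us ps)" by linarith
  then show ?thesis using R(2) by simp
qed

definition unsat :: "(nat \<Rightarrow> clause) set" where
  "unsat = {f. \<forall>\<sigma>. \<exists>p<m. \<not> clause_sat \<sigma> (f p)}"

text \<open>Two isolated bicycles in one formula contain each other's patterns, so the patterns
  agree and there are at most 32 of them.\<close>

lemma sum_iso_le:
  assumes X: "finite X" "\<And>i h us ps. (i, h, us, ps) \<in> X \<Longrightarrow> bike i h us ps"
  shows "(\<Sum>(i, h, us, ps)\<in>X. pr (isolated i h us ps)) \<le> 32 * pr unsat"
proof -
  let ?isolated = "\<lambda>x. case x of (i, h, us, ps) \<Rightarrow> isolated i h us ps"
  have card_le: "card {x \<in> X. f \<in> ?isolated x} \<le> 32 * (if f \<in> unsat then 1 else 0)" for f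
  proof (cases "{x \<in> X. f \<in> ?isolated x} = {}")
    case False
    then obtain i h us ps where t: "(i, h, us, ps) \<in> X" "f \<in> isolated i h us ps" by auto
    have "bike i h us ps" "f \<in> Ev (pat i h us ps)" using t X by (auto simp: isolated_def)
    from bike_unsat[OF this] this have "f \<in> unsat"
      unfolding unsat_def bike_def by blast
    moreover have "card {x \<in> X. f \<in> ?isolated x} \<le> 32"
    proof (rule card_same_pat)
      fix i h us ps assume "(i, h, us, ps) \<in> {x \<in> X. f \<in> ?isolated x}"
      then show "bike i h us ps" using X by simp
    next
      fix i h us ps i' h' us' ps'
      assume s: "(i, h, us, ps) \<in> {x \<in> X. f \<in> ?isolated x}" "(i', h', us', ps') \<in> {x \<in> X. f \<in> ?isolated x}"
      then have "f \<in> isolated i h us ps" "f \<in> isolated i' h' us' ps'" "bike i h us ps" "bike i' h' us' ps'" using X by simp_all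
      then show "pat i h us ps = pat i' h' us' ps'" unfolding isolated_def by blast
    qed
    ultimately show ?thesis by simp
  next
    case True
    show ?thesis unfolding True by simp
  qed
  have "(\<Sum>(i, h, us, ps)\<in>X. pr (isolated i h us ps)) = (\<Sum>x\<in>X. pr (?isolated x))"
    by (intro sum.cong) auto
  also have "\<dots> = (\<Sum>x\<in>X. \<Sum>f\<in>\<Omega>. if f \<in> ?isolated x then 1 else 0) / real (card \<Omega>)"
    by (simp add: pr_eq sum_divide_distrib flip: sum.inter_filter) (simp add: Int_def)
  also have "\<dots> = (\<Sum>f\<in>\<Omega>. real (card {x \<in> X. f \<in> ?isolated x})) / real (card \<Omega>)"
    by (subst sum.swap) (simp add: X flip: sum.inter_filter)
  also have "\<dots> \<le> (\<Sum>f\<in>\<Omega>. 32 * (if f \<in> unsat then 1 else 0)) / real (card \<Omega>)"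
  proof (intro divide_right_mono sum_mono)
    fix f
    have "real (card {x \<in> X. f \<in> ?isolated x}) \<le> real (32 * (if f \<in> unsat then 1 else 0))"
      using card_le[of f] by (simp only: of_nat_le_iff)
    then show "real (card {x \<in> X. f \<in> ?isolated x}) \<le> 32 * (if f \<in> unsat then 1 else 0)" by (simp split: if_splits)
  qed simp
  also have "\<dots> = 32 * pr unsat"
    by (simp add: pr_eq sum_distrib_left[symmetric] flip: sum.inter_filter) (simp add: Int_def)
  finally show ?thesis .
qed

text \<open>\<open>r\<close>, \<open>t\<close>, \<open>s\<close> are the differences
  \<open>i - 1\<close>, \<open>h - i\<close> and \<open>length us - h\<close>; any positive values
  give bicycles, and different triples give disjoint families.\<close>

definition bikes :: "nat \<Rightarrow> nat \<Rightarrow> nat \<Rightarrow> (nat \<times> nat \<times> literal list \<times> nat list) set" where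
  "bikes r t s = (\<lambda>(us, ps). (r + 1, r + 1 + t, us, ps)) `
     ({us. length us = r + t + s + 1 \<and> distinct (map fst us) \<and> fst ` set us \<subseteq> A} \<times>
      {ps. length ps = r + t + s + 2 \<and> distinct ps \<and> set ps \<subseteq> {..<m}})"

lemma bikesD:
  assumes "(i, h, us, ps) \<in> bikes r t s" "r \<ge> 1" "t \<ge> 1" "s \<ge> 1"
  shows "bike i h us ps" "length us = r + t + s + 1" "i = r + 1" "h = r + 1 + t"
  using assms by (auto simp: bikes_def bike_def bicycle_def)

lemma card_bikes:
  assumes "r + t + s + 2 \<le> n" "r + t + s + 2 \<le> m"
  shows "real (2 * (n - (r + t + s + 1))) ^ (r + t + s + 1) * real (m - (r + t + s + 2)) ^ (r + t + s + 2) \<le> real (card (bikes r t s))"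
    and "finite (bikes r t s)"
proof -
  let ?l = "r + t + s + 1"
  let ?U = "{us :: literal list. length us = ?l \<and> distinct (map fst us) \<and> fst ` set us \<subseteq> A}"
  let ?P = "{ps. length ps = r + t + s + 2 \<and> distinct ps \<and> set ps \<subseteq> {..<m}}"
  have U: "(2 * (n - ?l)) ^ ?l \<le> card ?U" "finite ?U"
    using card_literal_lists_ge[of A ?l] assms by auto
  have P: "(m - (r + t + s + 2)) ^ (r + t + s + 2) \<le> card ?P"
    using card_distinct_lists_ge[of "{..<m}" "r + t + s + 2"] assms by simp
  have "?P \<subseteq> {ps. set ps \<subseteq> {..<m} \<and> length ps = r + t + s + 2}" by auto
  then have fP: "finite ?P" by (rule finite_subset[OF _ finite_lists_length_eq]) simp
  show "finite (bikes r t s)" unfolding bikes_def using U fP by (intro finite_imageI finite_cartesian_product)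
  have "card (bikes r t s) = card (?U \<times> ?P)"
    unfolding bikes_def by (rule card_image) (auto intro!: inj_onI)
  also have "\<dots> = card ?U * card ?P" by (rule card_cartesian_product)
  finally have "(2 * (n - ?l)) ^ ?l * (m - (r + t + s + 2)) ^ (r + t + s + 2) \<le> card (bikes r t s)"
    using mult_le_mono[OF U(1) P] by simp
  then show "real (2 * (n - ?l)) ^ ?l * real (m - (r + t + s + 2)) ^ (r + t + s + 2) \<le> real (card (bikes r t s))"
    by (metis of_nat_le_iff of_nat_mult of_nat_power)
qed

text \<open>With K clauses on K - 1 variables the expected number is about (2n)^(K-1) m^K / (2
  n^2)^K = (m/n)^K / (2n). As m/n is about 1 - gap \<ge> \<kappa> and gap * K \<le> 5, the power is
  about exp (-5/\<kappa>) or more. Avoiding repetitions costs a factor 1/2 for the variables and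
  another one for the times, by Bernoulli's inequality and K(K + 1) \<le> \<kappa> n / 2.\<close>

lemma bikes_weight:
  assumes k: "0 < \<kappa>" "gap m \<le> 1 - \<kappa>" "gap m > 0"
    and K: "gap m * real K \<le> 5" "K \<ge> 1" "real K * (real K + 1) \<le> \<kappa> * real n / 2"
  shows "exp (- 5 / \<kappa>) / (8 * real n) \<le> real (2 * (n - (K - 1))) ^ (K - 1) * real (m - K) ^ K * q ^ K"
    and "K \<le> n" "K \<le> m"
proof -
  define N where "N = real n"
  have N: "N \<ge> 2" using card_A by (simp add: N_def)
  have \<kappa>1: "\<kappa> < 1" using k by linarith
  have K1: "real K \<ge> 1" using K by simp
  have KK: "real K * (real K + 1) / (\<kappa> * N) \<le> 1 / 2"
    using K(3) k N by (simp add: N_def field_simps)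
  have Kn: "real K * 2 \<le> \<kappa> * N / 2"
  proof -
    have "real K * 2 \<le> real K * (real K + 1)" using K1 by (intro mult_left_mono) auto
    then show ?thesis using K(3) by (simp add: N_def)
  qed
  also have "\<dots> \<le> N / 2" using \<kappa>1 N by simp
  finally show "K \<le> n" by (simp add: N_def)
  have m: "real m = (1 - gap m) * (N - 1)" using N by (simp add: gap_def N_def)
  have "real m \<ge> \<kappa> * (N - 1)" unfolding m using k N by (intro mult_right_mono) auto
  then have "real K \<le> real m" using Kn \<kappa>1 K1 by (simp add: algebra_simps)
  then show Km: "K \<le> m" by simp
  have b1: "1 / 2 \<le> (1 - real K / N) ^ (K - 1)"
  proof -
    have "1 + real (K - 1) * (- (real K / N)) \<le> (1 + - (real K / N)) ^ (K - 1)"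
      using \<open>K \<le> n\<close> N by (intro Bernoulli_inequality) (simp add: N_def)
    moreover have "real (K - 1) * (real K / N) \<le> 1 / 2"
    proof -
      have "real (K - 1) * real K \<le> (real K + 1) * real K" by (intro mult_right_mono) auto
      also have "\<dots> = real K * (real K + 1)" by (rule mult.commute)
      also have "\<dots> \<le> \<kappa> * N / 2" using K(3) by (simp add: N_def)
      also have "\<dots> \<le> 1 * N / 2" using \<kappa>1 N by (intro divide_right_mono mult_right_mono) auto
      finally show ?thesis using N by (simp add: field_simps)
    qed
    ultimately show ?thesis by simp
  qed
  have c1: "(real K + 1) / (\<kappa> * N) \<le> 1"
  proof -
    have "(real K + 1) / (\<kappa> * N) \<le> real K * (real K + 1) / (\<kappa> * N)"
      using k N K1 by (intro divide_right_mono) (auto simp: mult_le_cancel_right1)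
    then show ?thesis using KK by linarith
  qed
  have b2: "(1 - (real K + 1) / (\<kappa> * N)) ^ K \<ge> 1 / 2"
  proof -
    have "1 + real K * (- ((real K + 1) / (\<kappa> * N))) \<le> (1 + - ((real K + 1) / (\<kappa> * N))) ^ K"
      using c1 by (intro Bernoulli_inequality) simp
    then show ?thesis using KK by simp
  qed
  have mK: "(1 - gap m) * (1 - (real K + 1) / (\<kappa> * N)) \<le> real (m - K) / N"
  proof -
    have "(real K + 1) / N \<le> (1 - gap m) * ((real K + 1) / (\<kappa> * N))"
    proof -
      have "\<kappa> * ((real K + 1) / (\<kappa> * N)) \<le> (1 - gap m) * ((real K + 1) / (\<kappa> * N))"
        using k N by (intro mult_right_mono) auto
      then show ?thesis using k by simp
    qed
    moreover have "real (m - K) / N = (1 - gap m) - (1 - gap m) / N - real K / N"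
    proof -
      have "real (m - K) = (1 - gap m) * N - (1 - gap m) - real K"
        using Km m by (simp add: of_nat_diff algebra_simps)
      then show ?thesis using N by (simp add: diff_divide_distrib)
    qed
    moreover have "(1 - gap m) / N \<le> 1 / N" using k N by (intro divide_right_mono) auto
    ultimately show ?thesis using N by (simp add: algebra_simps add_divide_distrib)
  qed
  have b3: "exp (- 5 / \<kappa>) \<le> (1 - gap m) ^ K"
  proof -
    have "1 / (1 - gap m) = 1 + gap m / (1 - gap m)" using k by (simp add: field_simps)
    also have "\<dots> \<le> exp (gap m / (1 - gap m))" by (rule exp_ge_add_one_self)
    also have "\<dots> \<le> exp (gap m / \<kappa>)" using k by (auto intro!: divide_left_mono)
    finally have "inverse (exp (gap m / \<kappa>)) \<le> 1 - gap m"
      using k by (simp add: field_simps)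
    then have "exp (- (gap m / \<kappa>)) ^ K \<le> (1 - gap m) ^ K" by (intro power_mono) (auto simp: exp_minus)
    moreover have "exp (- (gap m / \<kappa>)) ^ K = exp (- (gap m * real K / \<kappa>))"
      by (simp add: exp_of_nat_mult[symmetric] mult_ac)
    moreover have "exp (- 5 / \<kappa>) \<le> exp (- (gap m * real K / \<kappa>))" using k K by (simp add: divide_right_mono)
    ultimately show ?thesis by linarith
  qed
  have "exp (- 5 / \<kappa>) / (8 * N) = (1 / (2 * N)) * ((1 / 2) * (exp (- 5 / \<kappa>) * (1 / 2)))" by simp
  also have "\<dots> \<le> (1 / (2 * N)) * ((1 - real K / N) ^ (K - 1) * ((1 - gap m) ^ K * (1 - (real K + 1) / (\<kappa> * N)) ^ K))"
    using b1 b2 b3 N k by (intro mult_left_mono mult_mono) auto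
  also have "\<dots> = (1 / (2 * N)) * ((1 - real K / N) ^ (K - 1) * ((1 - gap m) * (1 - (real K + 1) / (\<kappa> * N))) ^ K)"
    by (simp add: power_mult_distrib)
  also have "\<dots> \<le> (1 / (2 * N)) * ((real (n - (K - 1)) / N) ^ (K - 1) * (real (m - K) / N) ^ K)"
  proof (intro mult_left_mono mult_mono power_mono mK)
    show "1 - real K / N \<le> real (n - (K - 1)) / N"
      using \<open>K \<le> n\<close> N by (simp add: N_def of_nat_diff field_simps)
    show "0 \<le> 1 - real K / N" using \<open>K \<le> n\<close> N by (simp add: N_def)
    show *: "0 \<le> (1 - gap m) * (1 - (real K + 1) / (\<kappa> * N))" using c1 k by (intro mult_nonneg_nonneg) auto
    show "0 \<le> ((1 - gap m) * (1 - (real K + 1) / (\<kappa> * N))) ^ K" using * by simp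
  qed (use N in auto)
  also have "\<dots> = real (2 * (n - (K - 1))) ^ (K - 1) * real (m - K) ^ K * (1 / (2 * N\<^sup>2)) ^ K"
  proof -
    obtain k' where k': "K = Suc k'" using K by (cases K) auto
    show ?thesis using N by (simp add: k' power_mult_distrib power_divide power2_eq_square field_simps)
  qed
  also have "\<dots> \<le> real (2 * (n - (K - 1))) ^ (K - 1) * real (m - K) ^ K * q ^ K"
  proof (intro mult_left_mono power_mono)
    show "1 / (2 * N\<^sup>2) \<le> q" unfolding q_def N_def using card_A
      by (intro divide_left_mono) (auto simp: power2_eq_square intro!: mult_left_mono)
  qed auto
  finally show "exp (- 5 / \<kappa>) / (8 * real n) \<le> real (2 * (n - (K - 1))) ^ (K - 1) * real (m - K) ^ K * q ^ K"
    by (simp add: N_def)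
qed

text \<open>Each of the three lengths runs up to L = floor (1/gap) \<ge> 1 / (2 gap), giving at
  least 1 / (8 gap^3) families of weight exp (-5/\<kappa>) / (16 n); with the multiplicity 32 this
  makes 8 * 16 * 32 = 4096. From K \<le> 3L + 2 \<le> 5L follow gap * K \<le> 5 and K(K + 1) \<le>
  30 / gap^2, which the bound 60 turns into K(K + 1) \<le> \<kappa> n / 2.\<close>

theorem prob_unsat_ge:
  assumes k: "0 < \<kappa>" "gap m \<le> 1 - \<kappa>" and a: "gap m > 0" "gap m ^ 3 * real n \<ge> 22000" "(gap m)\<^sup>2 * \<kappa> * real n \<ge> 60"
  shows "exp (- 5 / \<kappa>) / 4096 / (gap m ^ 3 * real n) \<le> pr unsat"
proof -
  define g where "g = gap m"
  have g: "0 < g" "g \<le> 1" using a gap_le_1 by (auto simp: g_def)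
  have n: "real n > 0" using card_A by simp
  define L where "L = nat \<lfloor>1 / g\<rfloor>"
  have L: "1 \<le> L" "real L \<le> 1 / g" "1 / g \<le> 2 * real L"
  proof -
    have "1 \<le> 1 / g" using g by simp
    then have f: "1 \<le> \<lfloor>1 / g\<rfloor>" by linarith
    then have "0 \<le> \<lfloor>1 / g\<rfloor>" by linarith
    then have L: "real L = of_int \<lfloor>1 / g\<rfloor>" unfolding L_def by (rule of_nat_nat)
    then show "real L \<le> 1 / g" by linarith
    have "1 \<le> real L" using f L by linarith
    then show "1 \<le> L" by simp
    show "1 / g \<le> 2 * real L" using f L by linarith
  qed
  have gL: "g * real L \<le> 1" using L(2) g by (simp add: field_simps)
  define T where "T = {1..L} \<times> {1..L} \<times> {1..L}"
  have each: "exp (- 5 / \<kappa>) / (16 * real n) \<le> (\<Sum>(i, h, us, ps)\<in>bikes r t s. pr (isolated i h us ps))"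
    and fin: "finite (bikes r t s)"
    if rts: "r \<in> {1..L}" "t \<in> {1..L}" "s \<in> {1..L}" for r t s
  proof -
    let ?K = "r + t + s + 2"
    have "real ?K \<le> 5 * real L" using rts L by auto
    then have "g * real ?K \<le> g * (5 * real L)" using g by (intro mult_left_mono) auto
    also have "\<dots> \<le> 5" using gL by simp
    finally have gK: "g * real ?K \<le> 5" .
    have KK: "real ?K * (real ?K + 1) \<le> \<kappa> * real n / 2"
    proof -
      have "g\<^sup>2 * (real ?K * (real ?K + 1)) = (g * real ?K) * (g * real ?K + g)"
        by (simp add: algebra_simps power2_eq_square)
      also have "\<dots> \<le> 5 * (5 + 1)" using gK g by (intro mult_mono add_mono) auto
      also have "\<dots> \<le> g\<^sup>2 * (\<kappa> * real n / 2)" using a(3) by (simp add: g_def algebra_simps)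
      finally show ?thesis by (rule mult_left_le_imp_le) (use g in simp)
    qed
    note w = bikes_weight[OF k a(1) gK[unfolded g_def] _ KK]
    show fin: "finite (bikes r t s)" using w(2,3) by (intro card_bikes) auto
    have "exp (- 5 / \<kappa>) / (16 * real n) = exp (- 5 / \<kappa>) / (8 * real n) / 2" by simp
    also have "\<dots> \<le> (real (2 * (n - (?K - 1))) ^ (?K - 1) * real (m - ?K) ^ ?K * q ^ ?K) / 2"
      by (intro divide_right_mono w(1)) auto
    also have "\<dots> = (real (2 * (n - (r + t + s + 1))) ^ (r + t + s + 1) * real (m - ?K) ^ ?K) * (q ^ ?K / 2)"
      by simp
    also have "\<dots> \<le> real (card (bikes r t s)) * (q ^ ?K / 2)"
      using w(2,3) q_pos by (intro mult_right_mono card_bikes) auto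
    also have "\<dots> = (\<Sum>x\<in>bikes r t s. q ^ ?K / 2)" by simp
    also have "\<dots> \<le> (\<Sum>(i, h, us, ps)\<in>bikes r t s. pr (isolated i h us ps))"
    proof (rule sum_mono)
      fix x assume x: "x \<in> bikes r t s"
      obtain i h us ps where xx: "x = (i, h, us, ps)" by (rule prod_cases4)
      have b: "bike i h us ps" "length us = r + t + s + 1"
        using bikesD[of i h us ps r t s] x rts by (auto simp: xx)
      have "gap m * real (length us) \<le> gap m * real ?K" using a(1) b(2) by (intro mult_left_mono) auto
      then have "gap m * real (length us) \<le> 5" using gK by (simp add: g_def)
      from pr_iso[OF b(1) a(1) this a(2)] show "q ^ ?K / 2 \<le> (case x of (i, h, us, ps) \<Rightarrow> pr (isolated i h us ps))"
        using b(2) by (simp add: xx)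
    qed
    finally show "exp (- 5 / \<kappa>) / (16 * real n) \<le> (\<Sum>(i, h, us, ps)\<in>bikes r t s. pr (isolated i h us ps))" .
  qed
  let ?X = "\<Union>(r, t, s)\<in>T. bikes r t s"
  have finT: "finite T" by (simp add: T_def)
  have "real (card T) * (exp (- 5 / \<kappa>) / (16 * real n)) \<le> (\<Sum>(r, t, s)\<in>T. \<Sum>(i, h, us, ps)\<in>bikes r t s. pr (isolated i h us ps))"
  proof -
    have "(\<Sum>x\<in>T. exp (- 5 / \<kappa>) / (16 * real n)) \<le> (\<Sum>(r, t, s)\<in>T. \<Sum>(i, h, us, ps)\<in>bikes r t s. pr (isolated i h us ps))"
      using each by (intro sum_mono) (auto simp: T_def)
    then show ?thesis by simp
  qed
  also have "\<dots> = (\<Sum>(i, h, us, ps)\<in>?X. pr (isolated i h us ps))"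
  proof -
    have "(\<Sum>(i, h, us, ps)\<in>(\<Union>x\<in>T. case x of (r, t, s) \<Rightarrow> bikes r t s). pr (isolated i h us ps)) =
      (\<Sum>x\<in>T. \<Sum>(i, h, us, ps)\<in>(case x of (r, t, s) \<Rightarrow> bikes r t s). pr (isolated i h us ps))"
    proof (rule sum.UNION_disjoint[OF finT])
      show "\<forall>x\<in>T. finite (case x of (r, t, s) \<Rightarrow> bikes r t s)" using fin by (auto simp: T_def)
      show "\<forall>x\<in>T. \<forall>y\<in>T. x \<noteq> y \<longrightarrow> (case x of (r, t, s) \<Rightarrow> bikes r t s) \<inter> (case y of (r, t, s) \<Rightarrow> bikes r t s) = {}"
      proof (intro ballI impI)
        fix x y assume xy: "x \<in> T" "y \<in> T" "x \<noteq> y"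
        obtain r t s where x: "x = (r, t, s)" by (rule prod_cases3)
        obtain r' t' s' where y: "y = (r', t', s')" by (rule prod_cases3)
        have disj: False if z: "z \<in> bikes r t s" "z \<in> bikes r' t' s'" for z
        proof -
          obtain i h us ps where zz: "z = (i, h, us, ps)" by (rule prod_cases4)
          have 1: "length us = r + t + s + 1 \<and> i = r + 1 \<and> h = r + 1 + t"
            using bikesD(2-4)[of i h us ps r t s] z(1) xy(1) unfolding zz x T_def by simp
          have 2: "length us = r' + t' + s' + 1 \<and> i = r' + 1 \<and> h = r' + 1 + t'"
            using bikesD(2-4)[of i h us ps r' t' s'] z(2) xy(2) unfolding zz y T_def by simp
          have "r = r' \<and> t = t' \<and> s = s'" using 1 2 by linarith
          then show False using xy(3) x y by simp
        qed
        then show "(case x of (r, t, s) \<Rightarrow> bikes r t s) \<inter> (case y of (r, t, s) \<Rightarrow> bikes r t s) = {}"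
          unfolding x y prod.case using disj by (intro equals0I) (elim IntE)
      qed
    qed
    then show ?thesis by (simp add: case_prod_unfold)
  qed
  also have "\<dots> \<le> 32 * pr unsat"
  proof (rule sum_iso_le)
    show "finite ?X" using finT fin by (auto simp: T_def)
    fix i h us ps assume "(i, h, us, ps) \<in> ?X"
    then obtain r t s where "(r, t, s) \<in> T" "(i, h, us, ps) \<in> bikes r t s" by blast
    then show "bike i h us ps" using bikesD(1)[of i h us ps r t s] unfolding T_def by simp
  qed
  finally have main: "real (card T) * (exp (- 5 / \<kappa>) / (16 * real n)) \<le> 32 * pr unsat" .
  have "1 / (8 * g ^ 3) \<le> real (card T)"
  proof -
    have "(1 / g) ^ 3 \<le> (2 * real L) ^ 3" using g L by (intro power_mono) auto
    then show ?thesis by (simp add: T_def card_cartesian_product power_divide power_mult_distrib power3_eq_cube)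
  qed
  then have "1 / (8 * g ^ 3) * (exp (- 5 / \<kappa>) / (16 * real n)) \<le> real (card T) * (exp (- 5 / \<kappa>) / (16 * real n))"
    using n by (intro mult_right_mono) auto
  from order.trans[OF this main]
  have "1 / (8 * g ^ 3) * (exp (- 5 / \<kappa>) / (16 * real n)) \<le> 32 * pr unsat" .
  then show ?thesis by (simp add: g_def)
qed

end

subsection \<open>The unit clause algorithm\<close>

text \<open>Clauses of a partially assigned formula are coded by their number of literals; the code \<open>3\<close>
  stands for a clause that is already satisfied and is represented by \<open>UNIV\<close>.\<close>

definition gen :: "nat set \<Rightarrow> nat \<Rightarrow> clause set" where
  "gen A \<tau> = (if \<tau> = 2 then clauses_on A else if \<tau> = 1 then (\<lambda>z. {z}) ` lits A else if \<tau> = 0 then {{}} else {UNIV})"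

definition avg :: "clause set \<Rightarrow> (clause \<Rightarrow> real) \<Rightarrow> real" where
  "avg S h = (\<Sum>C\<in>S. h C) / real (card S)"

text \<open>Expectation over independent clauses, the one with code \<tau> uniform on
  \<open>gen A \<tau>\<close>. Only the codes are known; the literals stay undecided until an
  average is resolved.\<close>

primrec mean :: "nat set \<Rightarrow> nat list \<Rightarrow> (formula \<Rightarrow> real) \<Rightarrow> real" where
  "mean A [] h = h []"
| "mean A (\<tau> # ts) h = avg (gen A \<tau>) (\<lambda>C. mean A ts (\<lambda>F. h (C # F)))"

definition res :: "literal \<Rightarrow> clause \<Rightarrow> clause" where
  "res x C = (if x \<in> C then UNIV else C - {neg x})"

text \<open>The law of the code of a random clause after one of the n variables is set: a 2-clause
  contains it with probability 2/n, a unit clause with probability 1/n, and then its literal is true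
  or false with equal probability.\<close>

definition kernel :: "real \<Rightarrow> nat \<Rightarrow> (nat \<Rightarrow> real) \<Rightarrow> real" where
  "kernel n \<tau> g = (if \<tau> = 2 then (1 - 2 / n) * g 2 + 1 / n * g 1 + 1 / n * g 3
     else if \<tau> = 1 then (1 - 1 / n) * g 1 + 1 / (2 * n) * g 0 + 1 / (2 * n) * g 3
     else if \<tau> = 0 then g 0 else g 3)"

primrec trans_op :: "real \<Rightarrow> nat list \<Rightarrow> (nat list \<Rightarrow> real) \<Rightarrow> real" where
  "trans_op n [] \<Phi> = \<Phi> []"
| "trans_op n (\<tau> # ts) \<Phi> = kernel n \<tau> (\<lambda>\<tau>'. trans_op n ts (\<lambda>ts'. \<Phi> (\<tau>' # ts')))"

lemma avg_sum: "avg S (\<lambda>C. \<Sum>i\<in>I. h i C) = (\<Sum>i\<in>I. avg S (h i))"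
  by (simp add: avg_def sum_divide_distrib sum.swap[of _ I])

lemma avg_divide: "avg S (\<lambda>C. h C / c) = avg S h / c"
  by (simp add: avg_def sum_divide_distrib mult.commute)

lemma avg_mono: "(\<And>C. C \<in> S \<Longrightarrow> h C \<le> h' C) \<Longrightarrow> avg S h \<le> avg S h'"
  by (simp add: avg_def divide_right_mono sum_mono)

lemma avg_single [simp]: "avg {C} h = h C"
  by (simp add: avg_def)

lemma gen_simps: "gen A 2 = clauses_on A" "gen A (Suc 0) = (\<lambda>z. {z}) ` lits A" "gen A 1 = (\<lambda>z. {z}) ` lits A" "gen A 0 = {{}}" "gen A 3 = {UNIV}"
  by (simp_all add: gen_def)

lemma avg_units: "avg ((\<lambda>z. {z}) ` lits A) h = (\<Sum>z\<in>lits A. h {z}) / real (card (lits A))"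
  by (simp add: avg_def sum.reindex card_image)

lemma mean_mono:
  assumes "\<And>F. list_all2 (\<lambda>C \<tau>. C \<in> gen A \<tau>) F ts \<Longrightarrow> h F \<le> h' F"
  shows "mean A ts h \<le> mean A ts h'"
  using assms by (induction ts arbitrary: h h') (auto intro!: avg_mono)

lemma mean_le: "(\<And>F. h F \<le> c) \<Longrightarrow> 0 \<le> c \<Longrightarrow> mean A ts h \<le> c"
proof (induction ts arbitrary: h)
  case (Cons \<tau> ts)
  have "avg (gen A \<tau>) (\<lambda>C. mean A ts (\<lambda>F. h (C # F))) \<le> avg (gen A \<tau>) (\<lambda>C. c)"
    using Cons by (intro avg_mono) auto
  also have "\<dots> \<le> c" using Cons.prems by (simp add: avg_def)
  finally show ?case by simp
qed simp

lemma trans_op_sum: "trans_op n ts (\<lambda>ts'. \<Sum>i\<in>I. \<Phi> i ts') = (\<Sum>i\<in>I. trans_op n ts (\<Phi> i))"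
  by (induction ts arbitrary: \<Phi>) (simp_all add: kernel_def sum.distrib sum_distrib_left)

lemma trans_op_divide: "trans_op n ts (\<lambda>ts'. \<Phi> ts' / c) = trans_op n ts \<Phi> / c"
  by (induction ts arbitrary: \<Phi>) (simp_all add: kernel_def add_divide_distrib)

lemma trans_op_cmult: "trans_op n ts (\<lambda>ts'. c * \<Phi> ts') = c * trans_op n ts \<Phi>"
  by (induction ts arbitrary: \<Phi>) (simp_all add: kernel_def algebra_simps)

lemma trans_op_add: "trans_op n ts (\<lambda>ts'. \<Phi> ts' + \<Psi> ts') = trans_op n ts \<Phi> + trans_op n ts \<Psi>"
  by (induction ts arbitrary: \<Phi> \<Psi>) (simp_all add: kernel_def algebra_simps)

lemma trans_op_avg:
  "trans_op n ts (\<lambda>ts'. avg S (\<lambda>C. g C ts')) = avg S (\<lambda>C. trans_op n ts (g C))"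
  by (simp add: avg_def trans_op_divide trans_op_sum)

lemma trans_op_mono:
  assumes "n \<ge> 2" "\<And>ts'. \<Phi> ts' \<le> \<Psi> ts'"
  shows "trans_op n ts \<Phi> \<le> trans_op n ts \<Psi>"
  using assms(2)
proof (induction ts arbitrary: \<Phi> \<Psi>)
  case (Cons \<tau> ts)
  have "trans_op n ts (\<lambda>ts'. \<Phi> (\<tau>' # ts')) \<le> trans_op n ts (\<lambda>ts'. \<Psi> (\<tau>' # ts'))" for \<tau>'
    using Cons by simp
  then show ?case using assms(1)
    by (auto simp: kernel_def intro!: add_mono mult_left_mono divide_right_mono)
qed simp

text \<open>Deferred decisions: setting the variable of \<open>x\<close> reveals only how a clause
  contains it. A clause that keeps both literals, or one of them, is still uniform among those of
  its code on the other variables. As \<open>card A \<ge> 3\<close>, two variables remain and the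
  averages are over nonempty sets.\<close>

lemma avg_res:
  assumes A: "finite A" "card A \<ge> 3" and x: "fst x \<in> A"
  shows "avg (gen A \<tau>) (\<lambda>C. h (res x C)) = kernel (real (card A)) \<tau> (\<lambda>\<tau>'. avg (gen (A - {fst x}) \<tau>') h)"
proof -
  let ?A' = "A - {fst x}" and ?n = "real (card A)"
  have n: "?n \<ge> 3" using A by simp
  have cA': "card ?A' = card A - 1" using A x by simp
  have rA': "real (card ?A') = ?n - 1" using A by (simp add: cA' of_nat_diff)
  have L: "lits A = lits ?A' \<union> {x, neg x}"
  proof (intro subset_antisym subsetI)
    fix z assume "z \<in> lits A"
    then show "z \<in> lits ?A' \<union> {x, neg x}" using same_var_cases[of z x] by (auto simp: lits_iff)
  qed (use x in \<open>auto simp: lits_iff\<close>)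
  have Ld: "lits ?A' \<inter> {x, neg x} = {}" by (auto simp: lits_iff)
  have fL: "finite (lits ?A')" using A by simp
  have zx: "x \<noteq> z \<and> neg x \<noteq> z" if "z \<in> lits ?A'" for z using that by (auto simp: lits_iff)
  consider "\<tau> = 2" | "\<tau> = 1" | "\<tau> = 0" | "\<tau> \<notin> {0, 1, 2}" by blast
  then show ?thesis
  proof cases
    case 1
    let ?P = "(\<lambda>z. {neg x, z}) ` lits ?A'" and ?Q = "(\<lambda>z. {x, z}) ` lits ?A'"
    have in': "x \<notin> C \<and> neg x \<notin> C" if "C \<in> clauses_on ?A'" for C
    proof -
      have "fst ` C \<subseteq> ?A'" using that by (auto simp: clauses_on_def)
      then show ?thesis using imageI[of x C fst] imageI[of "neg x" C fst] by auto
    qed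
    have split: "clauses_on A = clauses_on ?A' \<union> (?P \<union> ?Q)"
    proof (intro subset_antisym subsetI)
      fix C assume "C \<in> clauses_on A"
      then obtain a b where C: "C = {a, b}" "fst a \<in> A" "fst b \<in> A" "fst a \<noteq> fst b"
        by (auto simp: clauses_on_def)
      have PQ: "{c, d} \<in> ?P \<union> ?Q" if "fst c = fst x" "fst d \<noteq> fst x" "fst d \<in> A" for c d
      proof -
        have "d \<in> lits ?A'" using that by (simp add: lits_iff)
        moreover have "c = x \<or> c = neg x" using that same_var_cases by blast
        ultimately show ?thesis by blast
      qed
      show "C \<in> clauses_on ?A' \<union> (?P \<union> ?Q)"
      proof (cases "fst a = fst x")
        case True
        then show ?thesis using PQ[of a b] C by simp
      next
        case a: False
        show ?thesis
        proof (cases "fst b = fst x")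
          case True
          then show ?thesis using PQ[of b a] C by (simp add: insert_commute)
        next
          case False
          have "C \<in> clauses_on ?A'" unfolding clauses_on_def mem_Collect_eq
            using a False C by (intro exI[of _ a] exI[of _ b]) auto
          then show ?thesis by simp
        qed
      qed
    next
      fix C assume "C \<in> clauses_on ?A' \<union> (?P \<union> ?Q)"
      then consider "C \<in> clauses_on ?A'" | z where "z \<in> lits ?A'" "C = {neg x, z}" | z where "z \<in> lits ?A'" "C = {x, z}"
        by blast
      then show "C \<in> clauses_on A"
      proof cases
        case 1 then show ?thesis by (auto simp: clauses_on_def)
      next
        case 2 then show ?thesis unfolding clauses_on_def mem_Collect_eq using x
          by (intro exI[of _ "neg x"] exI[of _ z]) (auto simp: lits_iff)
      next
        case 3 then show ?thesis unfolding clauses_on_def mem_Collect_eq using x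
          by (intro exI[of _ x] exI[of _ z]) (auto simp: lits_iff)
      qed
    qed
    have fin: "finite (clauses_on ?A')" using A by (simp add: card_clauses_on)
    have d1: "clauses_on ?A' \<inter> (?P \<union> ?Q) = {}"
    proof -
      have False if "C \<in> clauses_on ?A'" "C \<in> ?P \<union> ?Q" for C using in'[OF that(1)] that(2) by auto
      then show ?thesis by blast
    qed
    have d2: "?P \<inter> ?Q = {}"
    proof -
      have False if "C \<in> ?P" "C \<in> ?Q" for C
      proof -
        from that obtain z z' where "z \<in> lits ?A'" "z' \<in> lits ?A'" "C = {neg x, z}" "C = {x, z'}" by auto
        then show False using zx[of z] by (metis doubleton_eq_iff neg_neq(1))
      qed
      then show ?thesis by blast
    qed
    have injP: "inj_on (\<lambda>z. {neg x, z}) (lits ?A')" and injQ: "inj_on (\<lambda>z. {x, z}) (lits ?A')"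
      using zx by (auto intro!: inj_onI simp: doubleton_eq_iff)
    have r1: "res x C = C" if "C \<in> clauses_on ?A'" for C using in'[OF that] by (simp add: res_def)
    have r2: "res x {neg x, z} = {z}" if "z \<in> lits ?A'" for z
      using zx[OF that] by (auto simp: res_def)
    have r3: "res x {x, z} = UNIV" for z by (simp add: res_def)
    have "(\<Sum>C\<in>clauses_on A. h (res x C)) = (\<Sum>C\<in>clauses_on ?A'. h (res x C)) + ((\<Sum>C\<in>?P. h (res x C)) + (\<Sum>C\<in>?Q. h (res x C)))"
      unfolding split using fin fL d1 d2 by (simp add: sum.union_disjoint)
    also have "(\<Sum>C\<in>clauses_on ?A'. h (res x C)) = (\<Sum>C\<in>clauses_on ?A'. h C)"
      using r1 by (intro sum.cong) auto
    also have "(\<Sum>C\<in>?P. h (res x C)) = (\<Sum>z\<in>lits ?A'. h {z})"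
      using r2 by (simp add: sum.reindex[OF injP])
    also have "(\<Sum>C\<in>?Q. h (res x C)) = real (card (lits ?A')) * h UNIV"
      by (simp add: sum.reindex[OF injQ] r3)
    finally have S: "(\<Sum>C\<in>clauses_on A. h (res x C)) =
      (\<Sum>C\<in>clauses_on ?A'. h C) + ((\<Sum>z\<in>lits ?A'. h {z}) + real (card (lits ?A')) * h UNIV)" .
    have c1: "real (card (clauses_on A)) = 2 * ?n * (?n - 1)"
      using A by (simp add: card_clauses_on of_nat_diff)
    have c2: "real (card (clauses_on ?A')) = 2 * (?n - 1) * (?n - 2)"
      using A x by (simp add: card_clauses_on cA' of_nat_diff)
    have c3: "real (card (lits ?A')) = 2 * (?n - 1)" by (simp add: card_lits rA')
    have alg: "(X + (Y + 2 * (N - 1) * Z)) / (2 * N * (N - 1)) =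
      (1 - 2 / N) * (X / (2 * (N - 1) * (N - 2))) + 1 / N * (Y / (2 * (N - 1))) + 1 / N * Z" if "N \<ge> 3" for X Y Z N :: real
    proof -
      define a b where "a = N - 1" and "b = N - 2"
      have ab: "a > 0" "b > 0" "N > 0" "1 - 2 / N = b / N" using that by (auto simp: a_def b_def field_simps)
      show ?thesis unfolding ab(4) a_def[symmetric] b_def[symmetric] using ab(1-3) by (simp add: field_simps)
    qed
    show ?thesis
      using alg[OF n] 1 by (simp add: kernel_def gen_simps avg_units avg_def[of "clauses_on _"] S c1 c2 c3)
  next
    case 2
    have r1: "res x {z} = {z}" if "z \<in> lits ?A'" for z using zx[OF that] by (auto simp: res_def)
    have r2: "res x {x} = UNIV" "res x {neg x} = {}" by (auto simp: res_def)
    have "(\<Sum>z\<in>lits A. h (res x {z})) = (\<Sum>z\<in>lits ?A'. h {z}) + (h UNIV + h {})"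
      unfolding L using fL Ld r1 by (simp add: sum.union_disjoint r2)
    moreover have c3: "real (card (lits ?A')) = 2 * (?n - 1)" by (simp add: card_lits rA')
    moreover have c4: "real (card (lits A)) = 2 * ?n" by (simp add: card_lits)
    moreover have "(Y + (Z + W)) / (2 * N) = (1 - 1 / N) * (Y / (2 * (N - 1))) + 1 / (2 * N) * W + 1 / (2 * N) * Z"
      if "N \<ge> 3" for Y Z W N :: real
    proof -
      define a where "a = N - 1"
      have ab: "a > 0" "N > 0" "1 - 1 / N = a / N" using that by (auto simp: a_def field_simps)
      show ?thesis unfolding ab(3) a_def[symmetric] using ab(1-2) by (simp add: field_simps)
    qed
    ultimately show ?thesis using n 2 by (simp add: kernel_def gen_simps avg_units)
  next
    case 3
    then show ?thesis by (simp add: kernel_def gen_def res_def)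
  next
    case 4
    then show ?thesis by (simp add: kernel_def gen_def res_def)
  qed
qed

lemma mean_res:
  assumes A: "finite A" "card A \<ge> 3" and x: "fst x \<in> A"
  shows "mean A ts (\<lambda>F. h (map (res x) F)) = trans_op (real (card A)) ts (\<lambda>ts'. mean (A - {fst x}) ts' h)"
proof (induction ts arbitrary: h)
  case (Cons \<tau> ts)
  let ?g = "\<lambda>C. trans_op (real (card A)) ts (\<lambda>ts'. mean (A - {fst x}) ts' (\<lambda>F. h (C # F)))"
  have "mean A (\<tau> # ts) (\<lambda>F. h (map (res x) F)) = avg (gen A \<tau>) (\<lambda>C. ?g (res x C))"
    using Cons[of "\<lambda>F. h (res x _ # F)"] by simp
  also have "\<dots> = kernel (real (card A)) \<tau> (\<lambda>\<tau>'. avg (gen (A - {fst x}) \<tau>') ?g)"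
    by (rule avg_res[OF A x])
  also have "\<dots> = trans_op (real (card A)) (\<tau> # ts) (\<lambda>ts'. mean (A - {fst x}) ts' h)"
    by (simp add: trans_op_avg)
  finally show ?case .
qed simp

lemma mean_unit:
  "mean A (ts1 @ 1 # ts2) h = (\<Sum>z\<in>lits A. mean A (ts1 @ 3 # ts2) (\<lambda>F. h (F[length ts1 := {z}]))) / real (card (lits A))"
proof (induction ts1 arbitrary: h)
  case Nil
  then show ?case using avg_units[of A "\<lambda>C. mean A ts2 (\<lambda>F. h (C # F))"] by (simp add: gen_def)
next
  case (Cons \<tau> ts1)
  have "mean A ((\<tau> # ts1) @ 1 # ts2) h = avg (gen A \<tau>) (\<lambda>C. (\<Sum>z\<in>lits A. mean A (ts1 @ 3 # ts2) (\<lambda>F. h (C # F[length ts1 := {z}]))) / real (card (lits A)))"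
    using Cons[of "\<lambda>F. h (_ # F)"] by simp
  also have "\<dots> = (\<Sum>z\<in>lits A. avg (gen A \<tau>) (\<lambda>C. mean A (ts1 @ 3 # ts2) (\<lambda>F. h (C # F[length ts1 := {z}])))) / real (card (lits A))"
    by (simp add: avg_divide avg_sum)
  finally show ?case by simp
qed

lemma deficit_res: "deficit F \<le> deficit (map (res x) F)"
proof (rule deficit_mono)
  fix \<sigma>
  define \<sigma>' where "\<sigma>' = \<sigma>(fst x := snd x)"
  have cl: "clause_sat \<sigma>' C" if sat: "clause_sat \<sigma> (res x C)" for C
  proof (cases "x \<in> C")
    case True
    then show ?thesis by (auto simp: clause_sat_iff lit_true_def \<sigma>'_def)
  next
    case False
    then obtain z where z: "z \<in> C" "z \<noteq> neg x" "lit_true \<sigma> z" using sat by (auto simp: clause_sat_iff res_def)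
    then have "fst z \<noteq> fst x" using same_var_cases[of z x] False by blast
    then have "lit_true \<sigma>' z" using z by (simp add: lit_true_def \<sigma>'_def)
    then show ?thesis using z by (auto simp: clause_sat_iff)
  qed
  have "num_unsat \<sigma>' F \<le> num_unsat \<sigma> (map (res x) F)"
  proof (induction F)
    case (Cons C F)
    then show ?case using cl[of C] by auto
  qed simp
  then show "\<exists>\<sigma>'. num_unsat \<sigma>' F \<le> num_unsat \<sigma> (map (res x) F)" by blast
qed

text \<open>Setting the literal of a unit clause satisfies that clause, so its code becomes 3 before
  the others make their transition. The choice of the unit clause is left open.\<close>

definition relax :: "nat list \<Rightarrow> nat list \<Rightarrow> bool" where
  "relax ts ts' \<longleftrightarrow> (if 1 \<in> set ts then \<exists>us vs. ts = us @ 1 # vs \<and> ts' = us @ 3 # vs else ts' = ts)"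

lemma ex_relax: "\<exists>ts'. relax ts ts'"
  using split_list[of 1 ts] by (auto simp: relax_def)

text \<open>One step of the unit clause algorithm: satisfy the first unit clause, or assign an arbitrary
  variable if there is none.\<close>

lemma mean_unit_step:
  assumes A: "finite A" "card A \<ge> 3" and \<phi>: "mono \<phi>" and r: "relax ts ts'"
    and le: "\<And>x ts. x \<in> A \<Longrightarrow> mean (A - {x}) ts (\<lambda>F. \<phi> (deficit F)) \<le> \<Phi> ts"
  shows "mean A ts (\<lambda>F. \<phi> (deficit F)) \<le> trans_op (real (card A)) ts' \<Phi>"
proof -
  have n: "real (card A) \<ge> 2" using A by simp
  have lits_ne: "lits A \<noteq> {}" "card (lits A) > 0" using A by (auto simp: lits_def card_lits)
  have key: "mean A us (\<lambda>F. \<phi> (deficit (map (res z) F))) \<le> trans_op (real (card A)) us \<Phi>" if "z \<in> lits A" for z us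
    using mean_res[OF A, of z us "\<lambda>F. \<phi> (deficit F)"] that le
    by (auto simp: lits_iff intro!: trans_op_mono n)
  show ?thesis
  proof (cases "1 \<in> set ts")
    case False
    obtain z where z: "z \<in> lits A" using lits_ne by blast
    have "mean A ts (\<lambda>F. \<phi> (deficit F)) \<le> mean A ts (\<lambda>F. \<phi> (deficit (map (res z) F)))"
      by (intro mean_mono monoD[OF \<phi>] deficit_res)
    then show ?thesis using key[OF z, of ts] r False by (simp add: relax_def)
  next
    case True
    then obtain us vs where ts: "ts = us @ 1 # vs" "ts' = us @ 3 # vs" using r by (auto simp: relax_def)
    have each: "mean A ts' (\<lambda>F. \<phi> (deficit (F[length us := {z}]))) \<le> trans_op (real (card A)) ts' \<Phi>" if z: "z \<in> lits A" for z
    proof -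
      have "mean A ts' (\<lambda>F. \<phi> (deficit (F[length us := {z}]))) \<le> mean A ts' (\<lambda>F. \<phi> (deficit (map (res z) F)))"
      proof (rule mean_mono)
        fix F assume F: "list_all2 (\<lambda>C \<tau>. C \<in> gen A \<tau>) F ts'"
        have len: "length us < length F" using list_all2_lengthD[OF F] ts by simp
        have "F ! length us \<in> gen A (ts' ! length us)" using list_all2_nthD[OF F len] .
        then have U: "F ! length us = UNIV" by (simp add: ts gen_def)
        \<comment> \<open>\<open>res z\<close> sends both the unit clause of \<open>z\<close> and
          the placeholder \<open>UNIV\<close> to \<open>UNIV\<close>.\<close>
        have "map (res z) (F[length us := {z}]) = map (res z) F"
          using len U by (intro nth_equalityI) (auto simp: nth_list_update res_def)
        then have "deficit (F[length us := {z}]) \<le> deficit (map (res z) F)" using deficit_res by metis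
        then show "\<phi> (deficit (F[length us := {z}])) \<le> \<phi> (deficit (map (res z) F))" using \<phi> by (auto dest: monoD)
      qed
      then show ?thesis using key[OF z, of ts'] by simp
    qed
    have "mean A ts (\<lambda>F. \<phi> (deficit F)) = (\<Sum>z\<in>lits A. mean A ts' (\<lambda>F. \<phi> (deficit (F[length us := {z}])))) / real (card (lits A))"
      unfolding ts by (rule mean_unit)
    also have "\<dots> \<le> (\<Sum>z\<in>lits A. trans_op (real (card A)) ts' \<Phi>) / real (card (lits A))"
      using each by (intro divide_right_mono sum_mono) auto
    also have "\<dots> = trans_op (real (card A)) ts' \<Phi>" using lits_ne by simp
    finally show ?thesis .
  qed
qed

lemma deficit_shift:
  assumes "\<And>\<sigma>. num_unsat \<sigma> G = c + num_unsat \<sigma> F"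
  shows "deficit G = c + deficit F"
proof (rule antisym)
  obtain \<sigma> where "num_unsat \<sigma> F = deficit F" using deficit_attained by blast
  then show "deficit G \<le> c + deficit F" using deficit_le[of G \<sigma>] assms by simp
  obtain \<sigma> where "num_unsat \<sigma> G = deficit G" using deficit_attained by blast
  then show "c + deficit F \<le> deficit G" using deficit_le[of F \<sigma>] assms[of \<sigma>] by simp
qed

text \<open>Empty clauses count 1 each and satisfied ones 0, so only the 2-clauses stay random.
  \<open>G\<close> collects those already passed, as the deficit is not additive along the
  list.\<close>

lemma mean_no_units:
  assumes "1 \<notin> set ts"
  shows "mean A ts (\<lambda>F. \<psi> (deficit (G @ F))) =
    mean A (replicate (count_list ts 2) 2) (\<lambda>F. \<psi> (count_list ts 0 + deficit (G @ F)))"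
  using assms
proof (induction ts arbitrary: G \<psi>)
  case (Cons \<tau> ts)
  consider "\<tau> = 2" | "\<tau> = 0" | "\<tau> \<notin> {0, 1, 2}" using Cons.prems by auto
  then show ?case
  proof cases
    case 1
    then show ?thesis using Cons.IH[of \<psi> "G @ [_]"] Cons.prems by simp
  next
    case 2
    have "deficit (G @ {} # F) = 1 + deficit (G @ F)" for F
      by (rule deficit_shift) (simp add: clause_sat_iff)
    then show ?thesis using 2 Cons.IH[of "\<lambda>d. \<psi> (Suc d)" G] Cons.prems by (simp add: gen_def)
  next
    case 3
    have "clause_sat \<sigma> UNIV" for \<sigma>
      unfolding clause_sat_iff by (rule bexI[of _ "(0, \<sigma> 0)"]) (simp_all add: lit_true_def)
    then have "deficit (G @ UNIV # F) = 0 + deficit (G @ F)" for F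
      by (intro deficit_shift) simp
    then show ?thesis using 3 Cons.IH[of \<psi> G] Cons.prems by (simp add: gen_def)
  qed
qed simp

lemma mean_replicate:
  assumes "finite A" "card A \<ge> 2"
  shows "mean A (replicate m 2) h = measure_pmf.expectation (random_cnf A m) h"
proof -
  have "card (clauses_on A) > 0" using assms by (simp add: card_clauses_on)
  then have cl: "clauses_on A \<noteq> {}" "finite (clauses_on A)" using card_gt_0_iff by blast+
  show ?thesis
  proof (induction m arbitrary: h)
    case 0
    then show ?case by (simp add: random_cnf_def)
  next
    case (Suc m)
    have fin: "finite (set_pmf (random_cnf A m))"
    proof (rule finite_subset[OF _ finite_lists_length_eq[OF cl(2), of m]])
      show "set_pmf (random_cnf A m) \<subseteq> {xs. set xs \<subseteq> clauses_on A \<and> length xs = m}"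
        using cl by (auto simp: random_cnf_def set_replicate_pmf)
    qed
    have "random_cnf A (Suc m) = pmf_of_set (clauses_on A) \<bind> (\<lambda>C. map_pmf (\<lambda>F. C # F) (random_cnf A m))"
      by (simp add: random_cnf_def map_pmf_def)
    then have "measure_pmf.expectation (random_cnf A (Suc m)) h =
        (\<Sum>C\<in>clauses_on A. measure_pmf.expectation (map_pmf (\<lambda>F. C # F) (random_cnf A m)) h /\<^sub>R real (card (clauses_on A)))"
      using cl fin by (simp add: pmf_expectation_bind_pmf_of_set)
    then show ?case
      using Suc by (simp add: gen_def avg_def sum_divide_distrib divide_inverse mult.commute sum_distrib_left)
  qed
qed

section \<open>Exponential weights and the potential\<close>

primrec weight :: "real \<Rightarrow> real \<Rightarrow> real \<Rightarrow> nat list \<Rightarrow> real" where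
  "weight \<alpha> \<beta> \<zeta> [] = 1"
| "weight \<alpha> \<beta> \<zeta> (\<tau> # ts) = (if \<tau> = 2 then \<alpha> else if \<tau> = 1 then \<beta> else if \<tau> = 0 then \<zeta> else 1) * weight \<alpha> \<beta> \<zeta> ts"

lemma weight_eq: "weight \<alpha> \<beta> \<zeta> ts = \<alpha> ^ count_list ts 2 * \<beta> ^ count_list ts 1 * \<zeta> ^ count_list ts 0"
  by (induction ts) auto

text \<open>Codes change independently, so a product over the clauses is mapped to a product over
  the clauses. The potentials below are built from such products.\<close>

lemma trans_op_weight:
  "trans_op n ts (weight \<alpha> \<beta> \<zeta>) =
    weight ((1 - 2 / n) * \<alpha> + 1 / n * \<beta> + 1 / n) ((1 - 1 / n) * \<beta> + 1 / (2 * n) * \<zeta> + 1 / (2 * n)) \<zeta> ts"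
  by (induction ts) (simp_all add: kernel_def trans_op_cmult algebra_simps)

lemma relax_counts:
  assumes "relax ts ts'"
  shows "count_list ts' 2 = count_list ts 2" "count_list ts' 0 = count_list ts 0"
    "count_list ts' 1 = count_list ts 1 - 1"
proof -
  have "count_list ts 1 = 0" if "1 \<notin> set ts" using that by (simp add: count_list_0_iff)
  then show "count_list ts' 2 = count_list ts 2" "count_list ts' 0 = count_list ts 0"
    "count_list ts' 1 = count_list ts 1 - 1"
    using assms by (auto simp: relax_def split: if_splits)
qed

lemma one_plus_power_le_exp: "0 \<le> 1 + x \<Longrightarrow> (1 + x) ^ m \<le> exp (real m * x)" for x :: real
  using power_mono[of "1 + x" "exp x" m] by (simp add: exp_of_nat_mult)

text \<open>The number \<open>k\<close> of assigned variables serves as time. While \<open>k < K1\<close>, the number \<open>u\<close> of unit clauses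
  behaves like a random walk with drift at most \<open>2 \<epsilon>\<close> that is reflected at \<open>0\<close>; for \<open>k \<ge> K1\<close> the drift is at most
  \<open>-2 \<epsilon>\<close>, and the algorithm stops as soon as \<open>u = 0\<close>. The function \<open>over\<close> bounds the probability that
  the \<open>2\<close>-clauses become too many, that \<open>u\<close> ever exceeds \<open>U\<close>, or that the algorithm runs up to time \<open>K\<close>.\<close>

locale supercritical =
  fixes n :: nat and \<epsilon> :: real
  assumes eps: "0 < \<epsilon>" "\<epsilon> \<le> 1 / 200" and big: "\<epsilon> ^ 3 * real n \<ge> 1000000"
begin

text \<open>By \<open>not_over\<close> the density of 2-clauses at time k is at most 1 + 2\<epsilon>
  - k/n, which is down to 1 - 2\<epsilon> at k = 4\<epsilon>n. During the first phase the potential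
  may gain 9\<epsilon>^2 per step in the exponent, 36 \<epsilon>^3 n in all; the 50 in
  \<open>H\<close> outweighs this.\<close>

definition K1 :: nat where "K1 = nat \<lceil>4 * \<epsilon> * real n\<rceil>"
definition H :: nat where "H = nat \<lceil>50 * \<epsilon> * real n\<rceil>"
definition K :: nat where "K = K1 + H"
definition U :: real where "U = \<epsilon> * real H"
definition rem :: "nat \<Rightarrow> real" where "rem k = real n - real k"
text \<open>\<open>r k / r 0\<close> is the probability that a 2-clause is untouched after k
  assignments. The number m of untouched 2-clauses is thus binomial with exponential martingale
  \<open>(1 + Y / r k) ^ m\<close>, and \<open>B\<close> is the level that it reaches if there are
  too many.\<close>

definition r :: "nat \<Rightarrow> real" where "r k = rem k * (rem k - 1)"
definition Y :: real where "Y = \<epsilon> / 16 * r 0"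
definition B :: real where "B = exp (\<epsilon> / 16 * real n * (1 + 3 * \<epsilon> / 2))"

text \<open>For k < \<open>K1\<close> the walk u is reflected at 0; the even convex function exp
  (\<epsilon>u) + exp (-\<epsilon>u) gains only a factor exp (9\<epsilon>^2) per step nevertheless.
  Afterwards exp (\<epsilon>u) loses a factor exp (-\<epsilon>^2) per step: the first summand
  reaches 1 at k = \<open>K\<close>, the second one at u \<ge> \<open>U\<close>, because \<epsilon>
  U = \<epsilon>^2 H. At k = \<open>K1\<close> both coefficients are exp (-\<epsilon>^2 H), whence
  the factor 2 of the first phase.\<close>

definition walk :: "nat \<Rightarrow> nat \<Rightarrow> real" where
  "walk k u = (if k < K1 then 2 * exp (- (\<epsilon>\<^sup>2 * real H)) * exp (9 * \<epsilon>\<^sup>2 * (real K1 - real k)) * (exp \<epsilon> ^ u + exp (- \<epsilon>) ^ u)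
     else (exp (- (\<epsilon>\<^sup>2 * (real K - real k))) + exp (- (\<epsilon>\<^sup>2 * real H))) * exp \<epsilon> ^ u)"

definition over :: "nat \<Rightarrow> nat \<Rightarrow> nat \<Rightarrow> real" where
  "over k m u = (1 + Y / r k) ^ m / B + walk k u"

abbreviation x :: real where "x \<equiv> \<epsilon> ^ 3 * real n"

lemma x_eq: "x = \<epsilon> * (\<epsilon>\<^sup>2 * real n)"
  by (simp add: power2_eq_square power3_eq_cube)

lemma sizes: "\<epsilon>\<^sup>2 * real n \<ge> 200 * x" "\<epsilon> * real n \<ge> 200 * (\<epsilon>\<^sup>2 * real n)" "real n \<ge> 200 * (\<epsilon> * real n)"
proof -
  have *: "200 * (\<epsilon> * y) \<le> y" if "y \<ge> 0" for y
    using mult_right_mono[OF eps(2) that] by simp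
  show "\<epsilon>\<^sup>2 * real n \<ge> 200 * x" using *[of "\<epsilon>\<^sup>2 * real n"] by (simp add: x_eq)
  show "\<epsilon> * real n \<ge> 200 * (\<epsilon>\<^sup>2 * real n)" using *[of "\<epsilon> * real n"] eps by (simp add: power2_eq_square mult.assoc)
  show "real n \<ge> 200 * (\<epsilon> * real n)" using *[of "real n"] by simp
qed

lemma en: "\<epsilon> * real n \<ge> 1000000"
  using sizes big by linarith

lemma K_bounds: "4 * \<epsilon> * real n \<le> real K1" "real K1 \<le> 4 * \<epsilon> * real n + 1" "50 * \<epsilon> * real n \<le> real H"
  "real H \<le> 50 * \<epsilon> * real n + 1" "real K = real K1 + real H" "real K \<le> 55 * (\<epsilon> * real n)" "real K \<le> real n / 3" "0 < K1"
proof -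
  have c: "z \<le> real (nat \<lceil>z\<rceil>) \<and> real (nat \<lceil>z\<rceil>) \<le> z + 1" if "z \<ge> 0" for z :: real
    using that by linarith
  have p: "4 * \<epsilon> * real n \<ge> 0" "50 * \<epsilon> * real n \<ge> 0" using en by linarith+
  show *: "4 * \<epsilon> * real n \<le> real K1" "real K1 \<le> 4 * \<epsilon> * real n + 1" "50 * \<epsilon> * real n \<le> real H"
    "real H \<le> 50 * \<epsilon> * real n + 1"
    using c[OF p(1)] c[OF p(2)] by (simp_all only: K1_def H_def)
  show **: "real K = real K1 + real H" by (simp add: K_def)
  show "real K \<le> 55 * (\<epsilon> * real n)" using * ** en by linarith
  then show "real K \<le> real n / 3" using sizes(3) by linarith
  have "real K1 > 0" using * en by linarith
  then show "0 < K1" by simp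
qed

lemma U_bounds: "50 * (\<epsilon>\<^sup>2 * real n) \<le> U" "U \<le> 51 * (\<epsilon>\<^sup>2 * real n)"
proof -
  have "\<epsilon> * (50 * \<epsilon> * real n) \<le> U" unfolding U_def using K_bounds eps by (intro mult_left_mono) auto
  then show "50 * (\<epsilon>\<^sup>2 * real n) \<le> U" by (simp add: power2_eq_square mult_ac)
  have "U \<le> \<epsilon> * (51 * (\<epsilon> * real n))" unfolding U_def using K_bounds(4) eps en by (intro mult_left_mono) auto
  then show "U \<le> 51 * (\<epsilon>\<^sup>2 * real n)" by (simp add: power2_eq_square mult_ac)
qed

lemma rem_bounds: "k \<le> K \<Longrightarrow> rem k \<ge> 2 / 3 * real n" "rem k \<le> real n" "real n \<ge> 1000000"
proof -
  show "real n \<ge> 1000000" using en sizes(3) by linarith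
  show "rem k \<le> real n" by (simp add: rem_def)
  show "rem k \<ge> 2 / 3 * real n" if "k \<le> K"
  proof -
    have "real k \<le> real K" using that by simp
    then show ?thesis using K_bounds(7) by (simp add: rem_def)
  qed
qed

lemma r_pos: "k \<le> K \<Longrightarrow> r k > 0" and r_half: "k \<le> K \<Longrightarrow> r 0 \<le> 3 * r k"
proof -
  assume k: "k \<le> K"
  have b: "rem k \<ge> 2 / 3 * real n" "real n \<ge> 1000000" using rem_bounds(1)[OF k] rem_bounds(3) by auto
  then show "r k > 0" unfolding r_def by (intro mult_pos_pos) linarith+
  have "(2 / 3 * real n) * (1 / 2 * real n) \<le> r k" unfolding r_def using b by (intro mult_mono) linarith+
  moreover have "r 0 \<le> real n * real n" unfolding r_def rem_def using b by (intro mult_mono) auto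
  ultimately show "r 0 \<le> 3 * r k" by simp
qed

lemma Y_pos: "Y > 0"
  using r_pos[of 0] eps by (simp add: Y_def)

lemma walk_nonneg: "walk k u \<ge> 0"
  by (simp add: walk_def)

text \<open>Each part of \<open>over\<close> is at least 1 once its own failure occurs, so
  \<open>over < 1\<close> excludes all of them at the same time.\<close>

lemma not_over:
  assumes k: "k \<le> K" and o: "over k m u < 1"
  shows "real u < U" "k < K" "real m \<le> (1 + 2 * \<epsilon> - real k / real n) * rem k"
proof -
  have t1: "(1 + Y / r k) ^ m / B < 1" and t2: "walk k u < 1"
  proof -
    have "0 \<le> (1 + Y / r k) ^ m / B" using Y_pos r_pos[OF k] by (simp add: B_def)
    then show "(1 + Y / r k) ^ m / B < 1" "walk k u < 1"
      using o walk_nonneg[of k u] unfolding over_def by linarith+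
  qed
  show "real u < U"
  proof (rule ccontr)
    assume "\<not> real u < U"
    then have "\<epsilon> * U \<le> \<epsilon> * real u" using eps by (intro mult_left_mono) auto
    then have "exp (\<epsilon>\<^sup>2 * real H) \<le> exp \<epsilon> ^ u"
      by (simp add: U_def power2_eq_square exp_of_nat_mult[symmetric] mult_ac)
    then have "exp (- (\<epsilon>\<^sup>2 * real H)) * exp (\<epsilon>\<^sup>2 * real H) \<le> exp (- (\<epsilon>\<^sup>2 * real H)) * exp \<epsilon> ^ u"
      by (intro mult_left_mono) auto
    then have ge: "1 \<le> exp (- (\<epsilon>\<^sup>2 * real H)) * exp \<epsilon> ^ u" by (simp add: exp_minus)
    show False
    proof (cases "k < K1")
      case True
      have "1 * 1 \<le> (exp (- (\<epsilon>\<^sup>2 * real H)) * exp \<epsilon> ^ u) * exp (9 * \<epsilon>\<^sup>2 * (real K1 - real k))"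
        using ge True by (intro mult_mono) auto
      also have "\<dots> \<le> walk k u" using True by (simp add: walk_def algebra_simps)
      finally show False using t2 by simp
    next
      case False
      have "exp (- (\<epsilon>\<^sup>2 * real H)) * exp \<epsilon> ^ u \<le> walk k u" using False by (simp add: walk_def algebra_simps)
      then show False using t2 ge by simp
    qed
  qed
  show "k < K"
  proof (rule ccontr)
    assume "\<not> k < K"
    then have "k = K" using k by simp
    then have w: "walk k u = (1 + exp (- (\<epsilon>\<^sup>2 * real H))) * exp \<epsilon> ^ u" using K_def by (simp add: walk_def)
    have "1 * 1 \<le> (1 + exp (- (\<epsilon>\<^sup>2 * real H))) * exp \<epsilon> ^ u" using eps by (intro mult_mono) auto
    then show False using t2 w by simp
  qed
  show "real m \<le> (1 + 2 * \<epsilon> - real k / real n) * rem k"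
  proof -
    define y where "y = Y / r k"
    have n: "real n \<ge> 1000000" by (rule rem_bounds)
    have y: "0 < y" "y \<le> \<epsilon> / 5"
    proof -
      show "0 < y" using Y_pos r_pos[OF k] by (simp add: y_def)
      have "Y \<le> \<epsilon> / 16 * (3 * r k)" unfolding Y_def using r_half[OF k] eps by (intro mult_left_mono) auto
      then have "y \<le> 3 * \<epsilon> / 16" using r_pos[OF k] by (simp add: y_def divide_le_eq)
      then show "y \<le> \<epsilon> / 5" using eps by simp
    qed
    have "(1 + y) ^ m < B" using t1 by (simp add: y_def B_def)
    then have "ln ((1 + y) ^ m) < ln B" using y by (subst ln_less_cancel_iff) (auto simp: B_def)
    then have "real m * ln (1 + y) < \<epsilon> / 16 * real n * (1 + 3 * \<epsilon> / 2)" using y by (simp add: ln_realpow B_def)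
    \<comment> \<open>With y \<le> \<epsilon>/5 the quadratic loss in ln (1 + y) \<ge> y - y^2 is
      covered by the difference between 2\<epsilon> here and 3\<epsilon>/2 in
      \<open>B\<close>.\<close>
    moreover have "real m * (y - y\<^sup>2) \<le> real m * ln (1 + y)"
      using y eps by (intro mult_left_mono ln_one_plus_pos_lower_bound) auto
    ultimately have "real m * (y * (1 - y)) \<le> \<epsilon> / 16 * real n * (1 + 3 * \<epsilon> / 2)"
      by (simp add: power2_eq_square algebra_simps)
    also have "\<dots> \<le> \<epsilon> / 16 * real n * ((1 + 2 * \<epsilon>) * (1 - y))"
    proof (intro mult_left_mono)
      have "(1 + 2 * \<epsilon>) * (1 - \<epsilon> / 5) \<le> (1 + 2 * \<epsilon>) * (1 - y)" using y eps by (intro mult_left_mono) auto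
      moreover have "(1 + 2 * \<epsilon>) * (1 - \<epsilon> / 5) = 1 + 3 * \<epsilon> / 2 + \<epsilon> * (3 / 10 - 2 * \<epsilon> / 5)" by (simp add: algebra_simps)
      moreover have "0 \<le> \<epsilon> * (3 / 10 - 2 * \<epsilon> / 5)" using eps by (intro mult_nonneg_nonneg) auto
      ultimately show "1 + 3 * \<epsilon> / 2 \<le> (1 + 2 * \<epsilon>) * (1 - y)" by linarith
    qed (use eps in auto)
    also have "\<dots> = (1 - y) * (\<epsilon> / 16 * real n * (1 + 2 * \<epsilon>))" by (simp only: mult_ac)
    also have "real m * (y * (1 - y)) = (1 - y) * (real m * y)" by (simp only: mult_ac)
    finally have "(1 - y) * (real m * y) \<le> (1 - y) * (\<epsilon> / 16 * real n * (1 + 2 * \<epsilon>))" .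
    then have my: "real m * y \<le> \<epsilon> / 16 * real n * (1 + 2 * \<epsilon>)" by (rule mult_left_le_imp_le) (use y eps in auto)
    have "y = \<epsilon> / 16 * (r 0 / r k)" by (simp add: y_def Y_def)
    then have "\<epsilon> / 16 * (real m * (r 0 / r k)) \<le> \<epsilon> / 16 * (real n * (1 + 2 * \<epsilon>))" using my by (simp add: mult_ac)
    then have "real m * (r 0 / r k) \<le> real n * (1 + 2 * \<epsilon>)" by (rule mult_left_le_imp_le) (use eps in auto)
    then have m1: "real m * r 0 \<le> real n * (1 + 2 * \<epsilon>) * r k" using r_pos[OF k] by (simp add: divide_le_eq)
    \<comment> \<open>That is, \<open>r k / r 0\<close> is at most the square of
      \<open>rem k / n\<close>.\<close>
    have "r k * real n \<le> rem k * rem k * (real n - 1)"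
    proof -
      have "(rem k - 1) * real n \<le> rem k * (real n - 1)" using rem_bounds(2)[of k] by (simp add: algebra_simps)
      then have "rem k * ((rem k - 1) * real n) \<le> rem k * (rem k * (real n - 1))"
        using rem_bounds(1)[OF k] n by (intro mult_left_mono) auto
      then show ?thesis by (simp add: r_def mult_ac)
    qed
    then have "(1 + 2 * \<epsilon>) * (r k * real n) \<le> (1 + 2 * \<epsilon>) * (rem k * rem k * (real n - 1))"
      using eps by (intro mult_left_mono) auto
    then have "real m * (real n * (real n - 1)) \<le> (1 + 2 * \<epsilon>) * (rem k * rem k * (real n - 1))"
      using m1 by (simp add: r_def rem_def mult_ac)
    then have "(real n - 1) * (real m * real n) \<le> (real n - 1) * ((1 + 2 * \<epsilon>) * (rem k * rem k))" by (simp add: mult_ac)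
    then have m2: "real m * real n \<le> (1 + 2 * \<epsilon>) * (rem k * rem k)" by (rule mult_left_le_imp_le) (use n in auto)
    have e: "rem k / real n = 1 - real k / real n" using n by (simp add: rem_def diff_divide_distrib)
    have "real m \<le> (1 + 2 * \<epsilon>) * (rem k * rem k) / real n" using m2 n by (simp add: le_divide_eq)
    also have "\<dots> = (1 + 2 * \<epsilon>) * (1 - real k / real n) * rem k" by (simp flip: e)
    also have "\<dots> \<le> (1 + 2 * \<epsilon> - real k / real n) * rem k"
    proof (rule mult_right_mono)
      have "0 \<le> 2 * \<epsilon> * (real k / real n)" using eps by simp
      then show "(1 + 2 * \<epsilon>) * (1 - real k / real n) \<le> 1 + 2 * \<epsilon> - real k / real n" by (simp add: algebra_simps)
      show "0 \<le> rem k" using rem_bounds(1)[OF k] n by linarith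
    qed
    finally show ?thesis .
  qed
qed

text \<open>\<open>survive \<zeta> k\<close> is the probability that a unit clause is not violated if \<open>\<zeta> = 0\<close>, and \<open>1\<close> if \<open>\<zeta> = 1\<close>.\<close>

definition survive :: "real \<Rightarrow> nat \<Rightarrow> real" where
  "survive \<zeta> k = 1 - (1 - \<zeta>) / (2 * rem k)"

definition unit_factor :: "real \<Rightarrow> nat \<Rightarrow> real \<Rightarrow> real" where
  "unit_factor \<zeta> k \<beta> = (1 - 1 / rem k) * \<beta> + 1 / (2 * rem k) * \<zeta> + 1 / (2 * rem k)"

lemma exp_eps: "exp \<epsilon> \<le> 1 + \<epsilon> + \<epsilon>\<^sup>2" "exp (- \<epsilon>) \<le> 1 - \<epsilon> + \<epsilon>\<^sup>2"
proof -
  show "exp \<epsilon> \<le> 1 + \<epsilon> + \<epsilon>\<^sup>2" using eps by (intro exp_bound) auto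
  have "1 \<le> (1 - \<epsilon> + \<epsilon>\<^sup>2) * (1 + \<epsilon>)"
  proof -
    have "(1 - \<epsilon> + \<epsilon>\<^sup>2) * (1 + \<epsilon>) = 1 + \<epsilon> ^ 3" by (simp add: algebra_simps power2_eq_square power3_eq_cube)
    then show ?thesis using eps by simp
  qed
  also have "\<dots> \<le> (1 - \<epsilon> + \<epsilon>\<^sup>2) * exp \<epsilon>" using eps by (intro mult_left_mono) (auto intro: add_nonneg_nonneg)
  finally show "exp (- \<epsilon>) \<le> 1 - \<epsilon> + \<epsilon>\<^sup>2" by (simp add: exp_minus field_simps)
qed

section \<open>One-step estimates for the number of unit clauses\<close>

context
  fixes k m u :: nat and \<zeta> :: real
  assumes k: "k \<le> K" and u: "real u < U" and \<zeta>: "0 \<le> \<zeta>" "\<zeta> \<le> 1"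
begin

lemma survive_bounds: "1 / 2 \<le> survive \<zeta> k" "survive \<zeta> k \<le> 1" "rem k > 1"
proof -
  have R: "rem k \<ge> 600000" using rem_bounds(1)[OF k] rem_bounds(3) by linarith
  then show "rem k > 1" by simp
  have "(1 - \<zeta>) / (2 * rem k) \<le> 1 / 2" using R \<zeta> by (simp add: divide_le_eq)
  then show "1 / 2 \<le> survive \<zeta> k" by (simp add: survive_def)
  show "survive \<zeta> k \<le> 1" using R \<zeta> by (simp add: survive_def)
qed

lemma plus_factor:
  "(1 + (exp \<epsilon> - 1) / rem k) ^ m * unit_factor \<zeta> k (exp \<epsilon>) ^ (u - 1)
    \<le> survive \<zeta> k ^ (u - 1) * exp (\<epsilon> * real (u - 1) + real m / rem k * (\<epsilon> + \<epsilon>\<^sup>2))"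
proof -
  note R = survive_bounds(3)
  have E: "exp \<epsilon> \<ge> 1" using eps by simp
  have "(1 + (exp \<epsilon> - 1) / rem k) ^ m \<le> exp (real m * ((exp \<epsilon> - 1) / rem k))"
    using R E by (intro one_plus_power_le_exp) (simp add: add_nonneg_nonneg)
  also have "\<dots> \<le> exp (real m / rem k * (\<epsilon> + \<epsilon>\<^sup>2))"
  proof -
    have "real m / rem k * (exp \<epsilon> - 1) \<le> real m / rem k * (\<epsilon> + \<epsilon>\<^sup>2)"
      using R exp_eps(1) by (intro mult_left_mono) auto
    then show ?thesis by simp
  qed
  finally have 1: "(1 + (exp \<epsilon> - 1) / rem k) ^ m \<le> exp (real m / rem k * (\<epsilon> + \<epsilon>\<^sup>2))" .
  have "unit_factor \<zeta> k (exp \<epsilon>) \<le> survive \<zeta> k * exp \<epsilon>"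
  proof -
    have "survive \<zeta> k * exp \<epsilon> - unit_factor \<zeta> k (exp \<epsilon>) = (1 + \<zeta>) / (2 * rem k) * (exp \<epsilon> - 1)"
      using R by (simp add: survive_def unit_factor_def field_simps)
    also have "\<dots> \<ge> 0" using R \<zeta> E by simp
    finally show ?thesis by simp
  qed
  moreover have "0 \<le> unit_factor \<zeta> k (exp \<epsilon>)" using R \<zeta> by (simp add: unit_factor_def)
  ultimately have "unit_factor \<zeta> k (exp \<epsilon>) ^ (u - 1) \<le> (survive \<zeta> k * exp \<epsilon>) ^ (u - 1)" by (intro power_mono)
  also have "\<dots> = survive \<zeta> k ^ (u - 1) * exp (\<epsilon> * real (u - 1))"
    by (simp add: power_mult_distrib exp_of_nat_mult[symmetric] mult.commute)
  finally have 2: "unit_factor \<zeta> k (exp \<epsilon>) ^ (u - 1) \<le> survive \<zeta> k ^ (u - 1) * exp (\<epsilon> * real (u - 1))" .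
  have "(1 + (exp \<epsilon> - 1) / rem k) ^ m * unit_factor \<zeta> k (exp \<epsilon>) ^ (u - 1)
    \<le> exp (real m / rem k * (\<epsilon> + \<epsilon>\<^sup>2)) * (survive \<zeta> k ^ (u - 1) * exp (\<epsilon> * real (u - 1)))"
    using 1 2 \<open>0 \<le> unit_factor \<zeta> k (exp \<epsilon>)\<close> by (intro mult_mono) auto
  then show ?thesis by (simp add: exp_add mult_ac)
qed

text \<open>Old unit clauses that contain the assigned variable disappear, which increases exp
  (-\<epsilon>u). This is the factor 1 + \<delta> per clause with \<delta> of order \<epsilon>/n;
  fewer than \<open>U\<close> \<le> 51 \<epsilon>^2 n clauses cost exp (O(\<epsilon>^3)) together,
  which is at most exp (2\<epsilon>^2) as \<epsilon> \<le> 1/200.\<close>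

lemma minus_factor:
  "(1 + (exp (- \<epsilon>) - 1) / rem k) ^ m * unit_factor \<zeta> k (exp (- \<epsilon>)) ^ (u - 1)
    \<le> survive \<zeta> k ^ (u - 1) * exp (- (\<epsilon> * real (u - 1)) - real m / rem k * (\<epsilon> - \<epsilon>\<^sup>2) + 2 * \<epsilon>\<^sup>2)"
proof -
  note R = survive_bounds(3)
  note s = survive_bounds(1,2)
  define E where "E = exp (- \<epsilon>)"
  have E: "0 < E" "E \<le> 1" "E \<le> 1 - \<epsilon> + \<epsilon>\<^sup>2" "exp \<epsilon> * E = 1"
    using eps exp_eps(2) by (simp_all add: E_def flip: exp_add)
  have "0 \<le> 1 + (E - 1) / rem k" using R E by (simp add: field_simps)
  then have "(1 + (E - 1) / rem k) ^ m \<le> exp (real m * ((E - 1) / rem k))"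
    by (rule one_plus_power_le_exp)
  also have "\<dots> \<le> exp (- (real m / rem k * (\<epsilon> - \<epsilon>\<^sup>2)))"
  proof -
    have "real m * ((E - 1) / rem k) = real m / rem k * (E - 1)" by simp
    also have "\<dots> \<le> real m / rem k * (- (\<epsilon> - \<epsilon>\<^sup>2))"
      using R E(3) by (intro mult_left_mono) auto
    also have "\<dots> = - (real m / rem k * (\<epsilon> - \<epsilon>\<^sup>2))" by (rule mult_minus_right)
    finally show ?thesis by (simp only: exp_le_cancel_iff)
  qed
  finally have 1: "(1 + (E - 1) / rem k) ^ m \<le> exp (- (real m / rem k * (\<epsilon> - \<epsilon>\<^sup>2)))" .
  define \<delta> where "\<delta> = 2 * (exp \<epsilon> - 1) / rem k"
  have \<delta>: "0 \<le> \<delta>" using R eps by (simp add: \<delta>_def)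
  have "unit_factor \<zeta> k E \<le> survive \<zeta> k * E * (1 + \<delta>)"
  proof -
    have "survive \<zeta> k * E * (1 + \<delta>) - unit_factor \<zeta> k E = survive \<zeta> k * E * \<delta> - (1 + \<zeta>) / (2 * rem k) * (1 - E)"
      using R by (simp add: survive_def unit_factor_def field_simps)
    moreover have "E * \<delta> = 2 * (1 - E) / rem k" using E(4) R by (simp add: \<delta>_def field_simps)
    then have "survive \<zeta> k * E * \<delta> = survive \<zeta> k * (2 * (1 - E) / rem k)" by (simp only: mult.assoc)
    moreover have "1 / 2 * (2 * (1 - E) / rem k) \<le> survive \<zeta> k * (2 * (1 - E) / rem k)"
      using s E R by (intro mult_right_mono) auto
    moreover have "(1 + \<zeta>) / (2 * rem k) * (1 - E) \<le> 2 / (2 * rem k) * (1 - E)"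
      using \<zeta> R E by (intro mult_right_mono divide_right_mono) auto
    moreover have "1 / 2 * (2 * (1 - E) / rem k) = 2 / (2 * rem k) * (1 - E)" using R by (simp add: field_simps)
    ultimately show ?thesis by linarith
  qed
  moreover have u0: "0 \<le> unit_factor \<zeta> k E" using R \<zeta> E by (simp add: unit_factor_def)
  ultimately have "unit_factor \<zeta> k E ^ (u - 1) \<le> (survive \<zeta> k * E * (1 + \<delta>)) ^ (u - 1)" by (intro power_mono)
  also have "\<dots> = survive \<zeta> k ^ (u - 1) * exp (- (\<epsilon> * real (u - 1))) * (1 + \<delta>) ^ (u - 1)"
    by (simp add: power_mult_distrib E_def exp_of_nat_mult[symmetric] mult.commute)
  also have "\<dots> \<le> survive \<zeta> k ^ (u - 1) * exp (- (\<epsilon> * real (u - 1))) * exp (2 * \<epsilon>\<^sup>2)"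
  proof (rule mult_left_mono)
    have "(1 + \<delta>) ^ (u - 1) \<le> exp (real (u - 1) * \<delta>)" using \<delta> by (intro one_plus_power_le_exp) auto
    also have "\<dots> \<le> exp (2 * \<epsilon>\<^sup>2)"
    proof -
      have "\<epsilon>\<^sup>2 \<le> \<epsilon> * (1 / 200)" unfolding power2_eq_square using eps by (intro mult_left_mono) auto
      then have "2 * (exp \<epsilon> - 1) \<le> 2 * (\<epsilon> + \<epsilon> * (1 / 200))" using exp_eps(1) by simp
      also have "\<dots> \<le> 21 / 10 * \<epsilon>" using eps by simp
      finally have "2 * (exp \<epsilon> - 1) \<le> 21 / 10 * \<epsilon>" .
      then have "\<delta> \<le> 21 / 10 * \<epsilon> / (2 / 3 * real n)"
        unfolding \<delta>_def using rem_bounds(1)[OF k] rem_bounds(3) eps by (intro frac_le) auto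
      moreover have "real (u - 1) \<le> 51 * (\<epsilon>\<^sup>2 * real n)" using u U_bounds(2) by linarith
      ultimately have "real (u - 1) * \<delta> \<le> 51 * (\<epsilon>\<^sup>2 * real n) * (21 / 10 * \<epsilon> / (2 / 3 * real n))"
        using \<delta> by (intro mult_mono) auto
      also have "\<dots> = 3213 / 20 * (\<epsilon> * \<epsilon>\<^sup>2)" using rem_bounds(3) by (simp add: field_simps)
      also have "\<dots> \<le> 3213 / 20 * (1 / 200 * \<epsilon>\<^sup>2)" using eps by (intro mult_left_mono mult_right_mono) auto
      also have "\<dots> \<le> 2 * \<epsilon>\<^sup>2" by simp
      finally show ?thesis by simp
    qed
    finally show "(1 + \<delta>) ^ (u - 1) \<le> exp (2 * \<epsilon>\<^sup>2)" .
  qed (use s in auto)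
  finally have 2: "unit_factor \<zeta> k E ^ (u - 1) \<le> survive \<zeta> k ^ (u - 1) * exp (- (\<epsilon> * real (u - 1))) * exp (2 * \<epsilon>\<^sup>2)" .
  have "(1 + (E - 1) / rem k) ^ m * unit_factor \<zeta> k E ^ (u - 1) \<le>
      exp (- (real m / rem k * (\<epsilon> - \<epsilon>\<^sup>2))) * (survive \<zeta> k ^ (u - 1) * exp (- (\<epsilon> * real (u - 1))) * exp (2 * \<epsilon>\<^sup>2))"
    using 1 2 u0 by (intro mult_mono) auto
  then show ?thesis by (simp add: E_def exp_add exp_diff exp_minus divide_inverse mult_ac)
qed

text \<open>After second-order terms of at most 7\<epsilon>^2 there remains 2 cosh (\<epsilon>v) for
  v = u - 1 + \<mu>, with u - 1 truncated at 0. If u \<ge> 1, then v \<le> u + 2\<epsilon> and cosh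
  is monotone. At u = 0 no unit clause is removed and v = \<mu> is at most 1 + 2\<epsilon>, but
  evenness removes the linear term: cosh (\<epsilon>v) \<le> 1 + 2\<epsilon>^2. Either case costs
  another 2\<epsilon>^2.\<close>

lemma both_factors:
  assumes \<mu>: "real m \<le> (1 + 2 * \<epsilon>) * rem k"
  shows "(1 + (exp \<epsilon> - 1) / rem k) ^ m * unit_factor \<zeta> k (exp \<epsilon>) ^ (u - 1) +
      (1 + (exp (- \<epsilon>) - 1) / rem k) ^ m * unit_factor \<zeta> k (exp (- \<epsilon>)) ^ (u - 1)
    \<le> survive \<zeta> k ^ (u - 1) * (exp (9 * \<epsilon>\<^sup>2) * (exp \<epsilon> ^ u + exp (- \<epsilon>) ^ u))"
proof -
  define \<mu> where "\<mu> = real m / rem k"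
  have R: "rem k > 1" by (rule survive_bounds)
  have \<mu>: "0 \<le> \<mu>" "\<mu> \<le> 1 + 2 * \<epsilon>" using \<mu> R by (auto simp: \<mu>_def divide_le_eq)
  define v where "v = real (u - 1) + \<mu>"
  have me: "\<mu> * \<epsilon>\<^sup>2 \<le> 101 / 100 * \<epsilon>\<^sup>2" using \<mu> eps by (intro mult_right_mono) auto
  have cosh: "exp (\<epsilon> * v) + exp (- (\<epsilon> * v)) \<le> exp (2 * \<epsilon>\<^sup>2) * (exp \<epsilon> ^ u + exp (- \<epsilon>) ^ u)"
  proof (cases "u = 0")
    case True
    have v1: "0 \<le> \<epsilon> * v" "\<epsilon> * v \<le> 1" "(\<epsilon> * v)\<^sup>2 \<le> 2 * \<epsilon>\<^sup>2"
    proof -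
      have "v = \<mu>" using True by (simp add: v_def)
      then have v: "0 \<le> v" "v \<le> 101 / 100" using \<mu> eps by auto
      then show "0 \<le> \<epsilon> * v" using eps by simp
      have "\<epsilon> * v \<le> 1 / 200 * (101 / 100)" using eps v by (intro mult_mono) auto
      then show "\<epsilon> * v \<le> 1" by simp
      have "v\<^sup>2 \<le> (101 / 100)\<^sup>2" using v by (intro power_mono) auto
      then have "v\<^sup>2 \<le> 2" by (simp add: power2_eq_square)
      then have "\<epsilon>\<^sup>2 * v\<^sup>2 \<le> \<epsilon>\<^sup>2 * 2" by (intro mult_left_mono) auto
      then show "(\<epsilon> * v)\<^sup>2 \<le> 2 * \<epsilon>\<^sup>2" by (simp add: power_mult_distrib)
    qed
    have "exp (\<epsilon> * v) \<le> 1 + \<epsilon> * v + (\<epsilon> * v)\<^sup>2" using v1 by (intro exp_bound)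
    moreover have "exp (- (\<epsilon> * v)) \<le> 1 - \<epsilon> * v + (\<epsilon> * v)\<^sup>2"
    proof -
      define y where "y = \<epsilon> * v"
      have y: "0 \<le> y" "y \<le> 1" using v1 by (auto simp: y_def)
      have "(1 - y + y\<^sup>2) * (1 + y) = 1 + y ^ 3" by (simp add: algebra_simps power2_eq_square power3_eq_cube)
      then have "1 \<le> (1 - y + y\<^sup>2) * (1 + y)" using y by simp
      also have "\<dots> \<le> (1 - y + y\<^sup>2) * exp y" using y by (intro mult_left_mono) (auto intro: add_nonneg_nonneg)
      finally show ?thesis by (simp add: y_def[symmetric] exp_minus field_simps)
    qed
    ultimately have "exp (\<epsilon> * v) + exp (- (\<epsilon> * v)) \<le> 2 * (1 + 2 * \<epsilon>\<^sup>2)" using v1(3) by simp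
    also have "\<dots> \<le> 2 * exp (2 * \<epsilon>\<^sup>2)" by (intro mult_left_mono exp_ge_add_one_self) auto
    finally show ?thesis using True by simp
  next
    case False
    then have u1: "real (u - 1) = real u - 1" by (simp add: of_nat_diff)
    have v: "0 \<le> v" "v \<le> real u + 2 * \<epsilon>" using \<mu> False by (auto simp: v_def u1)
    have "\<epsilon> * v \<le> \<epsilon> * (real u + 2 * \<epsilon>)" using v eps by (intro mult_left_mono) auto
    then have "\<epsilon> * v \<le> \<epsilon> * real u + 2 * \<epsilon>\<^sup>2" by (simp add: algebra_simps power2_eq_square)
    then have "cosh (\<epsilon> * v) \<le> cosh (\<epsilon> * real u + 2 * \<epsilon>\<^sup>2)"
      using v eps by (subst cosh_real_nonneg_le_iff) auto
    then have "exp (\<epsilon> * v) + exp (- (\<epsilon> * v)) \<le> exp (\<epsilon> * real u + 2 * \<epsilon>\<^sup>2) + exp (- (\<epsilon> * real u + 2 * \<epsilon>\<^sup>2))"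
      by (simp add: cosh_field_def)
    also have "exp (- (\<epsilon> * real u + 2 * \<epsilon>\<^sup>2)) \<le> exp (2 * \<epsilon>\<^sup>2 - \<epsilon> * real u)" by simp
    also have "exp (\<epsilon> * real u + 2 * \<epsilon>\<^sup>2) + exp (2 * \<epsilon>\<^sup>2 - \<epsilon> * real u) = exp (2 * \<epsilon>\<^sup>2) * (exp \<epsilon> ^ u + exp (- \<epsilon>) ^ u)"
    proof -
      have "exp \<epsilon> ^ u = exp (\<epsilon> * real u)" "exp (- \<epsilon>) ^ u = exp (- (\<epsilon> * real u))"
        by (simp_all add: exp_of_nat_mult[symmetric] mult.commute)
      then show ?thesis by (simp add: distrib_left add.commute flip: exp_add)
    qed
    finally show ?thesis by simp
  qed
  have s0: "0 \<le> survive \<zeta> k ^ (u - 1)" using survive_bounds by simp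
  have "(1 + (exp \<epsilon> - 1) / rem k) ^ m * unit_factor \<zeta> k (exp \<epsilon>) ^ (u - 1) +
      (1 + (exp (- \<epsilon>) - 1) / rem k) ^ m * unit_factor \<zeta> k (exp (- \<epsilon>)) ^ (u - 1)
    \<le> survive \<zeta> k ^ (u - 1) * exp (\<epsilon> * real (u - 1) + \<mu> * (\<epsilon> + \<epsilon>\<^sup>2)) +
      survive \<zeta> k ^ (u - 1) * exp (- (\<epsilon> * real (u - 1)) - \<mu> * (\<epsilon> - \<epsilon>\<^sup>2) + 2 * \<epsilon>\<^sup>2)"
    unfolding \<mu>_def by (intro add_mono plus_factor minus_factor)
  also have "\<dots> \<le> survive \<zeta> k ^ (u - 1) * exp (7 * \<epsilon>\<^sup>2 + \<epsilon> * v) + survive \<zeta> k ^ (u - 1) * exp (7 * \<epsilon>\<^sup>2 - \<epsilon> * v)"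
  proof (intro add_mono mult_left_mono s0)
    have e0: "\<epsilon>\<^sup>2 \<ge> 0" by simp
    have e1: "\<mu> * (\<epsilon> + \<epsilon>\<^sup>2) = \<mu> * \<epsilon> + \<mu> * \<epsilon>\<^sup>2" "\<mu> * (\<epsilon> - \<epsilon>\<^sup>2) = \<mu> * \<epsilon> - \<mu> * \<epsilon>\<^sup>2"
      "\<epsilon> * v = \<epsilon> * real (u - 1) + \<mu> * \<epsilon>" by (simp_all add: v_def algebra_simps)
    show "exp (\<epsilon> * real (u - 1) + \<mu> * (\<epsilon> + \<epsilon>\<^sup>2)) \<le> exp (7 * \<epsilon>\<^sup>2 + \<epsilon> * v)"
      unfolding exp_le_cancel_iff e1 using me e0 by linarith
    show "exp (- (\<epsilon> * real (u - 1)) - \<mu> * (\<epsilon> - \<epsilon>\<^sup>2) + 2 * \<epsilon>\<^sup>2) \<le> exp (7 * \<epsilon>\<^sup>2 - \<epsilon> * v)"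
      unfolding exp_le_cancel_iff e1 using me e0 by linarith
  qed
  also have "\<dots> = survive \<zeta> k ^ (u - 1) * (exp (7 * \<epsilon>\<^sup>2) * (exp (\<epsilon> * v) + exp (- (\<epsilon> * v))))"
    by (simp add: exp_add exp_diff exp_minus divide_inverse algebra_simps)
  also have "\<dots> \<le> survive \<zeta> k ^ (u - 1) * (exp (7 * \<epsilon>\<^sup>2) * (exp (2 * \<epsilon>\<^sup>2) * (exp \<epsilon> ^ u + exp (- \<epsilon>) ^ u)))"
    by (intro mult_left_mono s0 cosh) auto
  also have "\<dots> = survive \<zeta> k ^ (u - 1) * (exp (9 * \<epsilon>\<^sup>2) * (exp \<epsilon> ^ u + exp (- \<epsilon>) ^ u))"
  proof -
    have "exp (7 * \<epsilon>\<^sup>2) * exp (2 * \<epsilon>\<^sup>2) = exp (9 * \<epsilon>\<^sup>2)" by (simp flip: exp_add)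
    then show ?thesis by (metis mult.assoc)
  qed
  finally show ?thesis .
qed

text \<open>A unit clause is removed and \<mu> \<le> 1 - 2\<epsilon> arrive on average, so the
  exponent changes by at most \<mu>(\<epsilon> + \<epsilon>^2) - \<epsilon> \<le>
  -\<epsilon>^2.\<close>

lemma down_factor:
  assumes \<mu>: "real m \<le> (1 - 2 * \<epsilon>) * rem k" and u1: "u \<ge> 1"
  shows "(1 + (exp \<epsilon> - 1) / rem k) ^ m * unit_factor \<zeta> k (exp \<epsilon>) ^ (u - 1)
    \<le> survive \<zeta> k ^ (u - 1) * (exp (- (\<epsilon>\<^sup>2)) * exp \<epsilon> ^ u)"
proof -
  have R: "rem k > 1" by (rule survive_bounds)
  have "real m / rem k \<le> 1 - 2 * \<epsilon>" using \<mu> R by (simp add: divide_le_eq)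
  then have "real m / rem k * (\<epsilon> + \<epsilon>\<^sup>2) \<le> (1 - 2 * \<epsilon>) * (\<epsilon> + \<epsilon>\<^sup>2)" using eps by (intro mult_right_mono) auto
  also have "\<dots> = \<epsilon> - \<epsilon>\<^sup>2 - 2 * (\<epsilon> * \<epsilon>\<^sup>2)" by (simp add: algebra_simps power2_eq_square)
  also have "\<dots> \<le> \<epsilon> - \<epsilon>\<^sup>2" using eps by simp
  finally have "\<epsilon> * real (u - 1) + real m / rem k * (\<epsilon> + \<epsilon>\<^sup>2) \<le> \<epsilon> * real u - \<epsilon>\<^sup>2"
    using u1 by (simp add: of_nat_diff algebra_simps)
  then have "survive \<zeta> k ^ (u - 1) * exp (\<epsilon> * real (u - 1) + real m / rem k * (\<epsilon> + \<epsilon>\<^sup>2)) \<le>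
      survive \<zeta> k ^ (u - 1) * exp (\<epsilon> * real u - \<epsilon>\<^sup>2)"
    using survive_bounds by (intro mult_left_mono) auto
  also have "\<dots> = survive \<zeta> k ^ (u - 1) * (exp (- (\<epsilon>\<^sup>2)) * exp \<epsilon> ^ u)"
    by (simp add: exp_of_nat_mult[symmetric] exp_diff exp_minus divide_inverse mult_ac)
  finally show ?thesis using plus_factor by simp
qed

end

end

lemma expectation_indicator:
  "measure_pmf.expectation p (\<lambda>F. if P F then 1 else 0) = measure_pmf.prob p {F. P F}"
proof -
  have "(\<lambda>F. if P F then 1 else 0) = indicat_real {F. P F}" by (auto simp: indicator_def)
  then show ?thesis by simp
qed

section \<open>Induction along the algorithm\<close>

context supercritical
begin

abbreviation m2 :: "nat list \<Rightarrow> nat" where "m2 ts \<equiv> count_list ts 2"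
abbreviation m1 :: "nat list \<Rightarrow> nat" where "m1 ts \<equiv> count_list ts 1"
abbreviation m0 :: "nat list \<Rightarrow> nat" where "m0 ts \<equiv> count_list ts 0"

lemma trans_op_unit_weight:
  "trans_op (rem k) ts (weight \<alpha> \<beta> \<zeta>) =
    weight (1 + ((1 - 2 / rem k) * (\<alpha> - 1) + (\<beta> - 1) / rem k)) (unit_factor \<zeta> k \<beta>) \<zeta> ts" if "rem k \<noteq> 0"
proof -
  have "(1 - 2 / rem k) * \<alpha> + 1 / rem k * \<beta> + 1 / rem k = 1 + ((1 - 2 / rem k) * (\<alpha> - 1) + (\<beta> - 1) / rem k)"
    using that by (simp add: field_simps)
  then show ?thesis unfolding trans_op_weight unit_factor_def by simp
qed

text \<open>The supermartingale property of \<open>over\<close>, for two uses. With \<zeta> = 1 it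
  is the plain one, as \<open>survive\<close> is 1. With \<zeta> = 0 the factor
  \<open>\<zeta> ^ m0 ts\<close> restricts to runs without violated clause, and the power of
  \<open>survive\<close> is the probability of staying among them; its exponent is
  \<open>m1 ts - 1\<close> because one unit clause is satisfied by the assignment itself.\<close>

lemma over_step:
  assumes k: "k < K" and o: "over k (m2 ts) (m1 ts) < 1" and ts: "relax ts ts'" and u: "k < K1 \<or> m1 ts \<ge> 1"
    and \<zeta>: "0 \<le> \<zeta>" "\<zeta> \<le> 1"
  shows "trans_op (rem k) ts' (\<lambda>ts. \<zeta> ^ m0 ts * over (Suc k) (m2 ts) (m1 ts))
    \<le> survive \<zeta> k ^ (m1 ts - 1) * \<zeta> ^ m0 ts * over k (m2 ts) (m1 ts)"
proof -
  have kK: "k \<le> K" using k by simp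
  note cnt = relax_counts[OF ts]
  note no = not_over[OF kK o]
  have R: "rem k > 2" "rem k \<noteq> 0" using rem_bounds(1)[OF kK] rem_bounds(3) by auto
  have n: "real n > 0" using rem_bounds(3) by simp
  let ?s = "survive \<zeta> k ^ (m1 ts - 1)"
  have z0: "0 \<le> \<zeta> ^ m0 ts" using \<zeta> by simp
  define c where "c = (1 + Y / r (Suc k))"
  have plus: "trans_op (rem k) ts' (\<lambda>ts. \<zeta> ^ m0 ts * exp s ^ m1 ts) =
     \<zeta> ^ m0 ts * ((1 + (exp s - 1) / rem k) ^ m2 ts * unit_factor \<zeta> k (exp s) ^ (m1 ts - 1))" for s
  proof -
    have "(\<lambda>ts. \<zeta> ^ m0 ts * exp s ^ m1 ts) = weight 1 (exp s) \<zeta>"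
      by (rule ext) (simp add: weight_eq mult.commute)
    then show ?thesis by (simp add: trans_op_unit_weight R) (simp add: weight_eq cnt cnt(3)[simplified])
  qed
  have first: "trans_op (rem k) ts' (\<lambda>ts. \<zeta> ^ m0 ts * (c ^ m2 ts / B)) = ?s * \<zeta> ^ m0 ts * ((1 + Y / r k) ^ m2 ts / B)"
  proof -
    have "(\<lambda>ts. \<zeta> ^ m0 ts * (c ^ m2 ts / B)) = (\<lambda>ts. weight c 1 \<zeta> ts / B)"
      by (rule ext) (simp add: weight_eq)
    then have "trans_op (rem k) ts' (\<lambda>ts. \<zeta> ^ m0 ts * (c ^ m2 ts / B)) = trans_op (rem k) ts' (weight c 1 \<zeta>) / B"
      by (simp add: trans_op_divide)
    also have "\<dots> = (1 + (1 - 2 / rem k) * (c - 1)) ^ m2 ts * unit_factor \<zeta> k 1 ^ (m1 ts - 1) * \<zeta> ^ m0 ts / B"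
      by (simp add: trans_op_unit_weight R) (simp add: weight_eq cnt cnt(3)[simplified])
    also have "unit_factor \<zeta> k 1 = survive \<zeta> k"
      using R by (simp add: unit_factor_def survive_def field_simps)
    \<comment> \<open>The martingale identity: a 2-clause survives the step with probability 1 - 2 /
      rem k = r (k+1) / r k.\<close>
    also have "(1 - 2 / rem k) * (c - 1) = Y / r k"
    proof -
      have "(1 - 2 / a) * (y / ((a - 1) * (a - 2))) = y / (a * (a - 1))" if "a > 2" for a y :: real
      proof -
        have "(c / a) * (y / (b * c)) = y / (a * b)" if "c > 0" for b c using that by simp
        moreover have "1 - 2 / a = (a - 2) / a" using that by (simp add: diff_divide_distrib)
        ultimately show ?thesis using that by simp
      qed
      moreover have "rem (Suc k) = rem k - 1" by (simp add: rem_def)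
      ultimately show ?thesis using R(1) by (simp add: c_def r_def)
    qed
    finally show ?thesis by (simp add: mult_ac)
  qed
  have second: "trans_op (rem k) ts' (\<lambda>ts. \<zeta> ^ m0 ts * walk (Suc k) (m1 ts)) \<le> ?s * \<zeta> ^ m0 ts * walk k (m1 ts)"
  proof (cases "k < K1")
    case True
    have mm: "real (m2 ts) \<le> (1 + 2 * \<epsilon>) * rem k"
    proof -
      have "(1 + 2 * \<epsilon> - real k / real n) * rem k \<le> (1 + 2 * \<epsilon>) * rem k" using R n by (intro mult_right_mono) auto
      then show ?thesis using no(3) by simp
    qed
    note both = both_factors[OF kK no(1) \<zeta> mm]
    define C where "C = 2 * exp (- (\<epsilon>\<^sup>2 * real H)) * exp (9 * \<epsilon>\<^sup>2 * (real K1 - real (Suc k)))"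
    have C: "C \<ge> 0" by (simp add: C_def)
    have w: "walk (Suc k) v \<le> C * (exp \<epsilon> ^ v + exp (- \<epsilon>) ^ v)" for v
    proof (cases "Suc k < K1")
      case True
      then show ?thesis by (simp add: walk_def C_def)
    next
      case False
      then have e: "K1 = Suc k" using \<open>k < K1\<close> by simp
      then have "walk (Suc k) v = C * exp \<epsilon> ^ v" by (simp add: walk_def C_def K_def)
      then show ?thesis using C by (simp add: mult_left_mono)
    qed
    have Ck: "C * exp (9 * \<epsilon>\<^sup>2) = 2 * exp (- (\<epsilon>\<^sup>2 * real H)) * exp (9 * \<epsilon>\<^sup>2 * (real K1 - real k))"
      by (simp add: C_def algebra_simps flip: exp_add)
    have "trans_op (rem k) ts' (\<lambda>ts. \<zeta> ^ m0 ts * walk (Suc k) (m1 ts))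
      \<le> trans_op (rem k) ts' (\<lambda>ts. C * (\<zeta> ^ m0 ts * exp \<epsilon> ^ m1 ts + \<zeta> ^ m0 ts * exp (- \<epsilon>) ^ m1 ts))"
    proof (rule trans_op_mono)
      fix us
      have "\<zeta> ^ m0 us * walk (Suc k) (m1 us) \<le> \<zeta> ^ m0 us * (C * (exp \<epsilon> ^ m1 us + exp (- \<epsilon>) ^ m1 us))"
        using \<zeta> by (intro mult_left_mono w) auto
      then show "\<zeta> ^ m0 us * walk (Suc k) (m1 us) \<le> C * (\<zeta> ^ m0 us * exp \<epsilon> ^ m1 us + \<zeta> ^ m0 us * exp (- \<epsilon>) ^ m1 us)"
        by (simp add: algebra_simps)
    qed (use R in simp)
    also have "\<dots> = C * (\<zeta> ^ m0 ts * ((1 + (exp \<epsilon> - 1) / rem k) ^ m2 ts * unit_factor \<zeta> k (exp \<epsilon>) ^ (m1 ts - 1) +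
        (1 + (exp (- \<epsilon>) - 1) / rem k) ^ m2 ts * unit_factor \<zeta> k (exp (- \<epsilon>)) ^ (m1 ts - 1)))"
      by (simp only: trans_op_cmult trans_op_add plus distrib_left)
    also have "\<dots> \<le> C * (\<zeta> ^ m0 ts * (?s * (exp (9 * \<epsilon>\<^sup>2) * (exp \<epsilon> ^ m1 ts + exp (- \<epsilon>) ^ m1 ts))))"
      by (intro mult_left_mono both z0 C)
    also have "\<dots> = ?s * \<zeta> ^ m0 ts * ((C * exp (9 * \<epsilon>\<^sup>2)) * (exp \<epsilon> ^ m1 ts + exp (- \<epsilon>) ^ m1 ts))"
      by (simp only: mult_ac)
    also have "\<dots> = ?s * \<zeta> ^ m0 ts * walk k (m1 ts)" unfolding Ck using True by (simp add: walk_def)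
    finally show ?thesis .
  next
    case False
    then have u1: "m1 ts \<ge> 1" using u by simp
    have mm: "real (m2 ts) \<le> (1 - 2 * \<epsilon>) * rem k"
    proof -
      have "4 * \<epsilon> * real n \<le> real k" using K_bounds(1) False by simp
      then have "4 * \<epsilon> \<le> real k / real n" using n by (simp add: le_divide_eq)
      then have "(1 + 2 * \<epsilon> - real k / real n) * rem k \<le> (1 - 2 * \<epsilon>) * rem k" using R by (intro mult_right_mono) auto
      then show ?thesis using no(3) by simp
    qed
    note down = down_factor[OF kK no(1) \<zeta> mm u1]
    define C where "C = exp (- (\<epsilon>\<^sup>2 * (real K - real (Suc k)))) + exp (- (\<epsilon>\<^sup>2 * real H))"
    have C: "C \<ge> 0" by (simp add: C_def add_nonneg_nonneg)
    have w: "walk (Suc k) v = C * exp \<epsilon> ^ v" for v using False by (simp add: walk_def C_def)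
    have Ck: "C * exp (- (\<epsilon>\<^sup>2)) \<le> exp (- (\<epsilon>\<^sup>2 * (real K - real k))) + exp (- (\<epsilon>\<^sup>2 * real H))"
    proof -
      have "C * exp (- (\<epsilon>\<^sup>2)) = exp (- (\<epsilon>\<^sup>2 * (real K - real k))) + exp (- (\<epsilon>\<^sup>2 * real H)) * exp (- (\<epsilon>\<^sup>2))"
        by (simp add: C_def algebra_simps flip: exp_add)
      also have "exp (- (\<epsilon>\<^sup>2 * real H)) * exp (- (\<epsilon>\<^sup>2)) \<le> exp (- (\<epsilon>\<^sup>2 * real H)) * 1"
        by (intro mult_left_mono) auto
      finally show ?thesis by simp
    qed
    have "trans_op (rem k) ts' (\<lambda>ts. \<zeta> ^ m0 ts * walk (Suc k) (m1 ts)) = trans_op (rem k) ts' (\<lambda>ts. C * (\<zeta> ^ m0 ts * exp \<epsilon> ^ m1 ts))"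
      unfolding w by (simp only: mult_ac)
    also have "\<dots> = C * (\<zeta> ^ m0 ts * ((1 + (exp \<epsilon> - 1) / rem k) ^ m2 ts * unit_factor \<zeta> k (exp \<epsilon>) ^ (m1 ts - 1)))"
      by (simp only: trans_op_cmult plus)
    also have "\<dots> \<le> C * (\<zeta> ^ m0 ts * (?s * (exp (- (\<epsilon>\<^sup>2)) * exp \<epsilon> ^ m1 ts)))"
      by (intro mult_left_mono down z0 C)
    also have "\<dots> = ?s * \<zeta> ^ m0 ts * ((C * exp (- (\<epsilon>\<^sup>2))) * exp \<epsilon> ^ m1 ts)"
      by (simp only: mult_ac)
    also have "\<dots> \<le> ?s * \<zeta> ^ m0 ts * ((exp (- (\<epsilon>\<^sup>2 * (real K - real k))) + exp (- (\<epsilon>\<^sup>2 * real H))) * exp \<epsilon> ^ m1 ts)"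
      using survive_bounds(1)[OF kK no(1) \<zeta>] z0 by (intro mult_left_mono mult_right_mono Ck) auto
    also have "\<dots> = ?s * \<zeta> ^ m0 ts * walk k (m1 ts)" using False by (simp add: walk_def)
    finally show ?thesis .
  qed
  have "trans_op (rem k) ts' (\<lambda>ts. \<zeta> ^ m0 ts * over (Suc k) (m2 ts) (m1 ts)) =
      trans_op (rem k) ts' (\<lambda>ts. \<zeta> ^ m0 ts * (c ^ m2 ts / B)) + trans_op (rem k) ts' (\<lambda>ts. \<zeta> ^ m0 ts * walk (Suc k) (m1 ts))"
    by (simp only: over_def c_def distrib_left trans_op_add)
  also have "\<dots> \<le> ?s * \<zeta> ^ m0 ts * ((1 + Y / r k) ^ m2 ts / B) + ?s * \<zeta> ^ m0 ts * walk k (m1 ts)"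
    using first second by simp
  finally show ?thesis by (simp only: over_def distrib_left)
qed

text \<open>Markov's inequality for 2 ^ m0 at level d. In each step fewer than \<open>U\<close> unit
  clauses are at risk, each violated with probability 1 / (2 rem k), so the mean grows by a factor
  of at most exp (U/n).\<close>

definition tail_bound :: "nat \<Rightarrow> nat \<Rightarrow> real" where
  "tail_bound d k = (1 / 2) ^ d * exp ((real K - real k) * U / real n)"

text \<open>The leading 1/2 belongs to the subcritical rest of the formula; a step violates no unit
  clause with probability at least exp (-2U/n).\<close>

definition sat_bound :: "nat \<Rightarrow> real" where
  "sat_bound k = 1 / 2 * exp (- ((real K - real k) * (2 * U / real n)))"

lemma tail_bound_nonneg: "0 \<le> tail_bound d k" and sat_bound_nonneg: "0 \<le> sat_bound k"
  by (simp_all add: tail_bound_def sat_bound_def)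

lemma over_nonneg: "k \<le> K \<Longrightarrow> over k m u \<ge> 0"
  using Y_pos r_pos[of k] walk_nonneg[of k u] by (simp add: over_def B_def)

text \<open>From \<open>K1\<close> on the density is at most 1 - 2\<epsilon>, so the gap is at least
  \<epsilon>, the other \<epsilon> paying for rem k - 1 in its definition. At least n/2 variables
  are left, which doubles the constant 12000.\<close>

lemma stop_tail:
  assumes A: "finite A" "card A = n - k" and k: "K1 \<le> k" "k \<le> K" and m: "real m \<le> (1 + 2 * \<epsilon> - real k / real n) * rem k"
  shows "measure_pmf.prob (random_cnf A m) {F. d \<le> deficit F} \<le> (24000 * real d / x) ^ d"
proof -
  have kn: "k \<le> n" using k K_bounds(7) rem_bounds(3) by linarith
  have cA: "real (card A) = rem k" using A kn by (simp add: rem_def of_nat_diff)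
  have R: "rem k \<ge> 2 / 3 * real n" "real n \<ge> 1000000" using rem_bounds(1)[OF k(2)] rem_bounds(3) by auto
  have n: "real n > 0" using R by simp
  have "real (card A) \<ge> 2" using cA R by simp
  then interpret random_clauses A m using A by unfold_locales auto
  have "real m \<le> (1 - 2 * \<epsilon>) * rem k"
  proof -
    have "4 * \<epsilon> * real n \<le> real k" using K_bounds(1) k by simp
    then have "4 * \<epsilon> \<le> real k / real n" using n by (simp add: le_divide_eq)
    then have "(1 + 2 * \<epsilon> - real k / real n) * rem k \<le> (1 - 2 * \<epsilon>) * rem k" using R by (intro mult_right_mono) auto
    then show ?thesis using m by simp
  qed
  also have "\<dots> \<le> (1 - \<epsilon>) * (rem k - 1)"
  proof -
    have "1 \<le> \<epsilon> * rem k"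
    proof -
      have "\<epsilon> * (2 / 3 * real n) \<le> \<epsilon> * rem k" using R eps by (intro mult_left_mono) auto
      then show ?thesis using en by simp
    qed
    then show ?thesis using eps by (simp add: algebra_simps)
  qed
  finally have g: "gap m \<ge> \<epsilon>" unfolding gap_def cA using R by (simp add: field_simps)
  then have gp: "gap m > 0" using eps by simp
  have "measure_pmf.prob (random_cnf A m) {F. d \<le> deficit F} \<le> (12000 * real d / (gap m ^ 3 * real (card A))) ^ d"
    by (rule subcritical_deficit_tail[OF gp])
  also have "\<dots> \<le> (12000 * real d / (\<epsilon> ^ 3 * (real n / 2))) ^ d"
  proof (intro power_mono divide_left_mono mult_mono)
    show "\<epsilon> \<le> gap m" by (rule g)
    show "real n / 2 \<le> real (card A)" using cA R by simp
  qed (use gp eps n cA R in auto)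
  also have "12000 * real d / (\<epsilon> ^ 3 * (real n / 2)) = 24000 * real d / x" by simp
  finally show ?thesis .
qed

lemma stop_mean:
  assumes A: "finite A" "card A = n - k" and k: "K1 \<le> k" "k \<le> K" and u: "m1 ts = 0"
  shows "mean A ts (\<lambda>F. \<phi> (deficit F)) = measure_pmf.expectation (random_cnf A (m2 ts)) (\<lambda>F. \<phi> (m0 ts + deficit F))"
proof -
  have kn: "k \<le> n" using k K_bounds(7) rem_bounds(3) by linarith
  have cA: "real (card A) = rem k" using A kn by (simp add: rem_def of_nat_diff)
  then have "real (card A) \<ge> 2" using rem_bounds(1)[OF k(2)] rem_bounds(3) by linarith
  then have c2: "card A \<ge> 2" by simp
  have "1 \<notin> set ts" using u by (simp add: count_list_0_iff)
  from mean_no_units[OF this, of A \<phi> "[]"] show ?thesis by (simp add: mean_replicate[OF A(1) c2])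
qed

text \<open>Backward induction in k. If \<open>over \<ge> 1\<close>, the trivial bound 1 suffices.
  Otherwise the algorithm stops if k \<ge> \<open>K1\<close> and no unit clause is left, or makes
  one more step. The deficit is split into \<open>d1\<close> for clauses violated on the way and
  \<open>d2\<close> for the rest; \<open>p\<close> enters additively, once, since the operator
  preserves constants.\<close>

lemma algorithm_tail:
  assumes p: "\<And>A k m. finite A \<Longrightarrow> card A = n - k \<Longrightarrow> K1 \<le> k \<Longrightarrow> k \<le> K \<Longrightarrow>
      real m \<le> (1 + 2 * \<epsilon> - real k / real n) * rem k \<Longrightarrow> measure_pmf.prob (random_cnf A m) {F. d2 \<le> deficit F} \<le> p"
    and p0: "0 \<le> p"
  shows "k \<le> K \<Longrightarrow> finite A \<Longrightarrow> card A = n - k \<Longrightarrow>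
    mean A ts (\<lambda>F. if d1 + d2 \<le> deficit F then 1 else 0) \<le>
      2 ^ m0 ts * tail_bound d1 k + p + over k (m2 ts) (m1 ts)"
proof (induction "K - k" arbitrary: k A ts)
  case 0
  have "\<not> over k (m2 ts) (m1 ts) < 1" using not_over(2)[of k] 0 by auto
  moreover have "mean A ts (\<lambda>F. if d1 + d2 \<le> deficit F then 1 else 0) \<le> 1" by (rule mean_le) auto
  moreover have "0 \<le> 2 ^ m0 ts * tail_bound d1 k" using tail_bound_nonneg by simp
  ultimately show ?case using p0 by linarith
next
  case (Suc j)
  have kK: "k \<le> K" "k < K" using Suc by auto
  let ?g = "tail_bound d1"
  have le1: "mean A ts (\<lambda>F. if d1 + d2 \<le> deficit F then 1 else 0) \<le> 1" by (rule mean_le) auto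
  have g0: "0 \<le> 2 ^ m0 ts * ?g k" using tail_bound_nonneg by simp
  have R: "rem k \<ge> 2 / 3 * real n" "real n \<ge> 1000000" using rem_bounds(1)[OF kK(1)] rem_bounds(3) by auto
  have kn: "k \<le> n" using kK K_bounds(7) rem_bounds(3) by linarith
  have cA: "real (card A) = rem k" using Suc.prems kn by (simp add: rem_def of_nat_diff)
  have U0: "U \<ge> 0" using U_bounds(1) R by (intro order.trans[OF _ U_bounds(1)]) simp
  show ?case
  proof (cases "over k (m2 ts) (m1 ts) < 1")
    case False
    then show ?thesis using le1 p0 g0 by linarith
  next
    case o: True
    note no = not_over[OF kK(1) o]
    have on: "over k (m2 ts) (m1 ts) \<ge> 0" by (rule over_nonneg[OF kK(1)])
    show ?thesis
    proof (cases "K1 \<le> k \<and> m1 ts = 0")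
      case True
      show ?thesis
      proof (cases "d1 \<le> m0 ts")
        case d: True
        have "1 \<le> (2 :: real) ^ m0 ts * (1 / 2) ^ d1"
          using power_increasing[OF d, of "2 :: real"] by (simp add: power_divide field_simps)
        moreover have "1 \<le> exp ((real K - real k) * U / real n)" using U0 kK by simp
        ultimately have "1 * 1 \<le> (2 ^ m0 ts * (1 / 2) ^ d1) * exp ((real K - real k) * U / real n)"
          by (intro mult_mono) auto
        then have "1 \<le> 2 ^ m0 ts * ?g k" by (simp add: tail_bound_def mult.assoc)
        then show ?thesis using le1 p0 on by linarith
      next
        case False
        have "mean A ts (\<lambda>F. if d1 + d2 \<le> deficit F then 1 else 0) =
            measure_pmf.prob (random_cnf A (m2 ts)) {F. d1 + d2 \<le> m0 ts + deficit F}"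
          using stop_mean[of A k ts "\<lambda>d. if d1 + d2 \<le> d then 1 else 0"] Suc.prems True
          by (simp add: expectation_indicator)
        also have "\<dots> \<le> measure_pmf.prob (random_cnf A (m2 ts)) {F. d2 \<le> deficit F}"
          using False by (intro measure_pmf.finite_measure_mono) auto
        also have "\<dots> \<le> p" using Suc.prems True no(3) by (intro p) auto
        finally show ?thesis using g0 on by linarith
      qed
    next
      case ns: False
      obtain ts' where ts': "relax ts ts'" using ex_relax by blast
      note cnt = relax_counts[OF ts']
      have "mean A ts (\<lambda>F. if d1 + d2 \<le> deficit F then 1 else 0) \<le>
          trans_op (real (card A)) ts' (\<lambda>ts. 2 ^ m0 ts * ?g (Suc k) + p + over (Suc k) (m2 ts) (m1 ts))"
      proof (rule mean_unit_step[OF _ _ _ ts'])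
        show "finite A" by (rule Suc.prems)
        have "real (card A) \<ge> 3" using cA R by simp
        then show "3 \<le> card A" by simp
        show "mono (\<lambda>d. if d1 + d2 \<le> d then 1 else (0 :: real))" by (rule monoI) auto
        show "mean (A - {y}) us (\<lambda>F. if d1 + d2 \<le> deficit F then 1 else 0) \<le>
            2 ^ m0 us * ?g (Suc k) + p + over (Suc k) (m2 us) (m1 us)" if "y \<in> A" for y us
          using Suc that by (intro Suc.hyps) auto
      qed
      also have "\<dots> = trans_op (rem k) ts' (\<lambda>ts. 2 ^ m0 ts * ?g (Suc k)) + trans_op (rem k) ts' (\<lambda>ts. p)
          + trans_op (rem k) ts' (\<lambda>ts. over (Suc k) (m2 ts) (m1 ts))"
        unfolding cA by (simp only: trans_op_add)
      also have "trans_op (rem k) ts' (\<lambda>ts. over (Suc k) (m2 ts) (m1 ts)) \<le> over k (m2 ts) (m1 ts)"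
        using over_step[OF kK(2) o ts', of 1] ns by (auto simp: survive_def)
      also have "trans_op (rem k) ts' (\<lambda>ts. p) = p"
      proof -
        have "(\<lambda>ts. p) = (\<lambda>ts. p * weight 1 1 1 ts)" by (simp add: weight_eq)
        then show ?thesis using R by (simp add: trans_op_cmult trans_op_weight) (simp add: weight_eq)
      qed
      also have "trans_op (rem k) ts' (\<lambda>ts. 2 ^ m0 ts * ?g (Suc k)) \<le> 2 ^ m0 ts * ?g k"
      proof -
        have "(\<lambda>ts. 2 ^ m0 ts * ?g (Suc k)) = (\<lambda>ts. ?g (Suc k) * weight 1 1 2 ts)" by (rule ext) (simp add: weight_eq)
        then have "trans_op (rem k) ts' (\<lambda>ts. 2 ^ m0 ts * ?g (Suc k)) = ?g (Suc k) * trans_op (rem k) ts' (weight 1 1 2)"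
          by (simp only: trans_op_cmult)
        also have "\<dots> = ?g (Suc k) * (unit_factor 2 k 1 ^ (m1 ts - 1) * 2 ^ m0 ts)"
          using R by (simp add: trans_op_unit_weight) (simp add: weight_eq cnt cnt(3)[simplified])
        also have "unit_factor 2 k 1 = 1 + 1 / (2 * rem k)" using R by (simp add: unit_factor_def field_simps)
        also have "?g (Suc k) * ((1 + 1 / (2 * rem k)) ^ (m1 ts - 1) * 2 ^ m0 ts) \<le> ?g (Suc k) * (exp (U / real n) * 2 ^ m0 ts)"
        proof (intro mult_left_mono mult_right_mono)
          have "(1 + 1 / (2 * rem k)) ^ (m1 ts - 1) \<le> exp (real (m1 ts - 1) * (1 / (2 * rem k)))"
            using R by (intro one_plus_power_le_exp) simp
          also have "\<dots> \<le> exp (U / real n)"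
          proof -
            have "real (m1 ts - 1) * (1 / (2 * rem k)) \<le> U * (1 / real n)"
              using no(1) R by (intro mult_mono divide_left_mono) auto
            then show ?thesis by simp
          qed
          finally show "(1 + 1 / (2 * rem k)) ^ (m1 ts - 1) \<le> exp (U / real n)" .
        qed (use tail_bound_nonneg in auto)
        also have "\<dots> = 2 ^ m0 ts * ?g k"
        proof -
          have "exp ((real K - real (Suc k)) * U / real n) * exp (U / real n) = exp ((real K - real k) * U / real n)"
            unfolding exp_add[symmetric] by (simp add: field_simps diff_divide_distrib add_divide_distrib)
          then have "?g (Suc k) * exp (U / real n) = ?g k" by (simp add: tail_bound_def)
          then show ?thesis by (simp add: mult_ac)
        qed
        finally show ?thesis .
      qed
      finally show ?thesis by simp
    qed
  qed
qed

text \<open>The sign is reversed because \<open>mean_unit_step\<close> bounds nondecreasing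
  functions of the deficit from above. The right-hand side is minus \<open>sat_bound k\<close> times
  \<open>1 - over\<close>, with \<open>0 ^ m0 ts\<close> as the indicator of no violated
  clause.\<close>

lemma algorithm_sat:
  assumes p: "\<And>A k m. finite A \<Longrightarrow> card A = n - k \<Longrightarrow> K1 \<le> k \<Longrightarrow> k \<le> K \<Longrightarrow>
      real m \<le> (1 + 2 * \<epsilon> - real k / real n) * rem k \<Longrightarrow> measure_pmf.prob (random_cnf A m) {F. deficit F = 0} \<ge> 1 / 2"
  shows "k \<le> K \<Longrightarrow> finite A \<Longrightarrow> card A = n - k \<Longrightarrow>
    mean A ts (\<lambda>F. - (if deficit F = 0 then 1 else 0)) \<le>
      0 ^ m0 ts * over k (m2 ts) (m1 ts) * sat_bound k - 0 ^ m0 ts * sat_bound k"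
proof (induction "K - k" arbitrary: k A ts)
  case 0
  have "\<not> over k (m2 ts) (m1 ts) < 1" using not_over(2)[of k] 0 by auto
  then have "0 ^ m0 ts * 1 * sat_bound k \<le> 0 ^ m0 ts * over k (m2 ts) (m1 ts) * sat_bound k"
    using sat_bound_nonneg by (intro mult_right_mono mult_left_mono) auto
  moreover have "mean A ts (\<lambda>F. - (if deficit F = 0 then 1 else 0)) \<le> 0" by (rule mean_le) auto
  ultimately show ?case by simp
next
  case (Suc j)
  have kK: "k \<le> K" "k < K" using Suc by auto
  let ?g = sat_bound
  note g0 = sat_bound_nonneg
  have le0: "mean A ts (\<lambda>F. - (if deficit F = 0 then 1 else 0)) \<le> 0" by (rule mean_le) auto
  have R: "rem k \<ge> 2 / 3 * real n" "real n \<ge> 1000000" using rem_bounds(1)[OF kK(1)] rem_bounds(3) by auto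
  have kn: "k \<le> n" using kK K_bounds(7) rem_bounds(3) by linarith
  have cA: "real (card A) = rem k" using Suc.prems kn by (simp add: rem_def of_nat_diff)
  have U0: "U \<ge> 0" using U_bounds(1) R by (intro order.trans[OF _ U_bounds(1)]) simp
  show ?case
  proof (cases "over k (m2 ts) (m1 ts) < 1 \<and> m0 ts = 0")
    case False
    then show ?thesis
    proof (cases "m0 ts = 0")
      case True
      then have "1 * ?g k \<le> over k (m2 ts) (m1 ts) * ?g k" using False g0 by (intro mult_right_mono) auto
      moreover have "0 ^ m0 ts = (1 :: real)" using True by simp
      ultimately show ?thesis using le0 by (simp only: mult_1)
    next
      case F: False
      then have "0 ^ m0 ts = (0 :: real)" by simp
      then show ?thesis using le0 by (simp only: mult_zero_left)
    qed
  next
    case True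
    then have o: "over k (m2 ts) (m1 ts) < 1" and z: "m0 ts = 0" by auto
    note no = not_over[OF kK(1) o]
    have on: "over k (m2 ts) (m1 ts) \<ge> 0" by (rule over_nonneg[OF kK(1)])
    show ?thesis
    proof (cases "K1 \<le> k \<and> m1 ts = 0")
      case True
      have "mean A ts (\<lambda>F. - (if deficit F = 0 then 1 else 0)) =
          - measure_pmf.prob (random_cnf A (m2 ts)) {F. deficit F = 0}"
        using stop_mean[of A k ts "\<lambda>d. - (if d = 0 then 1 else 0)"] Suc.prems True z
        by (simp add: expectation_indicator)
      also have "\<dots> \<le> - (1 / 2)" using p[of A k "m2 ts"] Suc.prems True no(3) by simp
      also have "\<dots> \<le> - ?g k"
      proof -
        have "0 \<le> (real K - real k) * (2 * U / real n)" using U0 kK by simp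
        then show ?thesis by (simp add: sat_bound_def)
      qed
      also have "\<dots> \<le> over k (m2 ts) (m1 ts) * ?g k - ?g k" using on g0[of k] by simp
      finally show ?thesis using z by simp
    next
      case ns: False
      obtain ts' where ts': "relax ts ts'" using ex_relax by blast
      note cnt = relax_counts[OF ts']
      let ?s = "survive 0 k ^ (m1 ts - 1)"
      have s: "?s \<ge> exp (- (2 * U / real n))"
      proof -
        define y where "y = 1 / (2 * rem k)"
        have y: "0 \<le> y" "y \<le> 1 / 2" "y \<le> 1 / real n" using R by (auto simp: y_def intro!: divide_left_mono)
        have "1 \<le> (1 + 2 * y) * (1 - y)"
        proof -
          have "(1 + 2 * y) * (1 - y) = 1 + y * (1 - 2 * y)" by (simp add: algebra_simps)
          moreover have "0 \<le> y * (1 - 2 * y)" using y by (intro mult_nonneg_nonneg) auto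
          ultimately show ?thesis by simp
        qed
        also have "\<dots> \<le> exp (2 * y) * (1 - y)" using y by (intro mult_right_mono) auto
        finally have "exp (- (2 * y)) \<le> 1 - y" by (simp add: exp_minus field_simps)
        then have pw: "exp (- (2 * y)) ^ (m1 ts - 1) \<le> (1 - y) ^ (m1 ts - 1)" by (intro power_mono) auto
        have "real (m1 ts - 1) * (2 * y) \<le> U * (2 * (1 / real n))"
          using no(1) y U0 by (intro mult_mono) auto
        also have "\<dots> = 2 * U / real n" by simp
        finally have "exp (- (2 * U / real n)) \<le> exp (- (real (m1 ts - 1) * (2 * y)))"
          unfolding exp_le_cancel_iff by linarith
        also have "\<dots> = exp (- (2 * y)) ^ (m1 ts - 1)" unfolding exp_of_nat_mult[symmetric] by simp
        also have "\<dots> \<le> (1 - y) ^ (m1 ts - 1)" by (rule pw)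
        also have "\<dots> = ?s" by (simp only: survive_def y_def diff_zero)
        finally show ?thesis .
      qed
      have "mean A ts (\<lambda>F. - (if deficit F = 0 then 1 else 0)) \<le>
          trans_op (real (card A)) ts' (\<lambda>ts. 0 ^ m0 ts * over (Suc k) (m2 ts) (m1 ts) * ?g (Suc k) - 0 ^ m0 ts * ?g (Suc k))"
      proof (rule mean_unit_step[OF _ _ _ ts'])
        show "finite A" by (rule Suc.prems)
        have "real (card A) \<ge> 3" using cA R by simp
        then show "3 \<le> card A" by simp
        show "mono (\<lambda>d :: nat. - (if d = 0 then 1 else (0 :: real)))" by (rule monoI) auto
        show "mean (A - {y}) us (\<lambda>F. - (if deficit F = 0 then 1 else 0)) \<le>
            0 ^ m0 us * over (Suc k) (m2 us) (m1 us) * ?g (Suc k) - 0 ^ m0 us * ?g (Suc k)" if "y \<in> A" for y us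
          using Suc that by (intro Suc.hyps) auto
      qed
      also have "\<dots> = ?g (Suc k) * trans_op (rem k) ts' (\<lambda>ts. 0 ^ m0 ts * over (Suc k) (m2 ts) (m1 ts)) -
          ?g (Suc k) * trans_op (rem k) ts' (weight 1 1 0)"
      proof -
        have "(\<lambda>ts. 0 ^ m0 ts * over (Suc k) (m2 ts) (m1 ts) * ?g (Suc k) - 0 ^ m0 ts * ?g (Suc k)) =
          (\<lambda>ts. ?g (Suc k) * (0 ^ m0 ts * over (Suc k) (m2 ts) (m1 ts)) + (- ?g (Suc k)) * weight 1 1 0 ts)"
          by (rule ext) (simp add: weight_eq)
        then show ?thesis by (simp only: cA trans_op_add trans_op_cmult)
      qed
      also have "trans_op (rem k) ts' (weight 1 1 0) = ?s"
      proof -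
        have "unit_factor 0 k 1 = survive 0 k" using R by (simp add: unit_factor_def survive_def field_simps)
        then show ?thesis using R by (simp add: trans_op_unit_weight) (simp add: weight_eq cnt cnt(3)[simplified] z)
      qed
      also have "?g (Suc k) * trans_op (rem k) ts' (\<lambda>ts. 0 ^ m0 ts * over (Suc k) (m2 ts) (m1 ts)) \<le>
          ?g (Suc k) * (?s * over k (m2 ts) (m1 ts))"
        using over_step[OF kK(2) o ts', of 0] ns z g0 by (intro mult_left_mono) auto
      also have "?g (Suc k) * (?s * over k (m2 ts) (m1 ts)) - ?g (Suc k) * ?s = - ((?g (Suc k) * ?s) * (1 - over k (m2 ts) (m1 ts)))"
        by (simp add: algebra_simps)
      also have "\<dots> \<le> - (?g k * (1 - over k (m2 ts) (m1 ts)))"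
      proof -
        have "?g k = ?g (Suc k) * exp (- (2 * U / real n))"
          by (simp add: sat_bound_def algebra_simps diff_divide_distrib add_divide_distrib flip: exp_add)
        also have "\<dots> \<le> ?g (Suc k) * ?s" using s g0 by (intro mult_left_mono) auto
        finally have "?g k * (1 - over k (m2 ts) (m1 ts)) \<le> (?g (Suc k) * ?s) * (1 - over k (m2 ts) (m1 ts))"
          using o by (intro mult_right_mono) auto
        then show ?thesis by simp
      qed
      also have "\<dots> = over k (m2 ts) (m1 ts) * ?g k - ?g k" by (simp add: algebra_simps)
      finally show ?thesis using z by simp
    qed
  qed
qed

section \<open>Bounds for the initial formula\<close>

lemma over_start:
  assumes M: "real M \<le> (1 + \<epsilon>) * real n"
  shows "over 0 M 0 \<le> 5 * exp (- (6 * x))"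
proof -
  have "(1 + Y / r 0) ^ M / B \<le> exp (- (6 * x))"
  proof -
    have r0: "r 0 > 0" using r_pos[of 0] by simp
    then have y: "Y / r 0 = \<epsilon> / 16" by (simp add: Y_def)
    have "(1 + Y / r 0) ^ M \<le> exp (real M * (\<epsilon> / 16))"
      unfolding y using eps by (intro one_plus_power_le_exp) simp
    also have "\<dots> \<le> exp ((1 + \<epsilon>) * real n * (\<epsilon> / 16))"
      using mult_right_mono[OF M, of "\<epsilon> / 16"] eps by simp
    finally have "(1 + Y / r 0) ^ M / B \<le> exp ((1 + \<epsilon>) * real n * (\<epsilon> / 16)) / B"
      by (rule divide_right_mono) (simp add: B_def)
    \<comment> \<open>The exponent is that of the start minus that of \<open>B\<close>: the
      difference \<epsilon>/2 of 3\<epsilon>/2 and \<epsilon>, times \<epsilon>n/16.\<close>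
    also have "\<dots> = exp (- (\<epsilon>\<^sup>2 * real n / 32))"
      unfolding B_def exp_diff[symmetric] by (simp add: field_simps power2_eq_square)
    also have "\<dots> \<le> exp (- (6 * x))" using sizes(1) big by simp
    finally show ?thesis .
  qed
  moreover have "walk 0 0 \<le> 4 * exp (- (6 * x))"
  proof -
    have h: "\<epsilon>\<^sup>2 * real H \<ge> 50 * x"
    proof -
      have "\<epsilon>\<^sup>2 * (50 * \<epsilon> * real n) \<le> \<epsilon>\<^sup>2 * real H" by (intro mult_left_mono K_bounds) auto
      then show ?thesis by (simp add: power2_eq_square power3_eq_cube mult_ac)
    qed
    have kk: "\<epsilon>\<^sup>2 * real K1 \<le> 4 * x + 1"
    proof -
      have "\<epsilon>\<^sup>2 * real K1 \<le> \<epsilon>\<^sup>2 * (4 * \<epsilon> * real n + 1)" by (intro mult_left_mono K_bounds) auto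
      also have "\<dots> = 4 * x + \<epsilon>\<^sup>2" by (simp add: power2_eq_square power3_eq_cube algebra_simps)
      also have "\<epsilon>\<^sup>2 \<le> 1" using eps by (intro power_le_one) auto
      finally show ?thesis by simp
    qed
    have "walk 0 0 = 4 * exp (9 * (\<epsilon>\<^sup>2 * real K1) - \<epsilon>\<^sup>2 * real H)"
      using K_bounds(8) by (simp add: walk_def exp_diff exp_minus divide_inverse mult_ac)
    also have "\<dots> \<le> 4 * exp (- (6 * x))"
    proof -
      \<comment> \<open>At most 9(4x + 1) - 50x = 9 - 14x.\<close>
      have "9 * (\<epsilon>\<^sup>2 * real K1) - \<epsilon>\<^sup>2 * real H \<le> - (6 * x)" using h kk big by linarith
      then show ?thesis by simp
    qed
    finally show ?thesis .
  qed
  ultimately show ?thesis unfolding over_def by simp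
qed

lemma count_start: "m2 (replicate M 2) = M" "m1 (replicate M 2) = 0" "m0 (replicate M 2) = 0"
  by (induction M) auto

lemma KU: "real K * U / real n \<le> 2805 * x"
proof -
  have n: "real n > 0" using rem_bounds(3) by simp
  have "real K * U \<le> (55 * (\<epsilon> * real n)) * (51 * (\<epsilon>\<^sup>2 * real n))"
    using K_bounds(6) U_bounds eps n by (intro mult_mono) (auto intro: order.trans[OF _ U_bounds(1)])
  also have "\<dots> = 2805 * x * real n" by (simp add: power2_eq_square power3_eq_cube)
  finally show ?thesis using n by (simp add: divide_le_eq)
qed

lemma n_ge_2: "2 \<le> n"
  using rem_bounds(3) by simp

text \<open>At most \<open>d1\<close>, about 6000x, clauses are violated on the way: since e^(1/2)
  \<le> 2, the error is exp (2805x - 3000x), where 2805 = 55 * 51 bounds K U / n in units of x. The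
  rest contributes \<open>d2\<close>, about x / 80000, chosen so that 24000 d2 / x is below 1/e. The
  errors add up to 7 exp (-x / 80000), and x \<ge> 1000000 lets half of the exponent absorb the
  7.\<close>

theorem supercritical_tail:
  assumes M: "real M \<le> (1 + \<epsilon>) * real n"
  shows "measure_pmf.prob (random_cnf {..<n} M) {F. 6010 * x \<le> real (deficit F)} \<le> exp (- (x / 160000))"
proof -
  define d1 where "d1 = nat \<lceil>6000 * x\<rceil>"
  define d2 where "d2 = nat \<lceil>x / 80000\<rceil>"
  have d1: "6000 * x \<le> real d1" "real d1 \<le> 6000 * x + 1" using big unfolding d1_def by linarith+
  have d2: "x / 80000 \<le> real d2" "real d2 \<le> x / 80000 + 1" using big unfolding d2_def by linarith+
  let ?p = "(24000 * real d2 / x) ^ d2"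
  have x0: "x > 0" using big by linarith
  have "mean {..<n} (replicate M 2) (\<lambda>F. if d1 + d2 \<le> deficit F then 1 else 0) \<le>
      2 ^ m0 (replicate M 2) * tail_bound d1 0 + ?p + over 0 (m2 (replicate M 2)) (m1 (replicate M 2))"
  proof (rule algorithm_tail)
    show "measure_pmf.prob (random_cnf A m) {F. d2 \<le> deficit F} \<le> ?p"
      if "finite A" "card A = n - k" "K1 \<le> k" "k \<le> K" "real m \<le> (1 + 2 * \<epsilon> - real k / real n) * rem k" for A k m
      using that by (rule stop_tail)
  qed (use x0 in auto)
  then have "measure_pmf.prob (random_cnf {..<n} M) {F. d1 + d2 \<le> deficit F} \<le> tail_bound d1 0 + ?p + over 0 M 0"
    using n_ge_2 by (simp add: mean_replicate expectation_indicator count_start)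
  moreover have "tail_bound d1 0 \<le> exp (- (x / 80000))"
  proof -
    have "exp (1 / 2) \<le> 1 + 1 / 2 + (1 / 2 :: real)\<^sup>2" by (rule exp_bound) auto
    then have "exp (1 / 2 :: real) \<le> 2" by (simp add: power2_eq_square)
    then have "1 / 2 \<le> exp (- (1 / 2) :: real)" by (simp add: exp_minus field_simps)
    then have "(1 / 2) ^ d1 \<le> exp (- (1 / 2) :: real) ^ d1" by (intro power_mono) auto
    also have "\<dots> = exp (- (real d1 / 2))" by (simp flip: exp_of_nat_mult)
    finally have "tail_bound d1 0 \<le> exp (- (real d1 / 2)) * exp (real K * U / real n)"
      unfolding tail_bound_def by (simp add: mult_right_mono)
    also have "\<dots> = exp (real K * U / real n - real d1 / 2)" by (simp flip: exp_add)
    also have "\<dots> \<le> exp (- (x / 80000))" unfolding exp_le_cancel_iff using KU d1 big by linarith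
    finally show ?thesis .
  qed
  moreover have "?p \<le> exp (- (x / 80000))"
  proof -
    have "24000 * real d2 \<le> 36 / 100 * x" using d2 big by linarith
    then have "24000 * real d2 / x \<le> 36 / 100" by (subst pos_divide_le_eq[OF x0])
    also have "\<dots> \<le> exp (-1)"
    proof -
      have "exp 1 * (36 / 100) \<le> (1 :: real)" using e_less_272 by simp
      then show ?thesis by (simp add: exp_minus field_simps)
    qed
    finally have "?p \<le> exp (-1) ^ d2" using x0 by (intro power_mono) auto
    also have "\<dots> = exp (- real d2)" by (simp flip: exp_of_nat_mult)
    also have "\<dots> \<le> exp (- (x / 80000))" using d2 by simp
    finally show ?thesis .
  qed
  moreover have "over 0 M 0 \<le> 5 * exp (- (x / 80000))"
  proof -
    have "exp (- (6 * x)) \<le> exp (- (x / 80000))" unfolding exp_le_cancel_iff using big by linarith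
    then show ?thesis using over_start[OF M] by linarith
  qed
  ultimately have "measure_pmf.prob (random_cnf {..<n} M) {F. d1 + d2 \<le> deficit F} \<le> 7 * exp (- (x / 80000))"
    by linarith
  also have "\<dots> \<le> exp (x / 160000) * exp (- (x / 80000))"
  proof (rule mult_right_mono)
    show "7 \<le> exp (x / 160000)" using exp_ge_add_one_self[of "x / 160000"] big by linarith
  qed simp
  also have "\<dots> = exp (- (x / 160000))" by (simp flip: exp_add)
  finally have *: "measure_pmf.prob (random_cnf {..<n} M) {F. d1 + d2 \<le> deficit F} \<le> exp (- (x / 160000))" .
  have "{F. 6010 * x \<le> real (deficit F)} \<subseteq> {F. d1 + d2 \<le> deficit F}"
  proof
    fix F assume "F \<in> {F. 6010 * x \<le> real (deficit F)}"
    then have "real (d1 + d2) \<le> real (deficit F)" using d1 d2 big by simp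
    then show "F \<in> {F. d1 + d2 \<le> deficit F}" by (simp only: of_nat_le_iff mem_Collect_eq)
  qed
  then show ?thesis using * by (intro order.trans[OF measure_pmf.finite_measure_mono *]) auto
qed

text \<open>The initial potential is below 1/2, so at least half of \<open>sat_bound 0\<close> is
  left, which is exp (-2 K U / n) / 4. Here 2 K U / n \<le> 2 * 2805x = 5610x, and the other 390x of
  the exponent pay for the factor 1/4.\<close>

theorem supercritical_sat:
  assumes M: "real M \<le> (1 + \<epsilon>) * real n"
  shows "exp (- (6000 * x)) \<le> measure_pmf.prob (random_cnf {..<n} M) {F. deficit F = 0}"
proof -
  have x0: "x > 0" using big by linarith
  have compl: "measure_pmf.prob p {F. deficit F = 0} = 1 - measure_pmf.prob p {F. 1 \<le> deficit F}" for p
  proof -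
    have "{F. deficit F = 0} = UNIV - {F. 1 \<le> deficit F}" by auto
    then show ?thesis using measure_pmf.prob_compl[of "{F. 1 \<le> deficit F}" p] by simp
  qed
  have "mean {..<n} (replicate M 2) (\<lambda>F. - (if deficit F = 0 then 1 else 0)) \<le>
      0 ^ m0 (replicate M 2) * over 0 (m2 (replicate M 2)) (m1 (replicate M 2)) * sat_bound 0 -
      0 ^ m0 (replicate M 2) * sat_bound 0"
  proof (rule algorithm_sat)
    show "1 / 2 \<le> measure_pmf.prob (random_cnf A m) {F. deficit F = 0}"
      if "finite A" "card A = n - k" "K1 \<le> k" "k \<le> K" "real m \<le> (1 + 2 * \<epsilon> - real k / real n) * rem k" for A k m
    proof -
      have "measure_pmf.prob (random_cnf A m) {F. 1 \<le> deficit F} \<le> (24000 * real 1 / x) ^ 1"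
        using that by (rule stop_tail)
      also have "\<dots> \<le> 1 / 2" using big by (simp add: divide_le_eq)
      finally show ?thesis by (simp add: compl)
    qed
  qed auto
  then have "- measure_pmf.prob (random_cnf {..<n} M) {F. deficit F = 0} \<le> over 0 M 0 * sat_bound 0 - sat_bound 0"
    using n_ge_2 by (simp add: mean_replicate expectation_indicator count_start)
  then have "(1 - over 0 M 0) * sat_bound 0 \<le> measure_pmf.prob (random_cnf {..<n} M) {F. deficit F = 0}"
    by (simp add: algebra_simps)
  moreover have "1 / 2 * sat_bound 0 \<le> (1 - over 0 M 0) * sat_bound 0"
  proof (intro mult_right_mono sat_bound_nonneg)
    have "exp (- (6 * x)) \<le> 1 / 10"
    proof -
      have "10 \<le> exp (6 * x)" using exp_ge_add_one_self[of "6 * x"] big by linarith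
      then show ?thesis by (simp add: exp_minus field_simps)
    qed
    then show "1 / 2 \<le> 1 - over 0 M 0" using over_start[OF M] by linarith
  qed
  moreover have "exp (- (6000 * x)) \<le> 1 / 2 * sat_bound 0"
  proof -
    have "exp (- (6000 * x)) = exp (- (390 * x)) * exp (- (5610 * x))" by (simp flip: exp_add)
    also have "\<dots> \<le> 1 / 4 * exp (- (real K * (2 * U / real n)))"
    proof (intro mult_mono)
      have "4 \<le> exp (390 * x)" using exp_ge_add_one_self[of "390 * x"] big by linarith
      then show "exp (- (390 * x)) \<le> 1 / 4" by (simp add: exp_minus field_simps)
      have "real K * (2 * U / real n) = 2 * (real K * U / real n)" by simp
      also have "\<dots> \<le> 2 * (2805 * x)" by (intro mult_left_mono KU) simp
      finally have "real K * (2 * U / real n) \<le> 5610 * x" by simp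
      then show "exp (- (5610 * x)) \<le> exp (- (real K * (2 * U / real n)))"
        unfolding exp_le_cancel_iff by (simp only: neg_le_iff_le)
    qed auto
    finally show ?thesis by (simp add: sat_bound_def)
  qed
  ultimately show ?thesis by linarith
qed

end

subsection \<open>Asymptotics in the three regimes\<close>

lemma cbrt_pow3: "y \<ge> 0 \<Longrightarrow> (y powr (1 / 3)) ^ 3 = y" for y :: real
proof (cases "y = 0")
  case False
  assume "y \<ge> 0"
  with False have "(y powr (1 / 3)) powr real 3 = y" by (simp add: powr_powr)
  then show ?thesis using False \<open>y \<ge> 0\<close> by (subst (asm) powr_realpow) auto
qed simp

definition dev :: "nat \<Rightarrow> real \<Rightarrow> real" where
  "dev n l = l * real n powr (- 1 / 3)"

lemma dev_pow3: "n > 0 \<Longrightarrow> dev n l ^ 3 * real n = l ^ 3"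
proof -
  assume n: "n > 0"
  have "(real n powr (- 1 / 3)) ^ 3 = real n powr (-1)"
    using n by (subst powr_realpow[symmetric]) (auto simp: powr_powr)
  then show ?thesis using n by (simp add: dev_def power_mult_distrib powr_minus)
qed

lemma dev_uminus: "dev n (- l) = - dev n l"
  by (simp add: dev_def)

lemma num_clauses_dev: "num_clauses n l = nat \<lfloor>(1 + dev n l) * real n\<rfloor>"
  by (simp add: num_clauses_def clause_density_def dev_def)

lemma num_clauses_bounds:
  assumes "1 + dev n l \<ge> 0"
  shows "real (num_clauses n l) \<le> (1 + dev n l) * real n" "(1 + dev n l) * real n - 1 \<le> real (num_clauses n l)"
proof -
  have "(1 + dev n l) * real n \<ge> 0" using assms by simp
  then show "real (num_clauses n l) \<le> (1 + dev n l) * real n" "(1 + dev n l) * real n - 1 \<le> real (num_clauses n l)"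
    unfolding num_clauses_dev by linarith+
qed

lemma num_clauses_mono: "l \<le> l' \<Longrightarrow> num_clauses n l \<le> num_clauses n l'"
  unfolding num_clauses_dev dev_def
  by (intro nat_mono floor_mono mult_right_mono add_left_mono) auto

text \<open>A coupling: the new clause is put in front, where \<open>mean\<close> averages over it
  last, and it cannot decrease the deficit.\<close>

lemma expectation_deficit_mono:
  assumes A: "finite A" "card A \<ge> 2" and \<phi>: "mono \<phi>" and le: "m \<le> m'"
  shows "measure_pmf.expectation (random_cnf A m) (\<lambda>F. \<phi> (deficit F)) \<le>
    (measure_pmf.expectation (random_cnf A m') (\<lambda>F. \<phi> (deficit F)) :: real)"
  using le
proof (induction m' rule: dec_induct)
  case (step k)
  have cl: "real (card (clauses_on A)) > 0" using A by (simp add: card_clauses_on)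
  have "mean A (replicate k 2) (\<lambda>F. \<phi> (deficit F)) = avg (clauses_on A) (\<lambda>C. mean A (replicate k 2) (\<lambda>F. \<phi> (deficit F)))"
    using cl by (simp add: avg_def)
  also have "\<dots> \<le> avg (clauses_on A) (\<lambda>C. mean A (replicate k 2) (\<lambda>F. \<phi> (deficit (C # F))))"
    by (intro avg_mono mean_mono monoD[OF \<phi>] deficit_Cons_ge)
  also have "\<dots> = mean A (replicate (Suc k) 2) (\<lambda>F. \<phi> (deficit F))" by (simp add: gen_simps)
  finally show ?case using step.IH by (simp only: mean_replicate[OF A])
qed simp

lemma prob_deficit_mono:
  assumes "2 \<le> n" "m \<le> m'"
  shows "measure_pmf.prob (random_formula n m) {F. d \<le> deficit F} \<le> measure_pmf.prob (random_formula n m') {F. d \<le> deficit F}"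
proof -
  have "mono (\<lambda>k. if d \<le> k then 1 else (0 :: real))" by (rule monoI) auto
  from expectation_deficit_mono[OF _ _ this assms(2), of "{..<n}"] assms(1)
  show ?thesis by (simp add: random_formula_eq expectation_indicator)
qed

definition mean_deficit :: "nat \<Rightarrow> nat \<Rightarrow> real" where
  "mean_deficit n m = measure_pmf.expectation (random_formula n m) (\<lambda>F. real (deficit F))"

lemma mean_deficit_mono: "2 \<le> n \<Longrightarrow> m \<le> m' \<Longrightarrow> mean_deficit n m \<le> mean_deficit n m'"
  unfolding mean_deficit_def random_formula_eq
  by (rule expectation_deficit_mono) (auto intro: monoI)

lemma random_formula_support:
  assumes "2 \<le> n"
  shows "finite (set_pmf (random_formula n m))" "F \<in> set_pmf (random_formula n m) \<Longrightarrow> length F = m"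
proof -
  have "card (clauses_on {..<n}) > 0" using assms by (simp add: card_clauses_on)
  then have cl: "clauses_on {..<n} \<noteq> {}" "finite (clauses_on {..<n})" using card_gt_0_iff by blast+
  have sub: "set_pmf (random_formula n m) \<subseteq> {xs. set xs \<subseteq> clauses_on {..<n} \<and> length xs = m}"
    using cl by (auto simp: random_formula_eq random_cnf_def set_replicate_pmf)
  then show "finite (set_pmf (random_formula n m))"
    by (rule finite_subset[OF _ finite_lists_length_eq[OF cl(2)]])
  show "F \<in> set_pmf (random_formula n m) \<Longrightarrow> length F = m" using sub by blast
qed

lemma mean_deficit_eq:
  assumes "2 \<le> n"
  shows "real m - expected_max_sat n m = mean_deficit n m"
proof -
  note fin = random_formula_support(1)[OF assms, of m]
  have "mean_deficit n m = measure_pmf.expectation (random_formula n m) (\<lambda>F. real m - real (max_sat F))"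
    unfolding mean_deficit_def
  proof (rule integral_cong_AE)
    show "AE F in random_formula n m. real (deficit F) = real m - real (max_sat F)"
      unfolding AE_measure_pmf_iff
    proof
      fix F assume "F \<in> set_pmf (random_formula n m)"
      then have "length F = m" by (rule random_formula_support(2)[OF assms])
      then show "real (deficit F) = real m - real (max_sat F)" using real_deficit[of F] by simp
    qed
  qed auto
  also have "\<dots> = real m - expected_max_sat n m"
    using fin by (simp add: expected_max_sat_def integrable_measure_pmf_finite)
  finally show ?thesis by simp
qed

lemma prob_unsat_eq: "1 - prob_satisfiable n m = measure_pmf.prob (random_formula n m) {F. 1 \<le> deficit F}"
proof -
  have "{F. 1 \<le> deficit F} = UNIV - {F. satisfiable F}" by (auto simp: deficit_eq_0_iff[symmetric] Suc_le_eq)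
  then show ?thesis
    using measure_pmf.prob_compl[of "{F. satisfiable F}" "random_formula n m"] by (simp add: prob_satisfiable_def)
qed

lemma prob_satisfiable_antimono: "2 \<le> n \<Longrightarrow> m \<le> m' \<Longrightarrow> prob_satisfiable n m' \<le> prob_satisfiable n m"
  using prob_deficit_mono[of n m m' 1] prob_unsat_eq[of n m] prob_unsat_eq[of n m'] by simp

text \<open>Below the threshold and in the window, a lower bound on the left and an upper bound on
  the right settle both two-sided estimates.\<close>

lemma prob_unsat_le_mean:
  assumes "2 \<le> n"
  shows "1 - prob_satisfiable n m \<le> mean_deficit n m"
proof -
  have "1 - prob_satisfiable n m = measure_pmf.expectation (random_formula n m) (\<lambda>F. if 1 \<le> deficit F then 1 else 0)"
    by (simp add: prob_unsat_eq expectation_indicator)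
  also have "\<dots> \<le> mean_deficit n m"
    unfolding mean_deficit_def
    by (intro integral_mono integrable_measure_pmf_finite random_formula_support(1)[OF assms]) auto
  finally show ?thesis .
qed

section \<open>Consequences above the threshold\<close>

lemma supercritical_dev:
  assumes "l \<ge> 100" "n > 0" "dev n l \<le> 1 / 200"
  shows "supercritical n (dev n l)"
proof
  show "0 < dev n l" using assms by (simp add: dev_def)
  show "dev n l \<le> 1 / 200" by (rule assms)
  have "(100 :: real) ^ 3 \<le> l ^ 3" using assms by (intro power_mono) auto
  then show "1000000 \<le> dev n l ^ 3 * real n" using dev_pow3[OF assms(2), of l] by simp
qed

text \<open>As \<epsilon> is bounded below, 1 + \<epsilon> is O(\<epsilon>^3), and \<epsilon>^3 n =
  \<lambda>^3. In this range the number of clauses itself is an admissible bound for the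
  deficit.\<close>

lemma num_clauses_le_large_dev:
  assumes l: "l \<ge> 100" and n: "n > 0" and d: "dev n l > 1 / 200"
  shows "real (num_clauses n l) < 10000000 * l ^ 3"
proof -
  define e where "e = dev n l"
  have e: "e > 1 / 200" "e ^ 3 * real n = l ^ 3" using d dev_pow3[OF n, of l] by (auto simp: e_def)
  have l3: "l ^ 3 > 0" using l by simp
  have e3: "(1 + e) \<le> 9000000 * e ^ 3"
  proof -
    have "(1 / 200) ^ 3 \<le> e ^ 3" using e by (intro power_mono) auto
    then have 1: "1 \<le> 8000000 * e ^ 3" by (simp add: power3_eq_cube)
    have "(1 / 200) * (1 / 200) * e \<le> e * e * e" using e by (intro mult_mono) auto
    then have 2: "e \<le> 40000 * e ^ 3" by (simp add: power3_eq_cube)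
    show ?thesis using 1 2 by simp
  qed
  have "real (num_clauses n l) \<le> (1 + e) * real n" using num_clauses_bounds(1)[of n l] e by (simp add: e_def)
  also have "\<dots> \<le> 9000000 * e ^ 3 * real n" using e3 by (intro mult_right_mono) auto
  also have "\<dots> = 9000000 * l ^ 3" using e(2) by simp
  also have "\<dots> < 10000000 * l ^ 3" using l3 by simp
  finally show ?thesis .
qed

lemma deficit_tail:
  assumes n: "2 \<le> n" and l: "l \<ge> 100"
  shows "measure_pmf.prob (random_formula n (num_clauses n l)) {F. 10000000 * l ^ 3 \<le> real (deficit F)} \<le> exp (- (l ^ 3 / 160000))"
proof (cases "dev n l \<le> 1 / 200")
  case True
  have n0: "n > 0" using n by simp
  interpret supercritical n "dev n l" by (rule supercritical_dev[OF l n0 True])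
  have M: "real (num_clauses n l) \<le> (1 + dev n l) * real n"
    using num_clauses_bounds(1)[of n l] eps by simp
  have "measure_pmf.prob (random_formula n (num_clauses n l)) {F. 10000000 * l ^ 3 \<le> real (deficit F)} \<le>
      measure_pmf.prob (random_formula n (num_clauses n l)) {F. 6010 * l ^ 3 \<le> real (deficit F)}"
    using l by (intro measure_pmf.finite_measure_mono) (auto intro: order.trans[rotated])
  also have "\<dots> \<le> exp (- (l ^ 3 / 160000))"
    using supercritical_tail[OF M] dev_pow3[OF n0, of l] by (simp add: random_formula_eq)
  finally show ?thesis .
next
  case False
  have "measure_pmf.prob (random_formula n (num_clauses n l)) {F. 10000000 * l ^ 3 \<le> real (deficit F)} =
      measure_pmf.prob (random_formula n (num_clauses n l)) ({F. 10000000 * l ^ 3 \<le> real (deficit F)} \<inter> set_pmf (random_formula n (num_clauses n l)))"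
    by (simp add: measure_Int_set_pmf)
  also have "{F. 10000000 * l ^ 3 \<le> real (deficit F)} \<inter> set_pmf (random_formula n (num_clauses n l)) = {}"
  proof -
    have "real (deficit F) < 10000000 * l ^ 3" if "F \<in> set_pmf (random_formula n (num_clauses n l))" for F
      using random_formula_support(2)[OF n that] deficit_le_length[of F] num_clauses_le_large_dev[of l n] l n False by simp
    then show ?thesis by force
  qed
  finally show ?thesis by simp
qed

text \<open>The tail bound is used at the larger parameter with third power \<open>s\<close>; more
  clauses only increase the deficit. One deviation level for each \<lambda> thus yields all larger
  levels.\<close>

lemma deficit_tail_scaled:
  assumes n: "2 \<le> n" and l: "l \<ge> 0" "l ^ 3 \<le> s" and s: "s \<ge> 1000000"
  shows "measure_pmf.prob (random_formula n (num_clauses n l)) {F. 10000000 * s \<le> real (deficit F)} \<le> exp (- (s / 160000))"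
proof -
  define l' where "l' = s powr (1 / 3)"
  have l': "l' ^ 3 = s" "l' \<ge> 0" using s by (auto simp: l'_def cbrt_pow3)
  have "l \<le> l'" using l l' by (intro power_le_imp_le_base[of l 2 l']) (auto simp: numeral_3_eq_3)
  have "(100 :: real) ^ 3 \<le> l' ^ 3" using l' s by simp
  then have h: "100 \<le> l'" using l' by (intro power_le_imp_le_base[of 100 2 l']) (auto simp: numeral_3_eq_3)
  define d where "d = nat \<lceil>10000000 * s\<rceil>"
  have d: "{F. 10000000 * s \<le> real (deficit F)} = {F. d \<le> deficit F}"
    using s by (auto simp: d_def nat_le_iff ceiling_le_iff)
  have "measure_pmf.prob (random_formula n (num_clauses n l)) {F. d \<le> deficit F} \<le>
      measure_pmf.prob (random_formula n (num_clauses n l')) {F. d \<le> deficit F}"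
    using n \<open>l \<le> l'\<close> by (intro prob_deficit_mono num_clauses_mono)
  also have "\<dots> \<le> exp (- (s / 160000))" using deficit_tail[OF n h] l' d by simp
  finally show ?thesis by (simp add: d)
qed

text \<open>Sum of tails. The terms before \<open>K\<close> are bounded by 1; beyond, k itself sets
  the scale s' = k / 10000000, and the tail becomes geometric with ratio \<rho>, where 10000000 *
  160000 = 1600000000000.\<close>

lemma mean_deficit_le:
  assumes n: "2 \<le> n" and l: "l \<ge> 0" "l ^ 3 \<le> s" and s: "s \<ge> 1000000"
  shows "mean_deficit n (num_clauses n l) \<le> 10000000 * s + 1 + 1 / (1 - exp (- (1 / 1600000000000)))"
proof -
  define \<rho> :: real where "\<rho> = exp (- (1 / 1600000000000))"
  have \<rho>: "0 < \<rho>" "\<rho> < 1" by (auto simp: \<rho>_def)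
  let ?p = "random_formula n (num_clauses n l)" and ?m = "num_clauses n l"
  define K where "K = nat \<lceil>10000000 * s\<rceil>"
  have K: "10000000 * s \<le> real K" "real K \<le> 10000000 * s + 1" using s unfolding K_def by linarith+
  note fin = random_formula_support(1)[OF n, of ?m]
  have "mean_deficit n ?m = measure_pmf.expectation ?p (\<lambda>F. \<Sum>k<?m. if Suc k \<le> deficit F then 1 else 0)"
    unfolding mean_deficit_def
  proof (rule integral_cong_AE)
    show "AE F in ?p. real (deficit F) = (\<Sum>k<?m. if Suc k \<le> deficit F then 1 else 0)"
    proof (simp add: AE_measure_pmf_iff, intro ballI)
      fix F assume "F \<in> set_pmf ?p"
      then have "deficit F \<le> ?m" using random_formula_support(2)[OF n] deficit_le_length[of F] by simp
      then have "{k \<in> {..<?m}. Suc k \<le> deficit F} = {..<deficit F}" by auto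
      then show "real (deficit F) = (\<Sum>k<?m. if Suc k \<le> deficit F then 1 else 0)"
        by (simp flip: sum.inter_filter)
    qed
  qed auto
  also have "\<dots> = (\<Sum>k<?m. measure_pmf.prob ?p {F. Suc k \<le> deficit F})"
    using fin by (subst Bochner_Integration.integral_sum) (auto simp: integrable_measure_pmf_finite expectation_indicator)
  also have "\<dots> \<le> (\<Sum>k<?m. (if k < K then 1 else 0) + \<rho> ^ k)"
  proof (rule sum_mono)
    fix k
    show "measure_pmf.prob ?p {F. Suc k \<le> deficit F} \<le> (if k < K then 1 else 0) + \<rho> ^ k"
    proof (cases "k < K")
      case True
      then show ?thesis using \<rho> by (intro order.trans[OF measure_pmf.prob_le_1]) simp
    next
      case False
      define s' where "s' = real k / 10000000"
      have s': "s \<le> s'" using False K by (simp add: s'_def)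
      have "measure_pmf.prob ?p {F. Suc k \<le> deficit F} \<le> measure_pmf.prob ?p {F. 10000000 * s' \<le> real (deficit F)}"
        by (intro measure_pmf.finite_measure_mono) (auto simp: s'_def)
      also have "\<dots> \<le> exp (- (s' / 160000))"
        using s' l s by (intro deficit_tail_scaled n) auto
      also have "\<dots> = \<rho> ^ k" by (simp add: \<rho>_def s'_def flip: exp_of_nat_mult)
      finally show ?thesis using False by simp
    qed
  qed
  also have "\<dots> = (\<Sum>k<?m. if k < K then 1 else 0) + (\<Sum>k<?m. \<rho> ^ k)" by (rule sum.distrib)
  also have "(\<Sum>k<?m. if k < K then 1 else (0 :: real)) \<le> real K"
  proof -
    have "(\<Sum>k<?m. if k < K then 1 else (0 :: real)) = real (card {k \<in> {..<?m}. k < K})" by (simp flip: sum.inter_filter)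
    also have "\<dots> \<le> real (card {..<K})" by (intro of_nat_mono card_mono) auto
    finally show ?thesis by simp
  qed
  also have "(\<Sum>k<?m. \<rho> ^ k) \<le> 1 / (1 - \<rho>)"
  proof -
    have "(\<Sum>k<?m. \<rho> ^ k) = (1 - \<rho> ^ ?m) / (1 - \<rho>)"
      using \<rho> sum_gp_strict[of \<rho> ?m] by (simp)
    also have "\<dots> \<le> 1 / (1 - \<rho>)" using \<rho> by (intro divide_right_mono) auto
    finally show ?thesis .
  qed
  finally show ?thesis using K by (simp add: \<rho>_def)
qed

lemma mean_deficit_bound:
  obtains C where "C > 0" "\<And>n l. 2 \<le> n \<Longrightarrow> l \<le> 1 \<Longrightarrow> mean_deficit n (num_clauses n l) \<le> C"
    "\<And>n l. 2 \<le> n \<Longrightarrow> l > 1 \<Longrightarrow> mean_deficit n (num_clauses n l) \<le> C * l ^ 3"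
proof -
  define C0 :: real where "C0 = 1 + 1 / (1 - exp (- (1 / 1600000000000)))"
  have C0: "C0 > 0" unfolding C0_def by (intro add_pos_nonneg) auto
  define C where "C = 10000000 * 1000000 + C0"
  have up: "mean_deficit n (num_clauses n l) \<le> C * l ^ 3" if "2 \<le> n" "l \<ge> 1" for n l
  proof -
    have l3: "1 \<le> l ^ 3" using that by (intro one_le_power)
    have "mean_deficit n (num_clauses n l) \<le> 10000000 * (1000000 * l ^ 3) + C0"
      using mean_deficit_le[of n l "1000000 * l ^ 3"] that l3 by (simp add: C0_def)
    also have "\<dots> \<le> 10000000 * (1000000 * l ^ 3) + C0 * l ^ 3" using l3 C0 by simp
    finally show ?thesis by (simp add: C_def algebra_simps)
  qed
  show thesis
  proof
    show "C > 0" using C0 by (simp add: C_def)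
    show "mean_deficit n (num_clauses n l) \<le> C" if "2 \<le> n" "l \<le> 1" for n l
      using mean_deficit_mono[OF that(1) num_clauses_mono[OF that(2), of n]] up[OF that(1), of 1] by simp
    show "mean_deficit n (num_clauses n l) \<le> C * l ^ 3" if "2 \<le> n" "l > 1" for n l
      using up that by simp
  qed
qed

text \<open>The all-true assignment satisfies a random clause with probability at least 1/2, since
  negating the literals maps the violated clauses injectively into the satisfied ones; and 1/2 \<ge>
  1/e.\<close>

lemma prob_satisfiable_ge_exp:
  assumes n: "2 \<le> n"
  shows "exp (- real m) \<le> prob_satisfiable n m"
proof -
  let ?A = "{..<n}" and ?\<sigma> = "\<lambda>_ :: nat. True"
  have A: "finite ?A" "card ?A \<ge> 2" using n by auto
  let ?S = "{C \<in> clauses_on ?A. clause_sat ?\<sigma> C}" and ?N = "{C \<in> clauses_on ?A. \<not> clause_sat ?\<sigma> C}"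
  have fin: "finite (clauses_on ?A)" using A by (simp add: card_clauses_on)
  have cl: "real (card (clauses_on ?A)) > 0" using A by (simp add: card_clauses_on)
  have "inj_on (\<lambda>C. neg ` C) ?N" by (rule inj_on_inverseI[where g = "\<lambda>C. neg ` C"]) (simp add: image_image)
  moreover have "(\<lambda>C. neg ` C) ` ?N \<subseteq> ?S"
  proof (rule image_subsetI)
    fix C assume C: "C \<in> ?N"
    then obtain a b where ab: "C = {a, b}" "fst a \<in> ?A" "fst b \<in> ?A" "fst a \<noteq> fst b" by (auto simp: clauses_on_def)
    have "neg ` C \<in> clauses_on ?A" unfolding clauses_on_def mem_Collect_eq
      using ab by (intro exI[of _ "neg a"] exI[of _ "neg b"]) auto
    moreover have "clause_sat ?\<sigma> (neg ` C)" using C ab by (auto simp: clause_sat_iff)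
    ultimately show "neg ` C \<in> ?S" by simp
  qed
  ultimately have "card ?N \<le> card ?S" using fin by (intro card_inj_on_le) auto
  moreover have "card (clauses_on ?A) = card ?S + card ?N"
    using fin by (subst card_Un_disjoint[symmetric]) (auto intro!: arg_cong[of _ _ card])
  ultimately have half: "real (card (clauses_on ?A)) / 2 \<le> real (card ?S)" by simp
  have "exp (- real m) \<le> mean ?A (replicate m 2) (\<lambda>F. if \<forall>C\<in>set F. clause_sat ?\<sigma> C then 1 else 0)"
  proof (induction m)
    case (Suc m)
    let ?h = "\<lambda>F. if \<forall>C\<in>set F. clause_sat ?\<sigma> C then 1 else (0 :: real)"
    let ?e = "mean ?A (replicate m 2) ?h"
    have e0: "?e \<ge> 0" using Suc by (intro order.trans[OF _ Suc]) simp
    have z: "mean ?A ts (\<lambda>F. 0) = 0" for ts by (induction ts) (simp_all add: avg_def)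
    have e1: "exp (-1) \<le> (1 / 2 :: real)"
      using exp_ge_add_one_self[of 1] by (simp add: exp_minus field_simps)
    have "exp (- real (Suc m)) = exp (-1) * exp (- real m)" by (simp flip: exp_add)
    also have "\<dots> \<le> 1 / 2 * ?e" using Suc e0 e1 by (intro mult_mono) auto
    also have "\<dots> \<le> (real (card ?S) / real (card (clauses_on ?A))) * ?e"
      using half cl e0 by (intro mult_right_mono) (auto simp: field_simps)
    also have "\<dots> = avg (clauses_on ?A) (\<lambda>C. if clause_sat ?\<sigma> C then ?e else 0)"
      using fin by (simp add: avg_def flip: sum.inter_filter)
    also have "\<dots> = mean ?A (replicate (Suc m) 2) ?h"
      by (simp add: gen_simps) (intro arg_cong[of _ _ "avg (clauses_on ?A)"], auto simp: z)
    finally show ?case .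
  qed simp
  also have "\<dots> \<le> mean ?A (replicate m 2) (\<lambda>F. if satisfiable F then 1 else 0)"
    by (intro mean_mono) (auto simp: satisfiable_iff)
  also have "\<dots> = prob_satisfiable n m"
    by (simp add: mean_replicate[OF A] prob_satisfiable_def random_formula_eq expectation_indicator)
  finally show ?thesis .
qed

text \<open>Passing to \<open>100 * l\<close> enters the range of the supercritical estimate for all
  \<open>l \<ge> 1\<close> at once, at the price of a factor 100^3 in the exponent.\<close>

lemma prob_satisfiable_bound:
  assumes n: "2 \<le> n"
  shows "l \<ge> 1 \<Longrightarrow> exp (- (10000000000000 * l ^ 3)) \<le> prob_satisfiable n (num_clauses n l)"
proof -
  assume l: "l \<ge> 1"
  define l' where "l' = 100 * l"
  have l': "l' \<ge> 100" "l \<le> l'" "l' ^ 3 = 1000000 * l ^ 3" using l by (auto simp: l'_def power_mult_distrib)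
  have n0: "n > 0" using n by simp
  have "exp (- (10000000 * l' ^ 3)) \<le> prob_satisfiable n (num_clauses n l')"
  proof (cases "dev n l' \<le> 1 / 200")
    case True
    interpret supercritical n "dev n l'" by (rule supercritical_dev[OF l'(1) n0 True])
    have M: "real (num_clauses n l') \<le> (1 + dev n l') * real n"
      using num_clauses_bounds(1)[of n l'] eps by simp
    have "exp (- (10000000 * l' ^ 3)) \<le> exp (- (6000 * l' ^ 3))" using l' l by simp
    also have "\<dots> \<le> prob_satisfiable n (num_clauses n l')"
      using supercritical_sat[OF M] dev_pow3[OF n0, of l']
      by (simp add: random_formula_eq prob_satisfiable_def deficit_eq_0_iff)
    finally show ?thesis .
  next
    case False
    then have "real (num_clauses n l') < 10000000 * l' ^ 3" using num_clauses_le_large_dev[OF l'(1) n0] by simp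
    then have "exp (- (10000000 * l' ^ 3)) \<le> exp (- real (num_clauses n l'))" by simp
    also have "\<dots> \<le> prob_satisfiable n (num_clauses n l')" by (rule prob_satisfiable_ge_exp[OF n])
    finally show ?thesis .
  qed
  also have "\<dots> \<le> prob_satisfiable n (num_clauses n l)"
    using n l' by (intro prob_satisfiable_antimono num_clauses_mono)
  finally show ?thesis using l' by simp
qed

section \<open>Estimates below the threshold and in the window\<close>

lemma subcritical_gap:
  assumes n: "n \<ge> 8" and l: "l \<le> -1" and d: "0 \<le> 1 + dev n l"
  shows "- dev n l / 2 \<le> random_clauses.gap {..<n} (num_clauses n l)"
    "random_clauses.gap {..<n} (num_clauses n l) \<le> - 2 * dev n l" "0 < - dev n l"
    "real n powr (1 / 3) \<le> (dev n l)\<^sup>2 * real n"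
proof -
  interpret random_clauses "{..<n}" "num_clauses n l" using n by unfold_locales auto
  define e where "e = - dev n l"
  have n0: "real n > 0" using n by simp
  define y where "y = real n powr (1 / 3)"
  have y: "y > 0" "y ^ 3 = real n" using n0 by (auto simp: y_def cbrt_pow3)
  have y2: "y \<ge> 2"
  proof (rule power_le_imp_le_base[of 2 2 y])
    show "2 ^ Suc 2 \<le> y ^ Suc 2" using y n by (simp add: numeral_3_eq_3[symmetric])
  qed (use y in simp)
  have "real n powr (- 1 / 3) = 1 / y" using n0 by (simp add: y_def powr_minus_divide)
  then have ey: "e = - l / y" by (simp add: e_def dev_def)
  have e1: "1 / y \<le> e" using l y divide_right_mono[of 1 "- l" y] by (simp add: ey)
  then show e0: "0 < - dev n l" using y by (simp add: e_def[symmetric]) (meson divide_pos_pos less_le_trans zero_less_one)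
  have nm: "real (num_clauses n l) \<le> (1 - e) * real n" "(1 - e) * real n - 1 \<le> real (num_clauses n l)"
    using num_clauses_bounds[OF d] by (auto simp: e_def)
  have cube: "y * y * y = real n" using y by (simp add: power3_eq_cube)
  have yy: "2 * y \<le> real n - 1"
  proof -
    have "4 * y \<le> y * y * y" using y2 mult_mono[of 2 y 2 y] y by (intro mult_right_mono) auto
    then show ?thesis using cube y2 by linarith
  qed
  have n1: "real n - 1 > 0" using n by simp
  have en1: "2 \<le> e * (real n - 1)"
  proof -
    have "1 / y * (2 * y) \<le> e * (real n - 1)" using e1 yy y e0 by (intro mult_mono) (auto simp: e_def)
    then show ?thesis using y by simp
  qed
  have g: "gap (num_clauses n l) = (real n - 1 - real (num_clauses n l)) / (real n - 1)"
    using n1 by (simp add: gap_def diff_divide_distrib)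
  \<comment> \<open>After rounding, the numerator of \<open>gap\<close> lies between P + e - 1 and P
    + e, hence between P/2 and 2P because P \<ge> 2. The latter holds as e \<ge> n^(-1/3) and n
    \<ge> 8.\<close>
  define P where "P = e * (real n - 1)"
  have eP: "e * real n = P + e" by (simp add: P_def algebra_simps)
  have nm': "real n - (P + e) - 1 \<le> real (num_clauses n l)" "real (num_clauses n l) \<le> real n - (P + e)"
    using nm by (simp_all add: left_diff_distrib eP)
  have e01: "0 < e" "e \<le> 1" using e0 d by (simp_all add: e_def)
  have P2: "2 \<le> P" using en1 by (simp add: P_def)
  have "e / 2 * (real n - 1) = P / 2" by (simp add: P_def)
  also have "\<dots> \<le> real n - 1 - real (num_clauses n l)" using nm'(2) P2 e01 by linarith
  finally have "e / 2 * (real n - 1) \<le> real n - 1 - real (num_clauses n l)" .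
  then show "- dev n l / 2 \<le> gap (num_clauses n l)"
    unfolding g using n1 by (simp add: le_divide_eq e_def)
  have "real n - 1 - real (num_clauses n l) \<le> 2 * P" using nm'(1) P2 e01 by linarith
  also have "\<dots> = 2 * e * (real n - 1)" by (simp add: P_def)
  finally have "real n - 1 - real (num_clauses n l) \<le> 2 * e * (real n - 1)" .
  then show "gap (num_clauses n l) \<le> - 2 * dev n l"
    unfolding g using n1 by (simp add: divide_le_eq e_def)
  have "y = (1 / y)\<^sup>2 * real n" using y cube by (simp add: power2_eq_square field_simps)
  also have "\<dots> \<le> e\<^sup>2 * real n" using e1 y by (intro mult_right_mono power_mono) auto
  finally show "real n powr (1 / 3) \<le> (dev n l)\<^sup>2 * real n" by (simp add: e_def y_def)
qed

lemma mean_deficit_subcritical: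
  assumes n: "n \<ge> 8" and l: "l \<le> -1" and d: "0 \<le> 1 + dev n l"
  shows "mean_deficit n (num_clauses n l) \<le> 32768 / \<bar>l\<bar> ^ 3"
proof -
  interpret random_clauses "{..<n}" "num_clauses n l" using n by unfold_locales auto
  note g = subcritical_gap[OF assms]
  have gp: "gap (num_clauses n l) > 0" using g by linarith
  have n0: "real n > 0" using n by simp
  have "mean_deficit n (num_clauses n l) \<le> 4096 / (gap (num_clauses n l) ^ 3 * real n)"
    using subcritical_expected_deficit[OF gp] by (simp add: mean_deficit_def random_formula_eq)
  also have "\<dots> \<le> 4096 / ((- dev n l / 2) ^ 3 * real n)"
    using g n0 by (intro divide_left_mono mult_right_mono power_mono mult_pos_pos zero_less_power gp) auto
  also have "(- dev n l / 2) ^ 3 * real n = \<bar>l\<bar> ^ 3 / 8"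
    using dev_pow3[of n "- l"] n l by (simp add: dev_uminus power_divide)
  finally show ?thesis by simp
qed

text \<open>\<open>prob_unsat_ge\<close> is applied with half of \<kappa>, which leaves room for
  rounding the number of clauses. Since gap is at least half the deviation, gap^3 n is at least
  100^3 / 8 > 22000, and gap^2 n is at least n^(1/3) / 4, which is large enough for large n.\<close>

lemma unsat_lower_bound:
  assumes k: "\<kappa> > 0"
  obtains c N where "c > 0" "\<And>n l. n \<ge> N \<Longrightarrow> l \<le> -100 \<Longrightarrow> clause_density n l \<ge> \<kappa> \<Longrightarrow>
    1 - prob_satisfiable n (num_clauses n l) \<ge> c / \<bar>l\<bar> ^ 3"
proof -
  define k where "k = \<kappa> / 2"
  have k0: "k > 0" using assms by (simp add: k_def)
  define c where "c = exp (- 5 / k) / 4096 / 8"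
  define N where "N = nat \<lceil>max (1 + 1 / k) ((240 / k) ^ 3)\<rceil> + 8"
  have "1 - prob_satisfiable n (num_clauses n l) \<ge> c / \<bar>l\<bar> ^ 3" if n: "n \<ge> N" and l: "l \<le> -100" and dn: "clause_density n l \<ge> \<kappa>" for n l
  proof -
    have n8: "n \<ge> 8" using n by (simp add: N_def)
    have "max (1 + 1 / k) ((240 / k) ^ 3) \<le> real N" unfolding N_def by linarith
    also have "\<dots> \<le> real n" using n by simp
    finally have nb: "1 + 1 / k \<le> real n" "(240 / k) ^ 3 \<le> real n" by auto
    have dev: "1 + dev n l \<ge> 2 * k" using dn by (simp add: clause_density_def dev_def k_def)
    then have d0: "0 \<le> 1 + dev n l" using k0 by simp
    interpret random_clauses "{..<n}" "num_clauses n l" using n8 by unfold_locales auto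
    have l1: "l \<le> -1" using l by simp
    note g = subcritical_gap[OF n8 l1 d0]
    define G where "G = gap (num_clauses n l)"
    have n0: "real n > 0" using n8 by simp
    have Gp: "G > 0" using g by (simp add: G_def)
    have l3: "(- dev n l) ^ 3 * real n = \<bar>l\<bar> ^ 3"
      using dev_pow3[of n "- l"] n8 l by (simp add: dev_uminus)
    have "1000000 \<le> \<bar>l\<bar> ^ 3" using power_mono[of 100 "\<bar>l\<bar>" 3] l by simp
    moreover have "\<bar>l\<bar> ^ 3 / 8 \<le> G ^ 3 * real n"
    proof -
      have "(- dev n l / 2) ^ 3 * real n \<le> G ^ 3 * real n"
        using g n0 by (intro mult_right_mono power_mono) (auto simp: G_def)
      then show ?thesis using l3 by (simp add: power_divide)
    qed
    ultimately have c1: "G ^ 3 * real n \<ge> 22000" by linarith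
    have c2: "G\<^sup>2 * k * real n \<ge> 60"
    proof -
      have "240 / k \<le> real n powr (1 / 3)"
        using k0 nb(2) n0 cbrt_pow3[of "real n"]
        by (intro power_le_imp_le_base[of "240 / k" 2]) (auto simp: numeral_3_eq_3[symmetric])
      also have "\<dots> \<le> (dev n l)\<^sup>2 * real n" by (rule g(4))
      also have "\<dots> = 4 * ((- dev n l / 2)\<^sup>2 * real n)" by (simp add: power_divide)
      also have "\<dots> \<le> 4 * (G\<^sup>2 * real n)"
        using g n0 by (intro mult_left_mono mult_right_mono power_mono) (auto simp: G_def)
      finally show ?thesis using k0 by (simp add: divide_le_eq mult_ac)
    qed
    have c3: "G \<le> 1 - k"
    proof -
      have n1: "real n - 1 > 0" using n8 by simp
      have "2 * k * real n \<le> (1 + dev n l) * real n" using dev n0 by (intro mult_right_mono) auto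
      then have "2 * k * real n - 1 \<le> real (num_clauses n l)" using num_clauses_bounds(2)[OF d0] by linarith
      moreover have "1 \<le> k * (real n - 1)" using nb(1) k0 by (simp add: field_simps)
      ultimately have "k * (real n - 1) \<le> real (num_clauses n l)" using k0 by (simp add: algebra_simps)
      then have "k \<le> real (num_clauses n l) / (real n - 1)" using n1 by (simp add: le_divide_eq)
      then show ?thesis by (simp add: G_def gap_def)
    qed
    have "exp (- 5 / k) / 4096 / (G ^ 3 * real n) \<le> pr unsat"
      using prob_unsat_ge[of k] k0 c1 c2 c3 Gp by (simp add: G_def)
    also have "\<dots> \<le> 1 - prob_satisfiable n (num_clauses n l)"
    proof -
      have "pr unsat \<le> pr {f. map f [0..<num_clauses n l] \<in> {F. 1 \<le> deficit F}}"
      proof (rule pr_mono)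
        fix f assume f: "f \<in> unsat"
        obtain \<sigma> where s: "num_unsat \<sigma> (map f [0..<num_clauses n l]) = deficit (map f [0..<num_clauses n l])"
          using deficit_attained by blast
        obtain p where "p < num_clauses n l" "\<not> clause_sat \<sigma> (f p)" using f by (auto simp: unsat_def)
        then have "f p \<in> set (filter (\<lambda>C. \<not> clause_sat \<sigma> C) (map f [0..<num_clauses n l]))" by simp
        then have "num_unsat \<sigma> (map f [0..<num_clauses n l]) \<noteq> 0" unfolding num_unsat_def by (metis length_0_conv list.set(1) empty_iff)
        then show "f \<in> {f. map f [0..<num_clauses n l] \<in> {F. 1 \<le> deficit F}}" using s by simp
      qed
      then show ?thesis by (simp add: prob_unsat_eq random_formula_eq prob_random_cnf)
    qed
    finally have main: "exp (- 5 / k) / 4096 / (G ^ 3 * real n) \<le> 1 - prob_satisfiable n (num_clauses n l)" .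
    have "G ^ 3 * real n \<le> (2 * (- dev n l)) ^ 3 * real n"
      using g Gp n0 by (intro mult_right_mono power_mono) (auto simp: G_def)
    also have "\<dots> = 8 * ((- dev n l) ^ 3 * real n)" unfolding power_mult_distrib by simp
    also have "\<dots> = 8 * \<bar>l\<bar> ^ 3" by (simp only: l3)
    finally have "exp (- 5 / k) / 4096 / (8 * \<bar>l\<bar> ^ 3) \<le> exp (- 5 / k) / 4096 / (G ^ 3 * real n)"
    proof (rule divide_left_mono)
      have "0 < G ^ 3 * real n" using Gp n0 by simp
      moreover have "0 < 8 * \<bar>l\<bar> ^ 3" using l by simp
      ultimately show "0 < 8 * \<bar>l\<bar> ^ 3 * (G ^ 3 * real n)" by (rule mult_pos_pos[rotated])
    qed simp_all
    then show ?thesis using main by (simp add: c_def)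
  qed
  moreover have "c > 0" by (simp add: c_def)
  ultimately show thesis using that by blast
qed

text \<open>Monotonicity in the number of clauses carries the bound at \<open>l = -100\<close> to
  all larger \<open>l\<close>. For n \<ge> 8000000 the density there is at least 1/2.\<close>

lemma unsat_window:
  obtains c N where "c > 0" "\<And>n l. n \<ge> N \<Longrightarrow> l \<ge> -100 \<Longrightarrow> 1 - prob_satisfiable n (num_clauses n l) \<ge> c"
proof -
  obtain c N where c: "c > 0" and N: "\<And>n l. n \<ge> N \<Longrightarrow> l \<le> -100 \<Longrightarrow> clause_density n l \<ge> 1 / 2 \<Longrightarrow>
    1 - prob_satisfiable n (num_clauses n l) \<ge> c / \<bar>l\<bar> ^ 3"
    using unsat_lower_bound[of "1 / 2"] by auto
  have "1 - prob_satisfiable n (num_clauses n l) \<ge> c / 1000000" if n: "n \<ge> max N 8000000" and l: "l \<ge> -100" for n l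
  proof -
    have "(200 :: real) \<le> real n powr (1 / 3)"
      using n cbrt_pow3[of "real n"] by (intro power_le_imp_le_base[of 200 2]) (auto simp: numeral_3_eq_3[symmetric])
    then have "real n powr (- 1 / 3) \<le> 1 / 200" using n by (simp add: powr_minus_divide divide_le_eq)
    then have "clause_density n (-100) \<ge> 1 / 2" by (simp add: clause_density_def)
    then have "c / 1000000 \<le> 1 - prob_satisfiable n (num_clauses n (-100))" using N[of n "-100"] n by simp
    also have "\<dots> \<le> 1 - prob_satisfiable n (num_clauses n l)"
      using prob_satisfiable_antimono[OF _ num_clauses_mono[OF l], of n] n by simp
    finally show ?thesis .
  qed
  then show thesis using that[of "c / 1000000" "max N 8000000"] c by simp
qed

section \<open>Passage to Landau symbols\<close>

lemma bigo_regime: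
  assumes "\<And>n l. n \<ge> N \<Longrightarrow> R n l \<Longrightarrow> \<bar>f n l\<bar> \<le> C * \<bar>g n l\<bar>"
  shows "(\<lambda>(n, l). f n l :: real) \<in> O[regime R](\<lambda>(n, l). g n l :: real)"
  by (rule bigoI[of _ C]) (use assms in \<open>auto simp: eventually_regime\<close>)

lemma bigtheta_regime:
  assumes "c > 0" "\<And>n l. n \<ge> N \<Longrightarrow> R n l \<Longrightarrow> c * \<bar>g n l\<bar> \<le> \<bar>f n l\<bar> \<and> \<bar>f n l\<bar> \<le> C * \<bar>g n l\<bar>"
  shows "(\<lambda>(n, l). f n l :: real) \<in> \<Theta>[regime R](\<lambda>(n, l). g n l :: real)"
proof (rule bigthetaI)
  show "(\<lambda>(n, l). f n l) \<in> O[regime R](\<lambda>(n, l). g n l)" using assms(2) by (intro bigo_regime) auto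
  show "(\<lambda>(n, l). f n l) \<in> \<Omega>[regime R](\<lambda>(n, l). g n l)"
    by (rule landau_omega.bigI[OF assms(1)]) (use assms(2) in \<open>auto simp: eventually_regime\<close>)
qed

lemma prob_satisfiable_le_1: "prob_satisfiable n m \<le> 1" and prob_satisfiable_nonneg: "0 \<le> prob_satisfiable n m"
  by (simp_all add: prob_satisfiable_def)

lemma mean_deficit_nonneg: "2 \<le> n \<Longrightarrow> 0 \<le> mean_deficit n m"
  using prob_unsat_le_mean[of n m] prob_satisfiable_le_1[of n m] by linarith

text \<open>For \<open>l\<close> between -100 and -1 the lower bound comes from the window, as the
  third power of 1 / \<bar>l\<bar> is at most 1.\<close>

lemma subcritical_bounds:
  assumes "\<kappa> > 0"
  obtains c N where "c > 0" "N \<ge> 8" "\<And>n l. n \<ge> N \<Longrightarrow> l < -1 \<Longrightarrow> clause_density n l \<ge> \<kappa> \<Longrightarrow>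
    c * \<bar>\<bar>l\<bar> powi (-3)\<bar> \<le> 1 - prob_satisfiable n (num_clauses n l) \<and>
    mean_deficit n (num_clauses n l) \<le> 32768 * \<bar>\<bar>l\<bar> powi (-3)\<bar>"
proof -
  obtain c1 N1 where c1: "c1 > 0" and N1: "\<And>n l. n \<ge> N1 \<Longrightarrow> l \<le> -100 \<Longrightarrow> clause_density n l \<ge> \<kappa> \<Longrightarrow>
    1 - prob_satisfiable n (num_clauses n l) \<ge> c1 / \<bar>l\<bar> ^ 3"
    using unsat_lower_bound[OF assms] by blast
  obtain c2 N2 where c2: "c2 > 0" and N2: "\<And>n l. n \<ge> N2 \<Longrightarrow> l \<ge> -100 \<Longrightarrow> 1 - prob_satisfiable n (num_clauses n l) \<ge> c2"
    using unsat_window by blast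
  have pw: "\<bar>\<bar>l\<bar> powi (-3)\<bar> = 1 / \<bar>l\<bar> ^ 3" for l :: real
    by (simp add: power_int_minus divide_inverse power_inverse)
  define N where "N = max 8 (max N1 N2)"
  show thesis
  proof
    show "min c1 c2 > 0" using c1 c2 by simp
    show "N \<ge> 8" by (simp add: N_def)
    fix n l assume n: "n \<ge> N" and l: "l < -1" and d: "clause_density n l \<ge> \<kappa>"
    have d0: "0 \<le> 1 + dev n l" using d assms by (simp add: clause_density_def dev_def)
    have l3: "1 \<le> \<bar>l\<bar> ^ 3" using l by (intro one_le_power) auto
    have "min c1 c2 * (1 / \<bar>l\<bar> ^ 3) \<le> 1 - prob_satisfiable n (num_clauses n l)"
    proof (cases "l \<le> -100")
      case True
      have "min c1 c2 * (1 / \<bar>l\<bar> ^ 3) \<le> c1 * (1 / \<bar>l\<bar> ^ 3)" by (intro mult_right_mono) auto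
      then show ?thesis using N1[of n l] n True d by (simp add: N_def)
    next
      case False
      have "min c1 c2 * (1 / \<bar>l\<bar> ^ 3) \<le> c2 * 1" using c1 c2 l3 by (intro mult_mono) (auto simp: divide_le_eq)
      then show ?thesis using N2[of n l] n False by (simp add: N_def)
    qed
    moreover have "mean_deficit n (num_clauses n l) \<le> 32768 * (1 / \<bar>l\<bar> ^ 3)"
      using mean_deficit_subcritical[of n l] n l d0 by (simp add: N_def)
    ultimately show "min c1 c2 * \<bar>\<bar>l\<bar> powi (-3)\<bar> \<le> 1 - prob_satisfiable n (num_clauses n l) \<and>
        mean_deficit n (num_clauses n l) \<le> 32768 * \<bar>\<bar>l\<bar> powi (-3)\<bar>"
      unfolding pw by blast
  qed
qed

lemma tail_bound_beta:
  assumes b0: "\<beta>\<^sub>0 > 0"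
  shows "\<exists>C>0. \<forall>\<beta>\<ge>\<beta>\<^sub>0. \<forall>n\<ge>2. \<forall>l>1.
        measure_pmf.prob (random_formula n (num_clauses n l))
          {F. real (num_clauses n l) - real (max_sat F) > C * \<beta> * l ^ 3}
        \<le> exp (- \<beta> * l ^ 3)"
proof -
  \<comment> \<open>160000 cancels the denominator in the exponent of
    \<open>deficit_tail_scaled\<close>, and \<open>1000000 / \<beta>\<^sub>0\<close> makes the scale
    at least 1000000 l^3 for every admissible \<beta>.\<close>
  define D where "D = max 160000 (1000000 / \<beta>\<^sub>0)"
  have D: "D \<ge> 160000" "D * \<beta>\<^sub>0 \<ge> 1000000"
    using b0 mult_right_mono[of "1000000 / \<beta>\<^sub>0" D \<beta>\<^sub>0] by (auto simp: D_def)
  show ?thesis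
  proof (rule exI[of _ "10000000 * D"], intro conjI allI impI)
    show "10000000 * D > 0" using D by simp
    fix \<beta> n l assume b: "\<beta> \<ge> \<beta>\<^sub>0" and n: "(2 :: nat) \<le> n" and l: "(1 :: real) < l"
    define s where "s = D * \<beta> * l ^ 3"
    have l3: "1 \<le> l ^ 3" using l by (intro one_le_power) auto
    have "D * \<beta>\<^sub>0 \<le> D * \<beta>" using D b by (intro mult_left_mono) auto
    then have Db: "D * \<beta> \<ge> 1000000" using D by linarith
    have "1000000 * l ^ 3 \<le> s" unfolding s_def using Db l l3 by (intro mult_right_mono) auto
    then have s1: "l ^ 3 \<le> s" "1000000 \<le> s" using l3 by linarith+
    have "measure_pmf.prob (random_formula n (num_clauses n l)) {F. real (num_clauses n l) - real (max_sat F) > 10000000 * D * \<beta> * l ^ 3}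
      = measure_pmf.prob (random_formula n (num_clauses n l))
        ({F. real (num_clauses n l) - real (max_sat F) > 10000000 * D * \<beta> * l ^ 3} \<inter> set_pmf (random_formula n (num_clauses n l)))"
      by (simp add: measure_Int_set_pmf)
    also have "\<dots> \<le> measure_pmf.prob (random_formula n (num_clauses n l)) {F. 10000000 * s \<le> real (deficit F)}"
    proof (rule measure_pmf.finite_measure_mono, rule subsetI)
      fix F assume F: "F \<in> {F. real (num_clauses n l) - real (max_sat F) > 10000000 * D * \<beta> * l ^ 3} \<inter> set_pmf (random_formula n (num_clauses n l))"
      then have "length F = num_clauses n l" using random_formula_support(2)[OF n] by blast
      then show "F \<in> {F. 10000000 * s \<le> real (deficit F)}" using F real_deficit[of F] by (simp add: s_def)
    qed simp
    also have "\<dots> \<le> exp (- (s / 160000))"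
      using n l l3 s1 by (intro deficit_tail_scaled) auto
    also have "\<dots> \<le> exp (- \<beta> * l ^ 3)"
    proof -
      have "160000 * (\<beta> * l ^ 3) \<le> D * (\<beta> * l ^ 3)" using D b b0 l l3 by (intro mult_right_mono mult_nonneg_nonneg) auto
      then show ?thesis by (simp add: s_def)
    qed
    finally show "measure_pmf.prob (random_formula n (num_clauses n l))
          {F. real (num_clauses n l) - real (max_sat F) > 10000000 * D * \<beta> * l ^ 3} \<le> exp (- \<beta> * l ^ 3)" .
  qed
qed

theorem theorem6:
  shows
    "((\<lambda>(n, l). real (num_clauses n l) - expected_max_sat n (num_clauses n l))
        \<in> O[regime (\<lambda>n l. l > 1)](\<lambda>(n, l). l ^ 3)) \<and>
     ((\<lambda>(n, l). real (num_clauses n l) - expected_max_sat n (num_clauses n l))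
        \<in> \<Theta>[regime (\<lambda>n l. -1 \<le> l \<and> l \<le> 1)](\<lambda>_. 1)) \<and>
     (\<forall>\<kappa>>0. (\<lambda>(n, l). real (num_clauses n l) - expected_max_sat n (num_clauses n l))
        \<in> \<Theta>[regime (\<lambda>n l. l < -1 \<and> clause_density n l \<ge> \<kappa>)](\<lambda>(n, l). \<bar>l\<bar> powi (-3))) \<and>
     (\<forall>\<beta>\<^sub>0>0. \<exists>C>0. \<forall>\<beta>\<ge>\<beta>\<^sub>0. \<forall>n\<ge>2. \<forall>l>1.
        measure_pmf.prob (random_formula n (num_clauses n l))
          {F. real (num_clauses n l) - real (max_sat F) > C * \<beta> * l ^ 3}
        \<le> exp (- \<beta> * l ^ 3)) \<and>
     (\<exists>g \<in> O[regime (\<lambda>n l. l > 1)](\<lambda>(n, l). l ^ 3).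
        \<forall>\<^sub>F (n, l) in regime (\<lambda>n l. l > 1).
          prob_satisfiable n (num_clauses n l) = exp (- g (n, l))) \<and>
     ((\<lambda>(n, l). prob_satisfiable n (num_clauses n l))
        \<in> \<Theta>[regime (\<lambda>n l. -1 \<le> l \<and> l < 1)](\<lambda>_. 1)) \<and>
     (\<forall>\<kappa>>0. (\<lambda>(n, l). 1 - prob_satisfiable n (num_clauses n l))
        \<in> \<Theta>[regime (\<lambda>n l. l < -1 \<and> clause_density n l \<ge> \<kappa>)](\<lambda>(n, l). \<bar>l\<bar> powi (-3)))"
proof -
  obtain C where C: "C > 0" and C1: "\<And>n l. 2 \<le> n \<Longrightarrow> l \<le> 1 \<Longrightarrow> mean_deficit n (num_clauses n l) \<le> C"
    and C3: "\<And>n l. 2 \<le> n \<Longrightarrow> l > 1 \<Longrightarrow> mean_deficit n (num_clauses n l) \<le> C * l ^ 3"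
    using mean_deficit_bound by metis
  obtain c N where c: "c > 0" and N: "\<And>n l. n \<ge> N \<Longrightarrow> l \<ge> -100 \<Longrightarrow> 1 - prob_satisfiable n (num_clauses n l) \<ge> c"
    using unsat_window by blast
  have one: "(\<lambda>_ :: nat \<times> real. 1 :: real) = (\<lambda>(n, l). 1)" by auto
  have "(\<lambda>(n, l). real (num_clauses n l) - expected_max_sat n (num_clauses n l)) \<in> O[regime (\<lambda>n l. l > 1)](\<lambda>(n, l). l ^ 3)"
  proof (rule bigo_regime[of 2 _ _ C])
    fix n :: nat and l :: real assume n: "2 \<le> n" and l: "l > 1"
    show "\<bar>real (num_clauses n l) - expected_max_sat n (num_clauses n l)\<bar> \<le> C * \<bar>l ^ 3\<bar>"
      using C3[OF n l] mean_deficit_nonneg[OF n, of "num_clauses n l"] l by (simp add: mean_deficit_eq[OF n])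
  qed
  moreover have "(\<lambda>(n, l). real (num_clauses n l) - expected_max_sat n (num_clauses n l))
      \<in> \<Theta>[regime (\<lambda>n l. -1 \<le> l \<and> l \<le> 1)](\<lambda>_. 1)"
    unfolding one
  proof (rule bigtheta_regime[OF c, of "max N 2" _ _ _ C])
    fix n :: nat and l :: real assume n: "max N 2 \<le> n" and l: "-1 \<le> l \<and> l \<le> 1"
    have n2: "2 \<le> n" "N \<le> n" using n by auto
    show "c * \<bar>1\<bar> \<le> \<bar>real (num_clauses n l) - expected_max_sat n (num_clauses n l)\<bar> \<and>
        \<bar>real (num_clauses n l) - expected_max_sat n (num_clauses n l)\<bar> \<le> C * \<bar>1\<bar>"
      using C1[OF n2(1), of l] N[OF n2(2), of l] prob_unsat_le_mean[OF n2(1), of "num_clauses n l"]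
        mean_deficit_nonneg[OF n2(1), of "num_clauses n l"] l
      by (simp add: mean_deficit_eq[OF n2(1)])
  qed
  moreover have "(\<lambda>(n, l). real (num_clauses n l) - expected_max_sat n (num_clauses n l))
      \<in> \<Theta>[regime (\<lambda>n l. l < -1 \<and> clause_density n l \<ge> \<kappa>)](\<lambda>(n, l). \<bar>l\<bar> powi (-3))"
    and "(\<lambda>(n, l). 1 - prob_satisfiable n (num_clauses n l))
      \<in> \<Theta>[regime (\<lambda>n l. l < -1 \<and> clause_density n l \<ge> \<kappa>)](\<lambda>(n, l). \<bar>l\<bar> powi (-3))" if k: "\<kappa> > 0" for \<kappa>
  proof -
    obtain c' N' where c': "c' > 0" and N8: "N' \<ge> 8" and N': "\<And>n l. n \<ge> N' \<Longrightarrow> l < -1 \<Longrightarrow> clause_density n l \<ge> \<kappa> \<Longrightarrow>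
      c' * \<bar>\<bar>l\<bar> powi (-3)\<bar> \<le> 1 - prob_satisfiable n (num_clauses n l) \<and>
      mean_deficit n (num_clauses n l) \<le> 32768 * \<bar>\<bar>l\<bar> powi (-3)\<bar>"
      using subcritical_bounds[OF k] by blast
    have bounds: "c' * \<bar>\<bar>l\<bar> powi (-3)\<bar> \<le> \<bar>mean_deficit n (num_clauses n l)\<bar> \<and>
        \<bar>mean_deficit n (num_clauses n l)\<bar> \<le> 32768 * \<bar>\<bar>l\<bar> powi (-3)\<bar> \<and>
        c' * \<bar>\<bar>l\<bar> powi (-3)\<bar> \<le> \<bar>1 - prob_satisfiable n (num_clauses n l)\<bar> \<and>
        \<bar>1 - prob_satisfiable n (num_clauses n l)\<bar> \<le> 32768 * \<bar>\<bar>l\<bar> powi (-3)\<bar>"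
      and n2: "2 \<le> n" if n: "n \<ge> N'" and l: "l < -1 \<and> clause_density n l \<ge> \<kappa>" for n l
    proof -
      show n2: "2 \<le> n" using n N8 by simp
      have b: "c' * \<bar>\<bar>l\<bar> powi (-3)\<bar> \<le> 1 - prob_satisfiable n (num_clauses n l)"
        "mean_deficit n (num_clauses n l) \<le> 32768 * \<bar>\<bar>l\<bar> powi (-3)\<bar>"
        using N'[OF n] l by blast+
      have "\<bar>mean_deficit n (num_clauses n l)\<bar> = mean_deficit n (num_clauses n l)"
        using mean_deficit_nonneg[OF n2] by simp
      moreover have "\<bar>1 - prob_satisfiable n (num_clauses n l)\<bar> = 1 - prob_satisfiable n (num_clauses n l)"
        using prob_satisfiable_le_1 by simp
      ultimately show "c' * \<bar>\<bar>l\<bar> powi (-3)\<bar> \<le> \<bar>mean_deficit n (num_clauses n l)\<bar> \<and>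
          \<bar>mean_deficit n (num_clauses n l)\<bar> \<le> 32768 * \<bar>\<bar>l\<bar> powi (-3)\<bar> \<and>
          c' * \<bar>\<bar>l\<bar> powi (-3)\<bar> \<le> \<bar>1 - prob_satisfiable n (num_clauses n l)\<bar> \<and>
          \<bar>1 - prob_satisfiable n (num_clauses n l)\<bar> \<le> 32768 * \<bar>\<bar>l\<bar> powi (-3)\<bar>"
        using b prob_unsat_le_mean[OF n2, of "num_clauses n l"] by linarith
    qed
    show "(\<lambda>(n, l). real (num_clauses n l) - expected_max_sat n (num_clauses n l))
        \<in> \<Theta>[regime (\<lambda>n l. l < -1 \<and> clause_density n l \<ge> \<kappa>)](\<lambda>(n, l). \<bar>l\<bar> powi (-3))"
    proof (rule bigtheta_regime[OF c', of N' _ _ _ 32768])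
      fix n l assume n: "N' \<le> n" and l: "l < -1 \<and> clause_density n l \<ge> \<kappa>"
      show "c' * \<bar>\<bar>l\<bar> powi (-3)\<bar> \<le> \<bar>real (num_clauses n l) - expected_max_sat n (num_clauses n l)\<bar> \<and>
          \<bar>real (num_clauses n l) - expected_max_sat n (num_clauses n l)\<bar> \<le> 32768 * \<bar>\<bar>l\<bar> powi (-3)\<bar>"
        unfolding mean_deficit_eq[OF n2[OF n l]] using bounds[OF n l] by blast
    qed
    show "(\<lambda>(n, l). 1 - prob_satisfiable n (num_clauses n l))
        \<in> \<Theta>[regime (\<lambda>n l. l < -1 \<and> clause_density n l \<ge> \<kappa>)](\<lambda>(n, l). \<bar>l\<bar> powi (-3))"
      by (rule bigtheta_regime[OF c', of N' _ _ _ 32768]) (use bounds in blast)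
  qed
  moreover have "\<exists>g \<in> O[regime (\<lambda>n l. l > 1)](\<lambda>(n, l). l ^ 3).
        \<forall>\<^sub>F (n, l) in regime (\<lambda>n l. l > 1).
          prob_satisfiable n (num_clauses n l) = exp (- g (n, l))"
  proof (rule bexI[of _ "\<lambda>(n, l). - ln (prob_satisfiable n (num_clauses n l))"])
    have pos: "0 < prob_satisfiable n (num_clauses n l)"
      "- ln (prob_satisfiable n (num_clauses n l)) \<le> 10000000000000 * l ^ 3"
      if n: "2 \<le> n" and l: "l > 1" for n l
    proof -
      have b: "exp (- (10000000000000 * l ^ 3)) \<le> prob_satisfiable n (num_clauses n l)"
        using prob_satisfiable_bound[OF n] l by simp
      then show p: "0 < prob_satisfiable n (num_clauses n l)" by (rule less_le_trans[rotated]) simp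
      show "- ln (prob_satisfiable n (num_clauses n l)) \<le> 10000000000000 * l ^ 3"
        using b p by (simp add: ln_ge_iff[symmetric])
    qed
    show "\<forall>\<^sub>F (n, l) in regime (\<lambda>n l. l > 1). prob_satisfiable n (num_clauses n l) =
        exp (- (case (n, l) of (n, l) \<Rightarrow> - ln (prob_satisfiable n (num_clauses n l))))"
      unfolding eventually_regime using pos(1) by (intro exI[of _ 2]) auto
    show "(\<lambda>(n, l). - ln (prob_satisfiable n (num_clauses n l))) \<in> O[regime (\<lambda>n l. l > 1)](\<lambda>(n, l). l ^ 3)"
    proof (rule bigo_regime[of 2 _ _ 10000000000000])
      fix n :: nat and l :: real assume n: "2 \<le> n" and l: "l > 1"
      have "ln (prob_satisfiable n (num_clauses n l)) \<le> 0" using pos(1)[OF n l] prob_satisfiable_le_1 by simp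
      then show "\<bar>- ln (prob_satisfiable n (num_clauses n l))\<bar> \<le> 10000000000000 * \<bar>l ^ 3\<bar>"
        using pos(2)[OF n l] l by simp
    qed
  qed
  moreover have "(\<lambda>(n, l). prob_satisfiable n (num_clauses n l)) \<in> \<Theta>[regime (\<lambda>n l. -1 \<le> l \<and> l < 1)](\<lambda>_. 1)"
    unfolding one
  proof (rule bigtheta_regime[of "exp (- 10000000000000)" 2 _ _ _ 1])
    fix n :: nat and l :: real assume n: "2 \<le> n" and l: "-1 \<le> l \<and> l < 1"
    have "exp (- 10000000000000) \<le> prob_satisfiable n (num_clauses n 1)" using prob_satisfiable_bound[OF n, of 1] by simp
    also have "\<dots> \<le> prob_satisfiable n (num_clauses n l)"
      using l by (intro prob_satisfiable_antimono[OF n] num_clauses_mono) auto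
    finally show "exp (- 10000000000000) * \<bar>1\<bar> \<le> \<bar>prob_satisfiable n (num_clauses n l)\<bar> \<and>
        \<bar>prob_satisfiable n (num_clauses n l)\<bar> \<le> 1 * \<bar>1\<bar>"
      using prob_satisfiable_nonneg[of n "num_clauses n l"] prob_satisfiable_le_1[of n "num_clauses n l"] by simp
  qed simp
  moreover note tail_bound_beta
  ultimately show ?thesis by blast
qed

end
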